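(* Let $\alpha>-1$ and let $\varphi\ge0$ be in $L^\infty(\omega_\alpha)$. The following are equivalent: (1) the Toeplitz operator $\mathbb{T}_\varphi$ is invertible on $L_a^2(\omega_\alpha)$; (2) the Berezin transform $\widehat{\varphi}$ is invertible in $L^\infty(\omega_\alpha)$, where $$\widehat{\varphi}(z)=\frac{1}{\|K^\alpha_z\|^2_{L^2(\omega_\alpha)}}\int_{\mathbb{D}}\varphi(\lambda)|K^\alpha_z(\lambda)|^2\omega_\alpha(\lambda)\,dA(\lambda);$$ (3) there exists $r>0$ such that, with $G:=\{z\in\mathbb{D}:\varphi(z)>r\}$, $\chi_G\,dA$ is a reverse Carleson measure for $L_a^2(\omega_\alpha)$; (4) there exist $r>0$ and $\delta\in(0,1)$ such that, with $G:=\{z\in\mathbb{D}:\varphi(z)>r\}$, $$|G\cap K|\ge\delta|\mathbb{D}\cap K|$$ for every ball $K$ whose center lies on $\partial\mathbb{D}$; (5) there exists a constant $C>0$ such that $$\int_{\mathbb{D}}|f(z)|^2\varphi(z)\omega_\alpha(z)\,dA(z)\ge C\int_{\mathbb{D}}|f(z)|^2\omega_\alpha(z)\,dA(z)$$ for all $f\in L_a^2(\omega_\alpha)$.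
   Context: $\mathbb{D}$ is the open unit disk in $\mathbb{C}$, $dA$ is Lebesgue area measure on $\mathbb{D}$ normalized so that $\mathbb{D}$ has measure $1$, and $|E|$ is the $dA$-measure of $E\subset\mathbb{D}$. For $\alpha>-1$, $\omega_\alpha(z)=(1+\alpha)(1-|z|^2)^\alpha$. $L^\infty(\omega_\alpha)$ is the algebra of essentially bounded measurable functions on $\mathbb{D}$. $L_a^2(\omega_\alpha)$ is the Hilbert space of analytic functions on $\mathbb{D}$ with $\|f\|^2_{L^2(\omega_\alpha)}=\int_{\mathbb{D}}|f|^2\omega_\alpha\,dA<\infty$; its reproducing kernel is $K_z^\alpha(\lambda)=(1-\overline{z}\lambda)^{-(2+\alpha)}$. For bounded $\varphi$, $\mathbb{T}_\varphi f=P(\varphi f)$, where $P$ is the orthogonal projection from $L^2(\omega_\alpha)$ onto $L_a^2(\omega_\alpha)$. For a measurable $G\subset\mathbb{D}$, $\chi_G\,dA$ is a reverse Carleson measure for $L_a^2(\omega_\alpha)$ if there is a constant $C>0$ such that $\int_{\mathbb{D}}|f|^2\omega_\alpha\,dA\le C\int_G|f|^2\omega_\alpha\,dA$ for all $f\in L_a^2(\omega_\alpha)$. *)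

theory Defs
  imports "HOL-Complex_Analysis.Complex_Analysis"
begin

abbreviation disk :: "complex set" where
  "disk \<equiv> ball 0 1"

definition area :: "complex measure" where
  "area = density (lebesgue_on disk) (\<lambda>_. ennreal (1 / pi))"

definition omega :: "real \<Rightarrow> complex \<Rightarrow> real" where
  "omega \<alpha> z = (1 + \<alpha>) * (1 - (cmod z)\<^sup>2) powr \<alpha>"

text \<open>The measure \<open>omega \<alpha> dA\<close>; its underlying space is the disk.\<close>

definition weighted_area :: "real \<Rightarrow> complex measure" where
  "weighted_area \<alpha> = density area (\<lambda>z. ennreal (omega \<alpha> z))"

definition L2 :: "real \<Rightarrow> (complex \<Rightarrow> complex) set" where
  "L2 \<alpha> = {f \<in> borel_measurable (weighted_area \<alpha>).
            integrable (weighted_area \<alpha>) (\<lambda>z. (cmod (f z))\<^sup>2)}"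

definition L2_inner :: "real \<Rightarrow> (complex \<Rightarrow> complex) \<Rightarrow> (complex \<Rightarrow> complex) \<Rightarrow> complex" where
  "L2_inner \<alpha> f g = (LINT z|weighted_area \<alpha>. f z * cnj (g z))"

definition L2_norm :: "real \<Rightarrow> (complex \<Rightarrow> complex) \<Rightarrow> real" where
  "L2_norm \<alpha> f = sqrt (LINT z|weighted_area \<alpha>. (cmod (f z))\<^sup>2)"

text \<open>An analytic function on the disk is represented by its extension by zero to the whole
  plane, so that equality of functions on the disk becomes equality in HOL.\<close>

definition bergman :: "real \<Rightarrow> (complex \<Rightarrow> complex) set" where
  "bergman \<alpha> = {f \<in> L2 \<alpha>. f holomorphic_on disk \<and> (\<forall>z. z \<notin> disk \<longrightarrow> f z = 0)}"

text \<open>The reproducing kernel \<open>K z\<close>, as a function of \<open>w\<close>. For \<open>z\<close> and \<open>w\<close> in the disk the base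
  has positive real part, so the principal branch is the intended one.\<close>

definition bergman_kernel :: "real \<Rightarrow> complex \<Rightarrow> complex \<Rightarrow> complex" where
  "bergman_kernel \<alpha> z w = (1 - cnj z * w) powr (- complex_of_real (2 + \<alpha>))"

definition bergman_projection :: "real \<Rightarrow> (complex \<Rightarrow> complex) \<Rightarrow> complex \<Rightarrow> complex" where
  "bergman_projection \<alpha> f =
     (THE h. h \<in> bergman \<alpha> \<and> (\<forall>g\<in>bergman \<alpha>. L2_inner \<alpha> (\<lambda>z. f z - h z) g = 0))"

definition toeplitz ::
  "real \<Rightarrow> (complex \<Rightarrow> complex) \<Rightarrow> (complex \<Rightarrow> complex) \<Rightarrow> complex \<Rightarrow> complex" where
  "toeplitz \<alpha> \<phi> f = bergman_projection \<alpha> (\<lambda>z. \<phi> z * f z)"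

definition bounded_operator :: "real \<Rightarrow> ((complex \<Rightarrow> complex) \<Rightarrow> complex \<Rightarrow> complex) \<Rightarrow> bool" where
  "bounded_operator \<alpha> T \<longleftrightarrow>
     (\<forall>f\<in>bergman \<alpha>. T f \<in> bergman \<alpha>) \<and>
     (\<forall>f\<in>bergman \<alpha>. \<forall>g\<in>bergman \<alpha>. T (\<lambda>z. f z + g z) = (\<lambda>z. T f z + T g z)) \<and>
     (\<forall>c. \<forall>f\<in>bergman \<alpha>. T (\<lambda>z. c * f z) = (\<lambda>z. c * T f z)) \<and>
     (\<exists>C. \<forall>f\<in>bergman \<alpha>. L2_norm \<alpha> (T f) \<le> C * L2_norm \<alpha> f)"

definition invertible_operator :: "real \<Rightarrow> ((complex \<Rightarrow> complex) \<Rightarrow> complex \<Rightarrow> complex) \<Rightarrow> bool" where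
  "invertible_operator \<alpha> T \<longleftrightarrow> bounded_operator \<alpha> T \<and>
     (\<exists>S. bounded_operator \<alpha> S \<and> (\<forall>f\<in>bergman \<alpha>. S (T f) = f \<and> T (S f) = f))"

definition Linfty :: "real \<Rightarrow> (complex \<Rightarrow> complex) set" where
  "Linfty \<alpha> = {f \<in> borel_measurable (weighted_area \<alpha>).
               \<exists>C. AE z in weighted_area \<alpha>. cmod (f z) \<le> C}"

definition invertible_Linfty :: "real \<Rightarrow> (complex \<Rightarrow> complex) \<Rightarrow> bool" where
  "invertible_Linfty \<alpha> f \<longleftrightarrow>
     f \<in> Linfty \<alpha> \<and> (\<exists>g\<in>Linfty \<alpha>. AE z in weighted_area \<alpha>. f z * g z = 1)"

definition berezin :: "real \<Rightarrow> (complex \<Rightarrow> complex) \<Rightarrow> complex \<Rightarrow> complex" where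
  "berezin \<alpha> \<phi> z =
     1 / complex_of_real ((L2_norm \<alpha> (bergman_kernel \<alpha> z))\<^sup>2) *
     (LINT w|weighted_area \<alpha>. \<phi> w * complex_of_real ((cmod (bergman_kernel \<alpha> z w))\<^sup>2))"

text \<open>\<open>reverse_carleson \<alpha> G\<close> says that \<open>indicator G dA\<close> is a reverse Carleson measure.\<close>

definition reverse_carleson :: "real \<Rightarrow> complex set \<Rightarrow> bool" where
  "reverse_carleson \<alpha> G \<longleftrightarrow> G \<in> sets area \<and>
     (\<exists>C>0. \<forall>f\<in>bergman \<alpha>.
        (LINT z|weighted_area \<alpha>. (cmod (f z))\<^sup>2) \<le> C * (LINT z:G|weighted_area \<alpha>. (cmod (f z))\<^sup>2))"

definition all_equivalent :: "bool list \<Rightarrow> bool" where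
  "all_equivalent Ps \<longleftrightarrow> (\<forall>P\<in>set Ps. \<forall>Q\<in>set Ps. P \<longleftrightarrow> Q)"

end

theory Submission
  imports Defs
begin

text \<open>
  (1) and (5): \<open>T\<close> is positive with \<open>\<parallel>T f\<parallel>\<^sup>2 \<le> \<parallel>\<phi> f\<parallel>\<^sup>2 \<le> sup \<phi> \<cdot> \<integral>\<phi>|f|\<^sup>2\<close>, so an invertible \<open>T\<close> is coercive;
  conversely coercivity lets one solve \<open>T f = g\<close> by minimising a quadratic functional. Montel's
  theorem together with Fatou's lemma yields the minimiser.

  (5) to (2) is the case of reproducing kernels. (2) to (4): for \<open>z\<close> near \<open>(1 - s/N) w\<close> with \<open>|w| = 1\<close>
  and \<open>N\<close> large, the normalised kernel at \<open>z\<close> carries little mass outside the ball of radius \<open>s\<close>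
  about \<open>w\<close> and little mass in a thin strip along the circle; on the rest it is of size at most
  \<open>s\<^sup>-\<^sup>2\<close>, so \<open>{\<phi> > r}\<close> must have area of order \<open>s\<^sup>2\<close> there.

  (4) to (3), after Luecking: cutting off a thin strip, (4) gives \<open>\<eta> < 1\<close> such that \<open>G = {\<phi> > r}\<close> fills a fixed
  proportion of every disk \<open>{|z - b| < \<eta> (1 - |b|)}\<close>. A normal family argument bounds \<open>|f b|\<^sup>2\<close> by the
  mean of \<open>|f|\<^sup>2\<close> over the part of \<open>G\<close> in this disk, up to \<open>\<epsilon>\<close> times the mean over a larger disk.
  Integrating in \<open>b\<close> and absorbing the \<open>\<epsilon>\<close>-term gives the reverse Carleson inequality.
\<close>

subsection \<open>Area means of holomorphic functions\<close>

text \<open>Condition (4) measures plain area, while the others integrate against a weight that may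
  vanish or blow up at the circle. Hence a strip along the circle is discarded both in (2) to (4)
  and in (4) to (3): its contribution is small, and away from it the weight is comparable to a power
  of the scale. The weighted strip estimate rests on \<open>x powr \<alpha>\<close> being integrable
  at 0, that is on \<alpha> > -1.

  In (4) to (3) the local bound cannot hold with a uniform constant and the mean over
  \<open>G\<close> alone: high powers of a linear function that is 1 at b and small on a part of
  \<open>G\<close> away from b violate it. The \<epsilon>-term pays for such functions through their
  size on a larger disk, and it is also what bounds the family to which Montel's theorem is applied.

  In (2) the Berezin transform is bounded below only almost everywhere, so the kernel is tested at
  some point of a small disk, not at (1 - s/N) w itself. The norm of that kernel grows like N to the
  power 2 + \<alpha> relative to its tail; so N is fixed first, and the width of the strip, which
  depends on the maximum of the kernel and hence on N, afterwards.\<close>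

lemma nn_integral_lborel_translate:
  fixes t :: "'a::euclidean_space"
  assumes [measurable]: "f \<in> borel_measurable borel"
  shows "(\<integral>\<^sup>+x. f (t + x) \<partial>lborel) = (\<integral>\<^sup>+x. f x \<partial>lborel)"
proof -
  have "(\<integral>\<^sup>+x. f x \<partial>lborel) = (\<integral>\<^sup>+x. f x \<partial>distr lborel borel ((+) t))"
    by (simp add: lborel_distr_plus)
  also have "\<dots> = (\<integral>\<^sup>+x. f (t + x) \<partial>lborel)"
    by (subst nn_integral_distr) simp_all
  finally show ?thesis ..
qed

text \<open>Rotation invariance is reduced to translation invariance. The double integral of
  \<open>indicator A (c * x) * indicator ?B (- (c * x) + y)\<close> is computed in both orders. One
  order gives the rotated measure of \<open>A\<close> times the area of \<open>?B\<close>; the other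
  gives the measure of \<open>A\<close> times the same factor, because the disk \<open>?B\<close> is
  itself invariant under \<open>c\<close>. The factor is finite and nonzero and cancels.\<close>

lemma lborel_distr_rotation:
  fixes c :: complex
  assumes c: "cmod c = 1"
  shows "distr lborel borel ((*) c) = lborel"
proof (rule measure_eqI)
  fix A :: "complex set" assume "A \<in> sets (distr lborel borel ((*) c))"
  then have [measurable]: "A \<in> sets borel" by simp
  let ?B = "ball (0::complex) 1"
  have [measurable]: "?B \<in> sets borel" by auto
  have c0: "c \<noteq> 0" using c by auto
  have tr: "(\<integral>\<^sup>+y. indicator ?B (x + y) \<partial>lborel) = emeasure lborel ?B" for x
    using nn_integral_lborel_translate[OF borel_measurable_indicator, of ?B x]
      nn_integral_indicator[of ?B lborel] by auto
  have "emeasure (distr lborel borel ((*) c)) A = (\<integral>\<^sup>+x. indicator A (c * x) \<partial>lborel)"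
    using nn_integral_distr[of "(*) c" lborel borel "indicator A"] by simp
  then have "emeasure (distr lborel borel ((*) c)) A * emeasure lborel ?B
      = (\<integral>\<^sup>+x. indicator A (c * x) * emeasure lborel ?B \<partial>lborel)"
    by (simp add: nn_integral_multc)
  also have "\<dots> = (\<integral>\<^sup>+x. indicator A (c * x) * (\<integral>\<^sup>+y. indicator ?B (- (c * x) + y) \<partial>lborel) \<partial>lborel)"
    by (simp only: tr)
  also have "\<dots> = (\<integral>\<^sup>+x. (\<integral>\<^sup>+y. indicator A (c * x) * indicator ?B (- (c * x) + y) \<partial>lborel) \<partial>lborel)"
    by (simp add: nn_integral_cmult)
  also have "\<dots> = (\<integral>\<^sup>+y. (\<integral>\<^sup>+x. indicator A (c * x) * indicator ?B (- (c * x) + y) \<partial>lborel) \<partial>lborel)"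
    by (rule lborel_pair.Fubini') (simp add: case_prod_unfold)
  \<comment> \<open>Translating \<open>x\<close> by \<open>y / c\<close> turns \<open>c * x\<close>
    into \<open>y + c * x\<close> and the argument of the disk indicator into
    \<open>- (c * x)\<close>, which has the norm of \<open>x\<close>.\<close>
  also have "\<dots> = (\<integral>\<^sup>+y. (\<integral>\<^sup>+x. indicator A (c * (y / c + x)) * indicator ?B (- (c * (y / c + x)) + y) \<partial>lborel) \<partial>lborel)"
    by (subst nn_integral_lborel_translate) simp_all
  also have "\<dots> = (\<integral>\<^sup>+y. (\<integral>\<^sup>+x. indicator A (c * x + y) * indicator ?B x \<partial>lborel) \<partial>lborel)"
    using c c0 by (intro nn_integral_cong)
      (simp add: algebra_simps indicator_def dist_norm norm_mult)
  also have "\<dots> = (\<integral>\<^sup>+x. (\<integral>\<^sup>+y. indicator A (c * x + y) * indicator ?B x \<partial>lborel) \<partial>lborel)"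
    by (rule lborel_pair.Fubini') (simp add: case_prod_unfold)
  also have "\<dots> = (\<integral>\<^sup>+x. (\<integral>\<^sup>+y. indicator A (c * x + y) \<partial>lborel) * indicator ?B x \<partial>lborel)"
    by (simp add: nn_integral_multc)
  also have "\<dots> = (\<integral>\<^sup>+x. emeasure lborel A * indicator ?B x \<partial>lborel)"
    by (subst nn_integral_lborel_translate) simp_all
  also have "\<dots> = emeasure lborel A * emeasure lborel ?B"
    by (simp add: nn_integral_cmult)
  finally have eq: "emeasure (distr lborel borel ((*) c)) A * emeasure lborel ?B
      = emeasure lborel A * emeasure lborel ?B" .
  have "emeasure lborel ?B = ennreal pi" by (simp add: emeasure_ball unit_ball_vol_2)
  with eq show "emeasure (distr lborel borel ((*) c)) A = emeasure lborel A"
    by (simp add: mult.commute[of _ "ennreal pi"] ennreal_mult_cancel_left)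
qed simp

lemma nn_integral_lborel_rotation:
  assumes [measurable]: "f \<in> borel_measurable borel" and "cmod c = 1"
  shows "(\<integral>\<^sup>+x. f (c * x) \<partial>lborel) = (\<integral>\<^sup>+x. f x \<partial>lborel)"
proof -
  have "(\<integral>\<^sup>+x. f x \<partial>lborel) = (\<integral>\<^sup>+x. f x \<partial>distr lborel borel ((*) c))"
    using assms by (simp add: lborel_distr_rotation)
  also have "\<dots> = (\<integral>\<^sup>+x. f (c * x) \<partial>lborel)"
    by (subst nn_integral_distr) simp_all
  finally show ?thesis ..
qed

text \<open>The square of \<open>f\<close> is itself holomorphic, so Cauchy's formula for
  \<open>h\<close> on the unit circle, followed by the triangle inequality, already yields the mean
  inequality for the squared modulus.\<close>

lemma holomorphic_circle_mean:
  assumes f: "f holomorphic_on ball b r" and u: "cmod u < r"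
  shows "ennreal ((cmod (f b))\<^sup>2)
    \<le> (\<integral>\<^sup>+t. ennreal ((cmod (f (b + u * exp (2 * of_real pi * \<i> * of_real t))))\<^sup>2) * indicator {0..1} t \<partial>lborel)"
proof -
  define e where "e t = exp (2 * of_real pi * \<i> * of_real t)" for t :: real
  have ne: "cmod (e t) = 1" for t by (simp add: e_def)
  define h where "h z = (f (b + u * z))\<^sup>2" for z
  have im: "b + u * z \<in> ball b r" if "cmod z \<le> 1" for z
  proof -
    have "cmod (u * z) \<le> cmod u" using that by (simp add: norm_mult mult_left_le)
    then show ?thesis using u by (simp add: dist_norm)
  qed
  have hol: "h holomorphic_on {z. cmod (u * z) < r}"
    unfolding h_def
    by (intro holomorphic_intros holomorphic_on_compose_gen[OF _ f, unfolded o_def])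
      (auto simp: dist_norm)
  have "open {z. cmod (u * z) < r}" by (intro open_Collect_less continuous_intros)
  have sub: "cball 0 1 \<subseteq> {z. cmod (u * z) < r}" 
    using im by (auto simp: dist_norm)
  have "((\<lambda>z. h z / (z - 0)) has_contour_integral 2 * of_real pi * \<i> * h 0) (circlepath 0 1)"
    by (rule Cauchy_integral_circlepath_simple[OF holomorphic_on_subset[OF hol sub]]) simp
  moreover have "circlepath 0 1 t = e t" for t by (simp add: circlepath e_def)
  moreover have "vector_derivative (circlepath 0 1) (at t) = 2 * of_real pi * \<i> * e t" for t
    by (simp add: vector_derivative_circlepath e_def)
  moreover have "vector_derivative (circlepath 0 1) (at t within {0..1}) = 2 * of_real pi * \<i> * e t"
    if "t \<in> {0..1}" for t
    using that by (simp add: vector_derivative_circlepath01 e_def)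
  ultimately have "((\<lambda>t. h (e t) / e t * (2 * of_real pi * \<i> * e t)) has_integral 2 * of_real pi * \<i> * h 0) {0..1}"
    unfolding has_contour_integral by simp
  then have "((\<lambda>t. (2 * of_real pi * \<i>) * h (e t)) has_integral (2 * of_real pi * \<i>) * h 0) {0..1}"
    by (rule has_integral_eq[rotated]) (use ne in \<open>auto simp: e_def\<close>)
  then have int: "((\<lambda>t. h (e t)) has_integral h 0) {0..1}"
    by (drule_tac has_integral_mult_right[where c = "1 / (2 * of_real pi * \<i>)"]) simp
  have cont: "continuous_on {0..1} (\<lambda>t. h (e t))"
    unfolding e_def
    by (intro continuous_on_compose2[OF holomorphic_on_imp_continuous_on[OF hol]] continuous_intros)
       (use u in \<open>auto simp: norm_mult\<close>)
  then have I: "set_integrable lborel {0..1} (\<lambda>t. h (e t))"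
    unfolding set_integrable_def by (intro borel_integrable_compact) auto
  have "h 0 = (LINT t:{0..1}|lborel. h (e t))"
    using has_integral_set_lebesgue[of "{0..1}"] set_borel_integral_eq_integral(2)[OF I] int
    by (simp add: integral_unique)
  then have "ennreal (cmod (h 0)) \<le> (\<integral>\<^sup>+t. ennreal (cmod (indicator {0..1} t *\<^sub>R h (e t))) \<partial>lborel)"
    using I unfolding set_integrable_def set_lebesgue_integral_def
    by (metis integral_norm_bound_ennreal)
  also have "\<dots> = (\<integral>\<^sup>+t. ennreal ((cmod (f (b + u * e t)))\<^sup>2) * indicator {0..1} t \<partial>lborel)"
    by (intro nn_integral_cong) (auto simp: h_def norm_power indicator_def)
  finally show ?thesis by (simp add: h_def e_def norm_power)
qed

text \<open>The area mean is obtained by averaging over all rotations of the disk, which avoids polar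
  coordinates.\<close>

lemma holomorphic_area_mean:
  assumes f: "f holomorphic_on ball b r" and r: "0 < r"
  shows "ennreal (pi * r\<^sup>2) * ennreal ((cmod (f b))\<^sup>2)
    \<le> (\<integral>\<^sup>+z. ennreal ((cmod (f z))\<^sup>2) * indicator (ball b r) z \<partial>lborel)"
proof -
  define e where "e t = exp (2 * of_real pi * \<i> * of_real t)" for t :: real
  have ne: "cmod (e t) = 1" for t by (simp add: e_def)
  have [measurable]: "e \<in> borel_measurable borel" unfolding e_def by measurable
  define F where "F z = ennreal ((cmod (f z))\<^sup>2) * indicator (ball b r) z" for z
  have "continuous_on (ball b r) (\<lambda>z. (cmod (f z))\<^sup>2)"
    by (intro continuous_intros holomorphic_on_imp_continuous_on[OF f])
  then have "(\<lambda>z. indicator (ball b r) z *\<^sub>R (cmod (f z))\<^sup>2) \<in> borel_measurable borel"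
    by (intro borel_measurable_continuous_on_indicator) auto
  then have "(\<lambda>z. ennreal (indicator (ball b r) z *\<^sub>R (cmod (f z))\<^sup>2)) \<in> borel_measurable borel"
    by measurable
  also have "(\<lambda>z. ennreal (indicator (ball b r) z *\<^sub>R (cmod (f z))\<^sup>2)) = F"
    by (auto simp: F_def indicator_def fun_eq_iff)
  finally have [measurable]: "F \<in> borel_measurable borel" .
  have "ennreal (pi * r\<^sup>2) * ennreal ((cmod (f b))\<^sup>2)
      = (\<integral>\<^sup>+u. ennreal ((cmod (f b))\<^sup>2) * indicator (ball (0::complex) r) u \<partial>lborel)"
    using r by (subst nn_integral_cmult_indicator)
      (simp_all add: emeasure_ball unit_ball_vol_2 mult.commute flip: ennreal_mult)
  also have "\<dots> \<le> (\<integral>\<^sup>+u. (\<integral>\<^sup>+t. F (b + u * e t) * indicator {0..1} t \<partial>lborel) \<partial>lborel)"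
  proof (intro nn_integral_mono)
    fix u :: complex
    show "ennreal ((cmod (f b))\<^sup>2) * indicator (ball 0 r) u
        \<le> (\<integral>\<^sup>+t. F (b + u * e t) * indicator {0..1} t \<partial>lborel)"
    proof (cases "cmod u < r")
      case True
      from holomorphic_circle_mean[OF f True]
      have "ennreal ((cmod (f b))\<^sup>2)
          \<le> (\<integral>\<^sup>+t. F (b + u * e t) * indicator {0..1} t \<partial>lborel)"
        unfolding e_def[symmetric]
        by (rule order_trans) (use True ne in \<open>auto intro!: nn_integral_mono simp: F_def dist_norm norm_mult\<close>)
      then show ?thesis using True by simp
    qed simp
  qed
  \<comment> \<open>For fixed \<open>t\<close>, multiplication by \<open>e t\<close> preserves
    Lebesgue measure, so the inner integral does not depend on \<open>t\<close>.\<close>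
  also have "\<dots> = (\<integral>\<^sup>+t. (\<integral>\<^sup>+u. F (b + u * e t) * indicator {0..1} t \<partial>lborel) \<partial>lborel)"
    by (rule lborel_pair.Fubini'[symmetric]) (simp add: case_prod_unfold)
  also have "\<dots> = (\<integral>\<^sup>+t. (\<integral>\<^sup>+u. F (b + e t * u) \<partial>lborel) * indicator {0..1} t \<partial>lborel)"
    by (intro nn_integral_cong, subst nn_integral_multc) (measurable, simp add: mult.commute)
  also have "\<dots> = (\<integral>\<^sup>+t. (\<integral>\<^sup>+u. F u \<partial>lborel) * indicator {0..1} (t::real) \<partial>lborel)"
    by (subst nn_integral_lborel_rotation[where f = "\<lambda>x. F (b + x)"])
      (simp_all add: ne nn_integral_lborel_translate)
  also have "\<dots> = (\<integral>\<^sup>+u. F u \<partial>lborel)"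
    by (simp add: nn_integral_cmult)
  finally show ?thesis unfolding F_def .
qed

subsection \<open>The weighted measures and normal families\<close>

lemma space_area [simp]: "space area = disk"
  and sets_area [measurable_cong]: "sets area = sets (lebesgue_on disk)"
  and space_weighted_area [simp]: "space (weighted_area \<alpha>) = disk"
  and sets_weighted_area [measurable_cong]: "sets (weighted_area \<alpha>) = sets (lebesgue_on disk)"
  by (simp_all add: area_def weighted_area_def)

lemma sets_area_iff: "A \<in> sets area \<longleftrightarrow> A \<in> sets lebesgue \<and> A \<subseteq> disk"
  by (auto simp: sets_area sets_restrict_space_iff)

lemma measurable_area_borel [measurable]: "(\<lambda>x. x) \<in> area \<rightarrow>\<^sub>M borel"
proof -
  have "(\<lambda>x. x) \<in> lebesgue \<rightarrow>\<^sub>M (borel :: complex measure)"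
    by (rule measurable_completion) auto
  then show ?thesis
    by (simp add: measurable_restrict_space1 cong: measurable_cong_sets[OF sets_area refl])
qed

lemma measurable_weighted_area: "borel_measurable (weighted_area \<alpha>) = borel_measurable area"
  by (rule measurable_cong_sets) (simp_all add: sets_area sets_weighted_area)

lemma borel_measurable_area: "f \<in> borel_measurable borel \<Longrightarrow> f \<in> borel_measurable area"
  using measurable_compose[OF measurable_area_borel] by blast

lemma borel_sets_area: "A \<in> sets borel \<Longrightarrow> A \<subseteq> disk \<Longrightarrow> A \<in> sets area"
  by (simp add: sets_area_iff)

lemma omega_measurable [measurable]: "omega \<alpha> \<in> borel_measurable area"
  by (rule borel_measurable_area) (unfold omega_def, measurable)

lemma omega_nonneg: "\<alpha> > -1 \<Longrightarrow> 0 \<le> omega \<alpha> z"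
  by (simp add: omega_def)

lemma disk_square_less: "cmod z < 1 \<Longrightarrow> (cmod z)\<^sup>2 < 1"
  by (simp add: abs_square_less_1)

lemma omega_pos: "\<alpha> > -1 \<Longrightarrow> z \<in> disk \<Longrightarrow> 0 < omega \<alpha> z"
  using disk_square_less[of z] by (auto simp: omega_def)

text \<open>Makes the normal family lemma available for plain area as the case \<alpha> = 0. In the
  disk the base of \<open>powr\<close> is nonzero, which matters because
  \<open>0 powr 0 = 0\<close>.\<close>

lemma weighted_area_0: "weighted_area 0 = area"
proof -
  have "weighted_area 0 = density area (\<lambda>z. 1)"
    unfolding weighted_area_def
    by (rule density_cong) (auto simp: omega_def intro!: AE_I2 dest: disk_square_less[THEN less_imp_neq])
  then show ?thesis by (simp add: density_1)
qed

lemma nn_integral_weighted_area: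
  assumes "f \<in> borel_measurable area"
  shows "(\<integral>\<^sup>+z. f z \<partial>weighted_area \<alpha>) = (\<integral>\<^sup>+z. ennreal (omega \<alpha> z) * f z \<partial>area)"
  unfolding weighted_area_def using assms by (simp add: nn_integral_density)

lemma nn_integral_area:
  assumes "f \<in> borel_measurable area"
  shows "(\<integral>\<^sup>+z. f z \<partial>area) = ennreal (1 / pi) * (\<integral>\<^sup>+z. f z * indicator disk z \<partial>lebesgue)"
proof -
  have "f \<in> borel_measurable (lebesgue_on disk)"
    using assms by (simp cong: measurable_cong_sets[OF sets_area refl])
  then show ?thesis
    by (simp add: area_def nn_integral_density nn_integral_cmult nn_integral_restrict_space)
qed

lemma emeasure_area:
  assumes "A \<in> sets area"
  shows "emeasure area A = ennreal (1 / pi) * emeasure lebesgue A"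
proof -
  have A: "A \<in> sets lebesgue" "A \<subseteq> disk" using assms by (simp_all add: sets_area_iff)
  have "emeasure area A = (\<integral>\<^sup>+z. indicator A z \<partial>area)" using assms by simp
  also have "\<dots> = ennreal (1 / pi) * (\<integral>\<^sup>+z. indicator A z * indicator disk z \<partial>lebesgue)"
    by (rule nn_integral_area) (use assms in measurable)
  also have "(\<lambda>z. indicator A z * indicator disk z :: ennreal) = indicator A"
    using A by (auto simp: indicator_def fun_eq_iff)
  finally show ?thesis using A by simp
qed

lemma emeasure_area_ball:
  assumes "0 \<le> r"
  shows "emeasure area (disk \<inter> ball b r) \<le> ennreal (r\<^sup>2)"
    and "ball b r \<subseteq> disk \<Longrightarrow> emeasure area (ball b r) = ennreal (r\<^sup>2)"
proof -
  have B: "emeasure lebesgue (ball b r) = ennreal (pi * r\<^sup>2)"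
    using assms by (simp add: emeasure_ball unit_ball_vol_2)
  have "emeasure area (disk \<inter> ball b r) = ennreal (1 / pi) * emeasure lebesgue (disk \<inter> ball b r)"
    by (intro emeasure_area borel_sets_area) auto
  also have "\<dots> \<le> ennreal (1 / pi) * emeasure lebesgue (ball b r)"
    by (intro mult_left_mono emeasure_mono) auto
  also have "\<dots> = ennreal (r\<^sup>2)" unfolding B by (simp flip: ennreal_mult)
  finally show "emeasure area (disk \<inter> ball b r) \<le> ennreal (r\<^sup>2)" .
  assume "ball b r \<subseteq> disk"
  then have "emeasure area (ball b r) = ennreal (1 / pi) * emeasure lebesgue (ball b r)"
    by (intro emeasure_area borel_sets_area) auto
  also have "\<dots> = ennreal (r\<^sup>2)" unfolding B by (simp flip: ennreal_mult)
  finally show "emeasure area (ball b r) = ennreal (r\<^sup>2)" .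
qed

interpretation area: finite_measure area
proof
  show "emeasure area (space area) \<noteq> \<infinity>"
    using emeasure_area_ball(2)[of 1 0] by simp
qed

lemma AE_weighted_area: "\<alpha> > -1 \<Longrightarrow> (AE z in weighted_area \<alpha>. P z) \<longleftrightarrow> (AE z in area. P z)"
  unfolding weighted_area_def by (subst AE_density) (auto simp: omega_pos intro!: AE_cong)

lemma holomorphic_measurable_area:
  assumes "f holomorphic_on disk"
  shows "f \<in> borel_measurable area"
proof -
  have "f \<in> borel_measurable (lebesgue_on disk)"
    by (intro continuous_imp_measurable_on_sets_lebesgue holomorphic_on_imp_continuous_on assms) auto
  then show ?thesis by (simp cong: measurable_cong_sets[OF sets_area refl])
qed

abbreviation sq_integral :: "complex measure \<Rightarrow> (complex \<Rightarrow> complex) \<Rightarrow> ennreal" where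
  "sq_integral M f \<equiv> \<integral>\<^sup>+z. ennreal ((cmod (f z))\<^sup>2) \<partial>M"

abbreviation sq_integral_on :: "complex measure \<Rightarrow> complex set \<Rightarrow> (complex \<Rightarrow> complex) \<Rightarrow> ennreal" where
  "sq_integral_on M A f \<equiv> \<integral>\<^sup>+z\<in>A. ennreal ((cmod (f z))\<^sup>2) \<partial>M"

text \<open>Point evaluations are bounded, uniformly on compact sets. The area mean is taken over
  disks of radius \<open>r\<close>; since \<open>R = 1 - 2 * r\<close>, they stay in
  \<open>cball 0 (1 - r)\<close>, where the continuous positive weight has a positive
  minimum.\<close>

lemma holomorphic_point_bound:
  assumes a: "\<alpha> > -1" and R: "0 \<le> R" "R < 1"
  obtains C where "C > 0" "\<And>f z. f holomorphic_on disk \<Longrightarrow> z \<in> cball 0 R \<Longrightarrow>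
    ennreal ((cmod (f z))\<^sup>2) \<le> ennreal C * sq_integral (weighted_area \<alpha>) f"
proof -
  define r where "r = (1 - R) / 2"
  have r: "0 < r" "r < 1" using R by (auto simp: r_def)
  have cont: "continuous_on (cball 0 (1 - r)) (omega \<alpha>)"
    unfolding omega_def using r
    by (intro continuous_intros) (auto simp: abs_square_eq_1)
  obtain z0 where z0: "z0 \<in> cball 0 (1 - r)" "\<And>z. z \<in> cball 0 (1 - r) \<Longrightarrow> omega \<alpha> z0 \<le> omega \<alpha> z"
    using continuous_attains_inf[OF _ _ cont] r by force
  define m where "m = omega \<alpha> z0"
  have m: "m > 0" unfolding m_def using z0 r by (intro omega_pos a) auto
  show thesis
  proof
    show "1 / (m * r\<^sup>2) > 0" using m r by simp
    fix f :: "complex \<Rightarrow> complex" and z :: complex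
    assume f: "f holomorphic_on disk" and z: "z \<in> cball 0 R"
    have [measurable]: "f \<in> borel_measurable area" by (rule holomorphic_measurable_area[OF f])
    have sub: "ball z r \<subseteq> cball 0 (1 - r)" "ball z r \<subseteq> disk"
    proof -
      have "cmod w \<le> 1 - r" if "w \<in> ball z r" for w
        using that z norm_triangle_ineq2[of w z] by (simp add: dist_norm norm_minus_commute r_def field_simps)
      then show "ball z r \<subseteq> cball 0 (1 - r)" by auto
      then show "ball z r \<subseteq> disk" using r by force
    qed
    have "ennreal (pi * r\<^sup>2) * ennreal ((cmod (f z))\<^sup>2)
        \<le> (\<integral>\<^sup>+w. ennreal ((cmod (f w))\<^sup>2) * indicator (ball z r) w \<partial>lborel)"
      using holomorphic_area_mean[of f z r] f sub r by (auto intro: holomorphic_on_subset)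
    also have "\<dots> = (\<integral>\<^sup>+w. ennreal ((cmod (f w))\<^sup>2) * indicator (ball z r) w \<partial>lebesgue)"
      by (simp add: nn_integral_completion)
    also have "\<dots> \<le> (\<integral>\<^sup>+w. (ennreal (1 / m) * (ennreal (omega \<alpha> w) * ennreal ((cmod (f w))\<^sup>2))) * indicator disk w \<partial>lebesgue)"
    proof (intro nn_integral_mono)
      fix w
      have "1 \<le> (1 / m) * omega \<alpha> w" if "w \<in> ball z r"
        using z0(2)[of w] that sub m by (auto simp: m_def field_simps)
      then have "(cmod (f w))\<^sup>2 \<le> (1 / m) * (omega \<alpha> w * (cmod (f w))\<^sup>2)" if "w \<in> ball z r"
        using that mult_right_mono[of 1 "(1 / m) * omega \<alpha> w" "(cmod (f w))\<^sup>2"] by (simp add: mult.assoc)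
      then show "ennreal ((cmod (f w))\<^sup>2) * indicator (ball z r) w
        \<le> (ennreal (1 / m) * (ennreal (omega \<alpha> w) * ennreal ((cmod (f w))\<^sup>2))) * indicator disk w"
        using sub m omega_nonneg[OF a] by (auto simp: indicator_def ennreal_mult'[symmetric] ennreal_leI)
    qed
    also have "\<dots> = ennreal pi * (\<integral>\<^sup>+w. ennreal (1 / m) * (ennreal (omega \<alpha> w) * ennreal ((cmod (f w))\<^sup>2)) \<partial>area)"
      by (subst nn_integral_area) (simp_all add: mult.assoc[symmetric] flip: ennreal_mult)
    also have "\<dots> = ennreal pi * (ennreal (1 / m) * sq_integral (weighted_area \<alpha>) f)"
      by (simp add: nn_integral_cmult nn_integral_weighted_area)
    finally have "ennreal (1 / (pi * r\<^sup>2)) * (ennreal (pi * r\<^sup>2) * ennreal ((cmod (f z))\<^sup>2))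
      \<le> ennreal (1 / (pi * r\<^sup>2)) * (ennreal pi * (ennreal (1 / m) * sq_integral (weighted_area \<alpha>) f))"
      by (rule mult_left_mono) simp
    then show "ennreal ((cmod (f z))\<^sup>2) \<le> ennreal (1 / (m * r\<^sup>2)) * sq_integral (weighted_area \<alpha>) f"
      using r m by (simp add: mult.assoc[symmetric] mult.commute flip: ennreal_mult)
  qed
qed

lemma bounded_L2_normal_family:
  fixes f :: "nat \<Rightarrow> complex \<Rightarrow> complex" and B :: real
  assumes a: "\<alpha> > -1" and f: "\<And>n. f n holomorphic_on disk"
    and B: "\<And>n. sq_integral (weighted_area \<alpha>) (f n) \<le> ennreal B"
  obtains g and r :: "nat \<Rightarrow> nat" where "g holomorphic_on disk" "strict_mono r"
    "\<And>z. z \<in> disk \<Longrightarrow> (\<lambda>n. f (r n) z) \<longlonglongrightarrow> g z"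
    "\<And>K. compact K \<Longrightarrow> K \<subseteq> disk \<Longrightarrow> uniform_limit K (\<lambda>n. f (r n)) g sequentially"
proof -
  define H where "H = {h. h holomorphic_on disk \<and>
    sq_integral (weighted_area \<alpha>) h \<le> ennreal B}"
  have "\<exists>b. \<forall>h\<in>H. \<forall>z\<in>K. cmod (h z) \<le> b" if K: "compact K" "K \<subseteq> disk" for K
  proof -
    obtain R where R: "0 \<le> R" "R < 1" "K \<subseteq> cball 0 R"
    proof (cases "K = {}")
      case True then show ?thesis using that[of 0] by auto
    next
      case False
      obtain x where "x \<in> K" "\<And>y. y \<in> K \<Longrightarrow> cmod y \<le> cmod x"
        using continuous_attains_sup[OF K(1) False, of cmod] by (auto intro: continuous_intros)
      then show ?thesis using that[of "cmod x"] K(2) by (force simp: subset_iff)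
    qed
    obtain C where C: "C > 0" "\<And>f z. f holomorphic_on disk \<Longrightarrow> z \<in> cball 0 R \<Longrightarrow>
      ennreal ((cmod (f z))\<^sup>2) \<le> ennreal C * sq_integral (weighted_area \<alpha>) f"
      using holomorphic_point_bound[OF a R(1,2)] by blast
    \<comment> \<open>\<open>B\<close> may be negative, and then \<open>ennreal B\<close> is 0;
      hence the maximum.\<close>
    have "cmod (h z) \<le> sqrt (C * max B 0)" if h: "h \<in> H" and z: "z \<in> K" for h z
    proof -
      have "ennreal ((cmod (h z))\<^sup>2) \<le> ennreal C * sq_integral (weighted_area \<alpha>) h"
        using h z R by (intro C) (auto simp: H_def)
      also have "\<dots> \<le> ennreal C * ennreal (max B 0)"
        using h by (intro mult_left_mono) (auto simp: H_def ennreal_neg max_def intro: order_trans)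
      finally have "(cmod (h z))\<^sup>2 \<le> C * max B 0"
        using C(1) by (simp flip: ennreal_mult)
      then show ?thesis by (simp add: real_le_rsqrt)
    qed
    then show ?thesis by blast
  qed
  moreover have H: "range f \<subseteq> H" using f B by (auto simp: H_def)
  ultimately obtain g r where "g holomorphic_on disk" "strict_mono (r :: nat \<Rightarrow> nat)"
    "\<And>z. z \<in> disk \<Longrightarrow> (\<lambda>n. f (r n) z) \<longlonglongrightarrow> g z"
    "\<And>K. compact K \<Longrightarrow> K \<subseteq> disk \<Longrightarrow> uniform_limit K (f \<circ> r) g sequentially"
    using Montel[of disk H f, OF open_ball _ _ H] unfolding H_def by blast
  then show thesis using that by (auto simp: o_def)
qed

subsection \<open>Reverse Carleson measures\<close>

lemma fsigma_disk: "fsigma disk"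
proof -
  obtain C where C: "\<And>n::nat. compact (C n)" "\<And>n. C n \<subseteq> disk" "\<Union>(range C) = disk"
    by (rule open_Union_compact_subsets[of disk]) auto
  then show ?thesis using fsigma.intros[of C] by (auto simp: compact_imp_closed)
qed

text \<open>By compactness. Counterexamples for c = 1, 2, ..., normalised to value 1 at 0, have
  norms bounded through the \<epsilon>-term, so a subsequence converges to some \<open>G\<close>
  with \<open>G 0 = 1\<close>. The zeros of \<open>G\<close> form a null set, hence
  \<open>cmod (G z)\<close> is small only on a set of area below \<open>\<delta> / 2\<close>. The
  functions are therefore bounded below on a fixed proportion of \<open>E n\<close>, against the
  integral over \<open>E n\<close> tending to 0. Convergence is uniform on all the sets
  \<open>E n\<close> because \<kappa> < 1.\<close>

lemma local_lower_bound_unit: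
  assumes k: "0 < \<kappa>" "\<kappa> < 1" and e: "0 < \<epsilon>" and d: "0 < \<delta>"
  obtains c :: real where "c > 0"
    "\<And>g E. g holomorphic_on disk \<Longrightarrow> E \<in> sets area \<Longrightarrow> E \<subseteq> ball 0 \<kappa> \<Longrightarrow> ennreal \<delta> \<le> emeasure area E \<Longrightarrow>
      ennreal ((cmod (g 0))\<^sup>2) \<le> ennreal \<epsilon> * sq_integral area g
        + ennreal c * sq_integral_on area E g"
proof (rule ccontr)
  note obt = that
  assume "\<not> thesis"
  define P where "P c g E \<longleftrightarrow> g holomorphic_on disk \<and> E \<in> sets area \<and> E \<subseteq> ball 0 \<kappa> \<and> ennreal \<delta> \<le> emeasure area E \<and>
      ennreal \<epsilon> * sq_integral area g
        + ennreal c * sq_integral_on area E g < ennreal ((cmod (g 0))\<^sup>2)" for c g E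
  have neg: "\<exists>g E. P c g E" if "c > 0" for c
  proof (rule ccontr)
    assume n: "\<nexists>g E. P c g E"
    have thesis
      by (rule obt[OF that]) (use n in \<open>simp only: P_def not_less[symmetric], blast\<close>)
    with \<open>\<not> thesis\<close> show False ..
  qed
  have "\<forall>n. \<exists>g E. P (real (Suc n)) g E"
    by (intro allI neg) simp
  then obtain g E where gE: "\<And>n. P (real (Suc n)) (g n) (E n)"
    by metis
  then have g: "\<And>n. g n holomorphic_on disk" and E: "\<And>n. E n \<in> sets area"
      "\<And>n. E n \<subseteq> ball 0 \<kappa>" "\<And>n. ennreal \<delta> \<le> emeasure area (E n)" and
      less: "\<And>n. ennreal \<epsilon> * sq_integral area (g n)
        + ennreal (real (Suc n)) * sq_integral_on area (E n) (g n) < ennreal ((cmod (g n 0))\<^sup>2)"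
    unfolding P_def by blast+
  note [measurable] = E(1) holomorphic_measurable_area[OF g]
  have g0: "g n 0 \<noteq> 0" for n using less[of n] by auto
  define h where "h n z = g n z / g n 0" for n z
  have h: "h n holomorphic_on disk" for n
    unfolding h_def using g0 by (intro holomorphic_intros g)
  note [measurable] = holomorphic_measurable_area[OF h]
  have hg: "ennreal ((cmod (h n z))\<^sup>2) = ennreal (1 / (cmod (g n 0))\<^sup>2) * ennreal ((cmod (g n z))\<^sup>2)" for n z
    by (simp add: h_def norm_divide power_divide flip: ennreal_mult)
  have less': "ennreal \<epsilon> * sq_integral area (h n)
        + ennreal (real (Suc n)) * sq_integral_on area (E n) (h n) < 1" for n
  proof -
    have "ennreal \<epsilon> * sq_integral area (h n)
        + ennreal (real (Suc n)) * sq_integral_on area (E n) (h n)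
      = ennreal (1 / (cmod (g n 0))\<^sup>2) * (ennreal \<epsilon> * sq_integral area (g n)
        + ennreal (real (Suc n)) * sq_integral_on area (E n) (g n))"
      unfolding hg mult.assoc by (subst (1 2) nn_integral_cmult) (measurable, simp only: distrib_left mult.left_commute)
    also have "\<dots> < ennreal (1 / (cmod (g n 0))\<^sup>2) * ennreal ((cmod (g n 0))\<^sup>2)"
      using g0 by (intro ennreal_mult_strict_left_mono less) (auto simp: less_top)
    also have "\<dots> = 1" using g0 by (simp flip: ennreal_mult)
    finally show ?thesis .
  qed
  have bound: "sq_integral (weighted_area 0) (h n) \<le> ennreal (1 / \<epsilon>)" for n
  proof -
    have "ennreal \<epsilon> * sq_integral area (h n) \<le> 1"
      using le_less_trans[OF _ less'[of n], of "ennreal \<epsilon> * sq_integral area (h n)"] by simp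
    then have "ennreal (1 / \<epsilon>) * (ennreal \<epsilon> * sq_integral area (h n)) \<le> ennreal (1 / \<epsilon>) * 1"
      by (rule mult_left_mono) simp
    then show ?thesis using e by (simp add: weighted_area_0 mult.assoc[symmetric] flip: ennreal_mult)
  qed
  obtain G r where G: "G holomorphic_on disk" "strict_mono (r :: nat \<Rightarrow> nat)"
    "\<And>z. z \<in> disk \<Longrightarrow> (\<lambda>n. h (r n) z) \<longlonglongrightarrow> G z"
    "\<And>K. compact K \<Longrightarrow> K \<subseteq> disk \<Longrightarrow> uniform_limit K (\<lambda>n. h (r n)) G sequentially"
    using bounded_L2_normal_family[of 0 h, OF _ h bound] by (auto simp: o_def)
  note [measurable] = holomorphic_measurable_area[OF G(1)]
  have G0: "G 0 = 1"
  proof -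
    have "(\<lambda>n. h (r n) 0) \<longlonglongrightarrow> G 0" by (rule G(3)) simp
    moreover have "h (r n) 0 = 1" for n using g0 by (simp add: h_def)
    ultimately show ?thesis by (simp add: LIMSEQ_const_iff)
  qed
  have cnt: "countable {z \<in> disk. G z = 0}"
  proof (cases "G constant_on disk")
    case True
    then have "{z \<in> disk. G z = 0} = {}" using G0 by (force simp: constant_on_def)
    then show ?thesis by (simp only: countable_empty)
  next
    case False
    show ?thesis by (rule holomorphic_countable_zeros) (use G False in \<open>auto intro: fsigma_disk\<close>)
  qed
  \<comment> \<open>The factor 2 leaves room for the approximation: off \<open>Z m\<close> the limit
    has modulus at least \<open>2 * t\<close> with \<open>t = 1 / real (Suc m)\<close>, so a
    function within \<open>t\<close> of it still has modulus at least \<open>t\<close>.\<close>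
  define Z where "Z m = {z \<in> space area. cmod (G z) < 2 / real (Suc m)}" for m
  have Zm [measurable]: "Z m \<in> sets area" for m unfolding Z_def by measurable
  have "(\<lambda>m. emeasure area (Z m)) \<longlonglongrightarrow> emeasure area (\<Inter>m. Z m)"
  proof (rule Lim_emeasure_decseq)
    show "decseq Z"
    proof (rule decseq_SucI)
      fix n
      have "2 / real (Suc (Suc n)) \<le> 2 / real (Suc n)" by (simp add: frac_le)
      then show "Z (Suc n) \<subseteq> Z n" unfolding Z_def by auto
    qed
  qed (use Zm in auto)
  moreover have "(\<Inter>m. Z m) \<subseteq> {z \<in> disk. G z = 0}"
  proof safe
    fix z assume z: "z \<in> (\<Inter>m. Z m)"
    then show "z \<in> disk" by (auto simp: Z_def)
    have "(\<lambda>m. 2 * inverse (real (Suc m))) \<longlonglongrightarrow> 2 * 0"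
      by (intro tendsto_intros LIMSEQ_inverse_real_of_nat)
    then have "(\<lambda>m. 2 * inverse (real (Suc m))) \<longlonglongrightarrow> 0" by (simp only: mult_zero_right)
    then have "cmod (G z) \<le> 0"
    proof (rule LIMSEQ_le_const)
      have "cmod (G z) \<le> 2 * inverse (real (Suc n))" for n
        using z by (auto simp only: Z_def divide_inverse intro: less_imp_le)
      then show "\<exists>N. \<forall>n\<ge>N. cmod (G z) \<le> 2 * inverse (real (Suc n))" by blast
    qed
    then show "G z = 0" by simp
  qed
  then have "countable (\<Inter>m. Z m)" using cnt countable_subset by blast
  then have "emeasure area (\<Inter>m. Z m) = 0"
  proof -
    have "emeasure lborel (\<Inter>m. Z m) = 0" using \<open>countable (\<Inter>m. Z m)\<close> by (rule emeasure_lborel_countable)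
    moreover have "(\<Inter>m. Z m) \<in> sets area" by measurable
    ultimately show ?thesis using emeasure_area[of "\<Inter>m. Z m"]
      \<open>countable (\<Inter>m. Z m)\<close> by (simp add: emeasure_completion sets.countable)
  qed
  ultimately have "(\<lambda>m. emeasure area (Z m)) \<longlonglongrightarrow> 0" by simp
  then have "eventually (\<lambda>m. emeasure area (Z m) < ennreal (\<delta> / 2)) sequentially"
    using d by (intro order_tendstoD) auto
  then obtain m where m: "emeasure area (Z m) < ennreal (\<delta> / 2)" by (auto simp: eventually_sequentially)
  define t where "t = 1 / real (Suc m)"
  have t: "t > 0" by (simp add: t_def)
  have "uniform_limit (cball 0 \<kappa>) (\<lambda>n. h (r n)) G sequentially"
    using k by (intro G(4)) auto
  then have "\<forall>\<^sub>F n in sequentially. \<forall>z\<in>cball 0 \<kappa>. dist (h (r n) z) (G z) < t"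
    using t by (auto simp: uniform_limit_iff)
  \<comment> \<open>The integral over \<open>E N\<close> will be at least
    \<open>t\<^sup>2 * (\<delta> / 2)\<close>; \<open>N\<close> must be so large that
    \<open>N + 1\<close> times this exceeds 1. A bound on \<open>n\<close> suffices because
    \<open>n \<le> r n\<close>.\<close>
  moreover have "\<forall>\<^sub>F n in sequentially. 1 / (t\<^sup>2 * (\<delta> / 2)) < real n"
    using filterlim_real_sequentially by (simp only: filterlim_at_top_dense)
  ultimately have "\<forall>\<^sub>F n in sequentially. (\<forall>z\<in>cball 0 \<kappa>. dist (h (r n) z) (G z) < t) \<and> 1 / (t\<^sup>2 * (\<delta> / 2)) < real n"
    by eventually_elim simp
  from eventually_happens'[OF sequentially_bot this]
  obtain n where n: "\<And>z. z\<in>cball 0 \<kappa> \<Longrightarrow> dist (h (r n) z) (G z) < t" "1 / (t\<^sup>2 * (\<delta> / 2)) < real n"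
    by blast
  define N where "N = r n"
  have "n \<le> N" using G(2) by (simp add: N_def seq_suble)
  have low: "t\<^sup>2 \<le> (cmod (h N z))\<^sup>2" if "z \<in> E N - Z m" for z
  proof -
    have "z \<in> cball 0 \<kappa>" "z \<in> disk" using that E(2)[of N] k by (auto simp: subset_iff less_imp_le)
    then have "dist (h N z) (G z) < t" "2 * t \<le> cmod (G z)"
      using n(1) that by (auto simp: N_def Z_def t_def)
    then have "t \<le> cmod (h N z)" 
      using norm_triangle_ineq2[of "G z" "h N z"] by (simp add: dist_norm norm_minus_commute)
    then show ?thesis using t by (intro power_mono) auto
  qed
  have "ennreal (\<delta> / 2) \<le> emeasure area (E N - Z m)"
  proof -
    have "ennreal \<delta> \<le> emeasure area (E N - Z m) + emeasure area (Z m)"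
      using E(3)[of N] emeasure_mono[of "E N" "(E N - Z m) \<union> Z m" area]
        emeasure_subadditive[of "E N - Z m" area "Z m"] by (auto intro: order_trans)
    also have "\<dots> \<le> emeasure area (E N - Z m) + ennreal (\<delta> / 2)"
      using m by (intro add_left_mono) auto
    finally have "ennreal (\<delta> / 2) + ennreal (\<delta> / 2) \<le> emeasure area (E N - Z m) + ennreal (\<delta> / 2)"
      using d by (simp flip: ennreal_plus)
    then show ?thesis by simp
  qed
  then have "ennreal (t\<^sup>2) * ennreal (\<delta> / 2) \<le> ennreal (t\<^sup>2) * emeasure area (E N - Z m)"
    by (rule mult_left_mono) simp
  also have "\<dots> = (\<integral>\<^sup>+z. ennreal (t\<^sup>2) * indicator (E N - Z m) z \<partial>area)"
    by (simp add: nn_integral_cmult_indicator)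
  also have "\<dots> \<le> sq_integral_on area (E N) (h N)"
    using low by (intro nn_integral_mono) (auto simp: indicator_def intro!: ennreal_leI)
  finally have "ennreal (real (Suc N)) * (ennreal (t\<^sup>2) * ennreal (\<delta> / 2))
      \<le> ennreal (real (Suc N)) * sq_integral_on area (E N) (h N)"
    by (rule mult_left_mono) simp
  also have "\<dots> < 1"
    using le_less_trans[OF _ less'[of N], of "ennreal (real (Suc N)) * sq_integral_on area (E N) (h N)"] by simp
  also have "ennreal (real (Suc N)) * (ennreal (t\<^sup>2) * ennreal (\<delta> / 2)) = ennreal (real (Suc N) * (t\<^sup>2 * (\<delta> / 2)))"
    using d by (simp only: ennreal_mult of_nat_0_le_iff mult_nonneg_nonneg zero_le_power2 less_imp_le half_gt_zero)
  finally have "real (Suc N) * (t\<^sup>2 * (\<delta> / 2)) < 1"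
    by (simp only: ennreal_less_one_iff)
  moreover have "1 < real (Suc N) * (t\<^sup>2 * (\<delta> / 2))"
  proof -
    have p: "0 < t\<^sup>2 * (\<delta> / 2)" using t d by simp
    have "1 < real n * (t\<^sup>2 * (\<delta> / 2))" using n(2) p by (simp only: pos_divide_less_eq)
    also have "\<dots> \<le> real (Suc N) * (t\<^sup>2 * (\<delta> / 2))"
      using \<open>n \<le> N\<close> p by (intro mult_right_mono) auto
    finally show ?thesis .
  qed
  ultimately show False by simp
qed

section \<open>Rescaling the local estimate to disks inside the unit disk\<close>

text \<open>Sets such as \<open>{z \<in> disk. \<phi> z > r}\<close> are only Lebesgue measurable,
  so the substitution is carried out in the completed measure and the measurability of the composed
  function is a claim of its own.\<close>

lemma nn_integral_area_scale:
  fixes F :: "complex \<Rightarrow> ennreal"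
  assumes F: "F \<in> borel_measurable area" and s: "0 < s" and sub: "ball b s \<subseteq> disk"
  shows "(\<lambda>u. F (b + of_real s * u)) \<in> borel_measurable area"
    and "(\<integral>\<^sup>+z\<in>ball b s. F z \<partial>area) = ennreal (s\<^sup>2) * (\<integral>\<^sup>+u. F (b + of_real s * u) \<partial>area)"
proof -
  define T where "T u = b + of_real s * u" for u
  have T: "T u = b + (\<Sum>j\<in>Basis. (s * (u \<bullet> j)) *\<^sub>R j)" for u
    unfolding T_def scaleR_scaleR[symmetric] scaleR_sum_right[symmetric] euclidean_representation
    by (simp add: scaleR_conv_of_real)
  have leb: "lebesgue = density (distr lebesgue lebesgue T) (\<lambda>_. ennreal (s\<^sup>2))"
    using lebesgue_affine_euclidean[of "\<lambda>_. s" b] s unfolding T[symmetric]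
    by (simp add: power2_eq_square)
  have [measurable]: "T \<in> lebesgue \<rightarrow>\<^sub>M lebesgue"
    using lebesgue_affine_measurable[of "\<lambda>_. s" b] s unfolding T[symmetric] by simp
  define F' where "F' z = F z * indicator (ball b s) z" for z
  have "F \<in> borel_measurable (lebesgue_on disk)"
    using F by (simp cong: measurable_cong_sets[OF sets_area refl])
  then have "(\<lambda>z. F z * indicator disk z) \<in> borel_measurable lebesgue"
    by (subst (asm) borel_measurable_restrict_space_iff_ennreal) auto
  then have "(\<lambda>z. (F z * indicator disk z) * indicator (ball b s) z) \<in> borel_measurable lebesgue"
    by (rule borel_measurable_times_ennreal) (auto intro: borel_measurable_indicator)
  also have "(\<lambda>z. (F z * indicator disk z) * indicator (ball b s) z) = F'"
    using sub by (auto simp: F'_def indicator_def fun_eq_iff subset_iff)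
  finally have F' [measurable]: "F' \<in> borel_measurable lebesgue" .
  have TB: "T u \<in> ball b s \<longleftrightarrow> u \<in> disk" for u
    using s by (simp add: T_def dist_norm norm_mult)
  have FT: "F' (T u) = F (T u) * indicator disk u" for u
    using TB[of u] by (simp add: F'_def indicator_def)
  have "(\<lambda>u. F' (T u)) \<in> borel_measurable lebesgue" by measurable
  then have "(\<lambda>u. F (T u)) \<in> borel_measurable (lebesgue_on disk)"
    unfolding FT by (subst borel_measurable_restrict_space_iff_ennreal) auto
  then have meas: "(\<lambda>u. F (T u)) \<in> borel_measurable area"
    by (simp cong: measurable_cong_sets[OF sets_area refl])
  then show "(\<lambda>u. F (b + of_real s * u)) \<in> borel_measurable area" by (simp add: T_def)
  have ind: "(\<lambda>z. F z * indicator (ball b s) z) \<in> borel_measurable area"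
    using F by (intro borel_measurable_times_ennreal borel_measurable_indicator borel_sets_area sub) auto
  have "(\<integral>\<^sup>+z\<in>ball b s. F z \<partial>area) = ennreal (1 / pi) * (\<integral>\<^sup>+z. F' z * indicator disk z \<partial>lebesgue)"
    by (subst nn_integral_area[OF ind]) (simp add: F'_def)
  also have "(\<lambda>z. F' z * indicator disk z) = F'"
    using sub by (auto simp: F'_def indicator_def fun_eq_iff subset_iff)
  also have "(\<integral>\<^sup>+z. F' z \<partial>lebesgue) = (\<integral>\<^sup>+z. F' z \<partial>density (distr lebesgue lebesgue T) (\<lambda>_. ennreal (s\<^sup>2)))"
    using leb by simp
  also have "\<dots> = ennreal (s\<^sup>2) * (\<integral>\<^sup>+u. F' (T u) \<partial>lebesgue)"
    by (subst nn_integral_density) (auto simp: nn_integral_cmult nn_integral_distr)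
  also have "(\<integral>\<^sup>+u. F' (T u) \<partial>lebesgue) = (\<integral>\<^sup>+u. F (T u) * indicator disk u \<partial>lebesgue)"
    by (simp only: FT)
  finally show "(\<integral>\<^sup>+z\<in>ball b s. F z \<partial>area) = ennreal (s\<^sup>2) * (\<integral>\<^sup>+u. F (b + of_real s * u) \<partial>area)"
    by (subst nn_integral_area) (use meas in \<open>simp_all add: T_def mult.left_commute\<close>)
qed

lemma scaled_ball_subset_disk:
  assumes "b \<in> disk" "\<eta> \<le> 1"
  shows "ball b (\<eta> * (1 - cmod b)) \<subseteq> disk"
proof
  fix z assume "z \<in> ball b (\<eta> * (1 - cmod b))"
  moreover have "\<eta> * (1 - cmod b) \<le> 1 - cmod b" using assms mult_right_mono[of \<eta> 1 "1 - cmod b"] by simp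
  ultimately have "cmod (z - b) < 1 - cmod b" by (simp add: dist_norm norm_minus_commute)
  then show "z \<in> disk" using norm_triangle_ineq2[of z b] by simp
qed

text \<open>The disk of radius \<open>\<eta>' * (1 - cmod b)\<close> is rescaled to the unit disk.
  The smaller disk becomes \<open>ball 0 (\<eta> / \<eta>')\<close>, so the gap between the two
  radii is what provides the \<kappa> < 1 of the normalised version.\<close>

lemma local_lower_bound:
  assumes eta: "0 < \<eta>" "\<eta> < \<eta>'" "\<eta>' < 1" and e: "0 < \<epsilon>" and d: "0 < \<delta>"
  obtains c :: real where "c > 0"
    "\<And>f b G. f holomorphic_on disk \<Longrightarrow> b \<in> disk \<Longrightarrow> G \<in> sets area \<Longrightarrow>
      ennreal (\<delta> * (1 - cmod b)\<^sup>2) \<le> emeasure area (G \<inter> ball b (\<eta> * (1 - cmod b))) \<Longrightarrow>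
      ennreal ((1 - cmod b)\<^sup>2 * (cmod (f b))\<^sup>2)
        \<le> ennreal \<epsilon> * sq_integral_on area (ball b (\<eta>' * (1 - cmod b))) f
          + ennreal c * (\<integral>\<^sup>+z\<in>ball b (\<eta> * (1 - cmod b)). ennreal ((cmod (f z))\<^sup>2) * indicator G z \<partial>area)"
proof -
  \<comment> \<open>The rescaling has Jacobian
    \<open>s\<^sup>2 = \<eta>'\<^sup>2 * t\<^sup>2\<close>, while the claim is normalised by
    \<open>t\<^sup>2\<close>. This accounts for \<open>\<epsilon> * \<eta>'\<^sup>2\<close> here and
    for \<open>c / \<eta>'\<^sup>2\<close> below.\<close>
  have h: "0 < \<eta> / \<eta>'" "\<eta> / \<eta>' < 1" "0 < \<epsilon> * \<eta>'\<^sup>2" using eta e by auto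
  obtain c where c: "c > 0"
    "\<And>g E. g holomorphic_on disk \<Longrightarrow> E \<in> sets area \<Longrightarrow> E \<subseteq> ball 0 (\<eta> / \<eta>') \<Longrightarrow> ennreal \<delta> \<le> emeasure area E \<Longrightarrow>
      ennreal ((cmod (g 0))\<^sup>2) \<le> ennreal (\<epsilon> * \<eta>'\<^sup>2) * sq_integral area g
        + ennreal c * sq_integral_on area E g"
    by (rule local_lower_bound_unit[OF h d]) blast
  show thesis
  proof
    show "c / \<eta>'\<^sup>2 > 0" using c eta by simp
    fix f b G assume f: "f holomorphic_on disk" and b: "b \<in> disk" and G: "G \<in> sets area" and
      GE: "ennreal (\<delta> * (1 - cmod b)\<^sup>2) \<le> emeasure area (G \<inter> ball b (\<eta> * (1 - cmod b)))"
    define t where "t = 1 - cmod b"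
    define s where "s = \<eta>' * t"
    define H where "H = G \<inter> ball b (\<eta> * t)"
    define E where "E = {u \<in> space area. b + of_real s * u \<in> H}"
    have t: "0 < t" "0 < s" using b eta by (auto simp: t_def s_def)
    have sub: "ball b s \<subseteq> disk" using scaled_ball_subset_disk[OF b, of \<eta>'] eta by (simp add: s_def t_def)
    have sub2: "ball b (\<eta> * t) \<subseteq> ball b s" using eta t by (auto simp: s_def intro!: subset_ball)
    have H [measurable]: "H \<in> sets area"
      unfolding H_def using sub sub2 by (intro sets.Int G borel_sets_area) auto
    note sc = nn_integral_area_scale[OF _ t(2) sub]
    have indE: "indicator H (b + of_real s * u) = indicator E u" if "u \<in> disk" for u
      using that by (simp add: E_def indicator_def)
    have "(\<lambda>u. indicator H (b + of_real s * u) :: ennreal) \<in> borel_measurable area"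
      by (rule sc) measurable
    then have "{u \<in> space area. indicator H (b + of_real s * u) = (1::ennreal)} \<in> sets area"
      by measurable
    also have "{u \<in> space area. indicator H (b + of_real s * u) = (1::ennreal)} = E"
      by (auto simp: E_def indicator_def)
    finally have E [measurable]: "E \<in> sets area" .
    have [measurable]: "(\<lambda>z. ennreal ((cmod (f z))\<^sup>2)) \<in> borel_measurable area"
      using holomorphic_measurable_area[OF f] by measurable
    define g where "g u = f (b + of_real s * u)" for u
    have T: "b + of_real s * u \<in> disk" if "u \<in> disk" for u
    proof -
      have "b + of_real s * u \<in> ball b s" using that t by (simp add: dist_norm norm_mult)
      then show ?thesis using sub by blast
    qed
    have g: "g holomorphic_on disk"
      unfolding g_def using T
      by (intro holomorphic_on_compose_gen[OF _ f, unfolded o_def] holomorphic_intros) auto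
    have HE: "(\<integral>\<^sup>+z\<in>ball b s. F z * indicator H z \<partial>area) = ennreal (s\<^sup>2) * (\<integral>\<^sup>+u\<in>E. F (b + of_real s * u) \<partial>area)"
      if [measurable]: "F \<in> borel_measurable area" for F
    proof -
      have "(\<integral>\<^sup>+z\<in>ball b s. F z * indicator H z \<partial>area)
          = ennreal (s\<^sup>2) * (\<integral>\<^sup>+u. F (b + of_real s * u) * indicator H (b + of_real s * u) \<partial>area)"
        by (rule sc) measurable
      also have "(\<integral>\<^sup>+u. F (b + of_real s * u) * indicator H (b + of_real s * u) \<partial>area)
          = (\<integral>\<^sup>+u\<in>E. F (b + of_real s * u) \<partial>area)"
        by (intro nn_integral_cong) (simp add: indE)
      finally show ?thesis .
    qed
    have HI: "(\<integral>\<^sup>+z\<in>ball b s. F z * indicator H z \<partial>area) = (\<integral>\<^sup>+z\<in>ball b (\<eta> * t). F z * indicator G z \<partial>area)" for F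
      using sub2 by (intro nn_integral_cong) (auto simp: H_def indicator_def)
    have "ennreal (s\<^sup>2) * ennreal \<delta> \<le> ennreal (s\<^sup>2) * emeasure area E"
    proof -
      have "ennreal (s\<^sup>2) * ennreal \<delta> \<le> ennreal (\<delta> * t\<^sup>2)"
        using eta d t by (simp add: s_def power_mult_distrib power_le_one flip: ennreal_mult)
      also have "\<dots> \<le> emeasure area H" using GE by (simp add: H_def t_def)
      also have "\<dots> = (\<integral>\<^sup>+z\<in>ball b s. 1 * indicator H z \<partial>area)"
        using sub2 by (subst nn_integral_indicator[symmetric, OF H])
          (auto simp: H_def indicator_def intro!: nn_integral_cong)
      also have "\<dots> = ennreal (s\<^sup>2) * (\<integral>\<^sup>+u\<in>E. 1 \<partial>area)" by (rule HE) simp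
      finally show ?thesis by simp
    qed
    then have E': "ennreal \<delta> \<le> emeasure area E"
      using t by (simp add: ennreal_mult_le_mult_iff)
    have "E \<subseteq> ball 0 (\<eta> / \<eta>')"
    proof
      fix u assume "u \<in> E"
      then have "s * cmod u < \<eta> * t" using t by (simp add: E_def H_def dist_norm norm_mult)
      then show "u \<in> ball 0 (\<eta> / \<eta>')" using t eta by (simp add: s_def field_simps)
    qed
    from c(2)[OF g E this E']
    have "ennreal (t\<^sup>2) * ennreal ((cmod (f b))\<^sup>2)
      \<le> ennreal (t\<^sup>2) * (ennreal (\<epsilon> * \<eta>'\<^sup>2) * sq_integral area g
        + ennreal c * sq_integral_on area E g)"
      by (intro mult_left_mono) (auto simp: g_def)
    also have "\<dots> = ennreal \<epsilon> * (ennreal (s\<^sup>2) * sq_integral area g)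
        + ennreal (c / \<eta>'\<^sup>2) * (ennreal (s\<^sup>2) * sq_integral_on area E g)"
    proof -
      have "ennreal (t\<^sup>2) * ennreal (\<epsilon> * \<eta>'\<^sup>2) = ennreal \<epsilon> * ennreal (s\<^sup>2)"
        using e by (simp add: s_def power_mult_distrib mult_ac flip: ennreal_mult)
      moreover have "ennreal (t\<^sup>2) * ennreal c = ennreal (c / \<eta>'\<^sup>2) * ennreal (s\<^sup>2)"
        using eta c(1) by (simp add: s_def power_mult_distrib mult_ac flip: ennreal_mult)
      ultimately show ?thesis by (simp only: distrib_left mult.assoc[symmetric])
    qed
    also have "ennreal (s\<^sup>2) * sq_integral area g
        = sq_integral_on area (ball b s) f"
      unfolding g_def by (rule sc(2)[symmetric]) measurable
    also have "ennreal (s\<^sup>2) * sq_integral_on area E g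
        = (\<integral>\<^sup>+z\<in>ball b (\<eta> * t). ennreal ((cmod (f z))\<^sup>2) * indicator G z \<partial>area)"
      unfolding g_def by (subst HI[symmetric], rule HE[symmetric]) measurable
    finally show "ennreal ((1 - cmod b)\<^sup>2 * (cmod (f b))\<^sup>2)
        \<le> ennreal \<epsilon> * sq_integral_on area (ball b (\<eta>' * (1 - cmod b))) f
          + ennreal (c / \<eta>'\<^sup>2) * (\<integral>\<^sup>+z\<in>ball b (\<eta> * (1 - cmod b)). ennreal ((cmod (f z))\<^sup>2) * indicator G z \<partial>area)"
      by (simp only: s_def t_def ennreal_mult zero_le_power2)
  qed
qed

section \<open>Comparable weights and averages over inner disks\<close>

text \<open>One bound for both signs of \<alpha>: the power increases or decreases in
  \<open>x\<close>, so one of the endpoint values dominates, and the other is nonnegative.\<close>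

lemma powr_le_powr_add_powr:
  fixes x :: real
  assumes "0 < a" "a \<le> x" "x \<le> b"
  shows "x powr \<alpha> \<le> a powr \<alpha> + b powr \<alpha>"
proof (cases "\<alpha> \<ge> 0")
  case True
  then have "x powr \<alpha> \<le> b powr \<alpha>" using assms by (intro powr_mono2) auto
  then show ?thesis by (simp add: add_increasing)
next
  case False
  then have "x powr \<alpha> \<le> a powr \<alpha>" using assms by (intro powr_mono2') auto
  then show ?thesis by (simp add: add_increasing2)
qed

text \<open>The weight is a power of \<open>(1 - cmod z) * (1 + cmod z)\<close>, whose second factor
  lies between 1 and 2. Passing from distances to the circle to weights therefore costs at most a
  factor 2 on either side, whence \<open>a / 2\<close> and \<open>2 * A\<close>.\<close>

lemma omega_le_of_comparable:
  assumes al: "\<alpha> > -1" and b: "b \<in> disk" and z: "z \<in> disk" and a: "0 < a"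
    and lo: "a * (1 - cmod z) \<le> 1 - cmod b" and hi: "1 - cmod b \<le> A * (1 - cmod z)"
  shows "omega \<alpha> b \<le> ((a / 2) powr \<alpha> + (2 * A) powr \<alpha>) * omega \<alpha> z"
proof -
  have p: "0 < 1 - cmod z" "0 < 1 - cmod b" using b z by auto
  define x where "x = (1 - (cmod b)\<^sup>2) / (1 - (cmod z)\<^sup>2)"
  have pz: "0 < 1 - (cmod z)\<^sup>2" and pb: "0 < 1 - (cmod b)\<^sup>2"
    using b z disk_square_less[of z] disk_square_less[of b] by auto
  have fz: "1 - (cmod z)\<^sup>2 = (1 - cmod z) * (1 + cmod z)" and fb: "1 - (cmod b)\<^sup>2 = (1 - cmod b) * (1 + cmod b)"
    by (simp_all add: power2_eq_square algebra_simps)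
  have A: "0 < A" using hi p by (metis less_le_trans zero_less_mult_pos2)
  have "a / 2 * ((1 - cmod z) * (1 + cmod z)) \<le> (1 - cmod b) * (1 + cmod b)"
  proof -
    have "a / 2 * ((1 - cmod z) * (1 + cmod z)) = (a * (1 - cmod z)) * ((1 + cmod z) / 2)" by simp
    also have "\<dots> \<le> (1 - cmod b) * (1 + cmod b)"
    proof (rule mult_mono[OF lo])
      have "(1 + cmod z) / 2 \<le> 1" "1 \<le> 1 + cmod b" using p by simp_all
      then show "(1 + cmod z) / 2 \<le> 1 + cmod b" by (rule order_trans)
    qed (use p in auto)
    finally show ?thesis .
  qed
  then have 1: "a / 2 \<le> x" unfolding x_def using pz fz fb by (simp add: pos_le_divide_eq)
  have "(1 - cmod b) * (1 + cmod b) \<le> 2 * A * ((1 - cmod z) * (1 + cmod z))"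
  proof -
    have "(1 - cmod b) * (1 + cmod b) \<le> (A * (1 - cmod z)) * (2 * (1 + cmod z))"
    proof (rule mult_mono[OF hi])
      have "1 + cmod b \<le> 2" "2 \<le> 2 * (1 + cmod z)" using p by simp_all
      then show "1 + cmod b \<le> 2 * (1 + cmod z)" by (rule order_trans)
    qed (use p A in auto)
    also have "\<dots> = 2 * A * ((1 - cmod z) * (1 + cmod z))" by simp
    finally show ?thesis .
  qed
  then have 2: "x \<le> 2 * A" unfolding x_def using pz fz fb by (simp add: pos_divide_le_eq)
  have "omega \<alpha> b = x powr \<alpha> * omega \<alpha> z"
    using pz pb by (simp add: omega_def x_def powr_divide)
  also have "\<dots> \<le> ((a / 2) powr \<alpha> + (2 * A) powr \<alpha>) * omega \<alpha> z"
    using 1 2 a by (intro mult_right_mono powr_le_powr_add_powr omega_nonneg al) auto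
  finally show ?thesis .
qed

lemma comparable_radii:
  assumes eta: "0 < \<eta>" "\<eta> < 1" and z: "dist b z < \<eta> * (1 - cmod b)"
  shows "(1 - \<eta>) * (1 - cmod b) \<le> 1 - cmod z" "1 - cmod z \<le> (1 + \<eta>) * (1 - cmod b)"
proof -
  have "cmod z \<le> cmod b + dist b z" "cmod b \<le> cmod z + dist b z"
    using norm_triangle_ineq2[of z b] norm_triangle_ineq2[of b z]
    by (simp_all add: dist_norm norm_minus_commute)
  then show "(1 - \<eta>) * (1 - cmod b) \<le> 1 - cmod z" "1 - cmod z \<le> (1 + \<eta>) * (1 - cmod b)"
    using z by (simp_all add: algebra_simps)
qed

lemma scaled_ball_measurable [measurable]:
  "(\<lambda>(b, z). indicator (ball b (\<eta> * (1 - cmod b))) z :: ennreal) \<in> borel_measurable (area \<Otimes>\<^sub>M area)"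
proof -
  have "(\<lambda>p. indicator {0<..} (\<eta> * (1 - cmod (fst p)) - dist (fst p) (snd p)) :: ennreal)
      \<in> borel_measurable (area \<Otimes>\<^sub>M area)"
    by measurable
  also have "(\<lambda>p. indicator {0<..} (\<eta> * (1 - cmod (fst p)) - dist (fst p) (snd p)) :: ennreal)
      = (\<lambda>(b, z). indicator (ball b (\<eta> * (1 - cmod b))) z)"
    by (auto simp: indicator_def fun_eq_iff)
  finally show ?thesis .
qed

lemma area_sigma_finite: "sigma_finite_measure area"
  by (rule area.sigma_finite_measure_axioms)

text \<open>By Tonelli the left side integrates \<open>F z\<close> against the mass of all
  \<open>b\<close> whose disk contains \<open>z\<close>. These \<open>b\<close> lie within
  \<open>\<eta> / (1 - \<eta>) * (1 - cmod z)\<close> of \<open>z\<close> and their distances to the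
  circle are comparable to that of \<open>z\<close>, so the area of this set cancels the squared
  distance in the denominator and a multiple of \<open>omega \<alpha> z\<close> remains.\<close>

lemma scaled_ball_average_le:
  assumes al: "\<alpha> > -1" and eta: "0 < \<eta>" "\<eta> < 1"
  obtains C :: real where "C > 0" "\<And>F. F \<in> borel_measurable area \<Longrightarrow>
    (\<integral>\<^sup>+b. ennreal (omega \<alpha> b / (1 - cmod b)\<^sup>2) * (\<integral>\<^sup>+z\<in>ball b (\<eta> * (1 - cmod b)). F z \<partial>area) \<partial>area)
      \<le> ennreal C * (\<integral>\<^sup>+z. F z \<partial>weighted_area \<alpha>)"
proof -
  \<comment> \<open>\<open>K\<close> is the constant of \<open>omega_le_of_comparable\<close> for
    ratios of distances between 1/2 and \<open>1 / (1 - \<eta>)\<close>. In \<open>C\<close>, the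
    factor 4 comes from replacing \<open>(1 - cmod b)\<^sup>2\<close> in the denominator, and the
    last factor is the area bound \<open>\<rho>\<^sup>2\<close> relative to
    \<open>(1 - cmod z)\<^sup>2\<close>.\<close>
  define K where "K = ((1 / 4) powr \<alpha> + (2 / (1 - \<eta>)) powr \<alpha>)"
  define C where "C = K * 4 * (\<eta> / (1 - \<eta>))\<^sup>2"
  have K: "0 < K" unfolding K_def using eta by (intro add_pos_pos) auto
  then have C: "0 < C" unfolding C_def using eta by simp
  have key: "(\<integral>\<^sup>+b. ennreal (omega \<alpha> b / (1 - cmod b)\<^sup>2) * indicator (ball b (\<eta> * (1 - cmod b))) z \<partial>area)
      \<le> ennreal (C * omega \<alpha> z)" if z: "z \<in> disk" for z
  proof -
    define \<rho> where "\<rho> = \<eta> / (1 - \<eta>) * (1 - cmod z)"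
    define w where "w = K * omega \<alpha> z * 4 / (1 - cmod z)\<^sup>2"
    have pz: "0 < 1 - cmod z" using z by simp
    have w: "0 \<le> w" unfolding w_def using K omega_nonneg[OF al] by simp
    have pt: "ennreal (omega \<alpha> b / (1 - cmod b)\<^sup>2) * indicator (ball b (\<eta> * (1 - cmod b))) z
        \<le> ennreal w * indicator (disk \<inter> ball z \<rho>) b" if b: "b \<in> disk" for b
    proof (cases "dist b z < \<eta> * (1 - cmod b)")
      case True
      have pb: "0 < 1 - cmod b" using b by simp
      note c = comparable_radii[OF eta True]
      have 1: "1 / 2 * (1 - cmod z) \<le> 1 - cmod b"
      proof -
        have "(1 + \<eta>) * (1 - cmod b) \<le> 2 * (1 - cmod b)" using eta pb by (intro mult_right_mono) auto
        then show ?thesis using c(2) by simp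
      qed
      have 2: "1 - cmod b \<le> 1 / (1 - \<eta>) * (1 - cmod z)" using c(1) eta by (simp add: field_simps)
      have "omega \<alpha> b \<le> K * omega \<alpha> z"
        using omega_le_of_comparable[OF al b z _ 1 2] by (simp add: K_def)
      moreover have "1 / (1 - cmod b)\<^sup>2 \<le> 4 / (1 - cmod z)\<^sup>2"
      proof -
        have "(1 / 2 * (1 - cmod z))\<^sup>2 \<le> (1 - cmod b)\<^sup>2" using 1 pz by (intro power_mono) auto
        then have "1 / (1 - cmod b)\<^sup>2 \<le> 1 / (1 / 2 * (1 - cmod z))\<^sup>2" using pz pb by (intro frac_le) auto
        then show ?thesis by (simp add: power_divide)
      qed
      ultimately have "omega \<alpha> b * (1 / (1 - cmod b)\<^sup>2) \<le> K * omega \<alpha> z * (4 / (1 - cmod z)\<^sup>2)"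
        using K omega_nonneg[OF al] by (intro mult_mono) auto
      then have "omega \<alpha> b / (1 - cmod b)\<^sup>2 \<le> w" by (simp add: w_def)
      moreover have "b \<in> ball z \<rho>"
      proof -
        have "\<eta> * (1 - cmod b) \<le> \<rho>"
          unfolding \<rho>_def using mult_left_mono[OF 2, of \<eta>] eta by simp
        then show ?thesis using True by (simp add: dist_commute)
      qed
      ultimately show ?thesis using True b by (simp add: ennreal_leI)
    qed simp
    have "(\<integral>\<^sup>+b. ennreal (omega \<alpha> b / (1 - cmod b)\<^sup>2) * indicator (ball b (\<eta> * (1 - cmod b))) z \<partial>area)
      \<le> (\<integral>\<^sup>+b. ennreal w * indicator (disk \<inter> ball z \<rho>) b \<partial>area)"
      using pt by (intro nn_integral_mono) simp
    also have "\<dots> = ennreal w * emeasure area (disk \<inter> ball z \<rho>)"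
      by (intro nn_integral_cmult_indicator borel_sets_area) auto
    also have "\<dots> \<le> ennreal w * ennreal (\<rho>\<^sup>2)"
      using eta pz by (intro mult_left_mono emeasure_area_ball) (auto simp: \<rho>_def)
    also have "\<dots> = ennreal (C * omega \<alpha> z)"
    proof -
      have "w * \<rho>\<^sup>2 = C * omega \<alpha> z"
      proof -
        have "\<rho>\<^sup>2 = (\<eta> / (1 - \<eta>))\<^sup>2 * (1 - cmod z)\<^sup>2" by (simp only: \<rho>_def power_mult_distrib)
        then show ?thesis using pz by (simp add: w_def C_def)
      qed
      then show ?thesis using w by (simp flip: ennreal_mult)
    qed
    finally show ?thesis .
  qed
  show thesis
  proof (rule that[OF C])
    fix F :: "complex \<Rightarrow> ennreal" assume F [measurable]: "F \<in> borel_measurable area"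
    interpret P: pair_sigma_finite area area
      by (simp add: pair_sigma_finite_def area_sigma_finite)
    let ?w = "\<lambda>b. ennreal (omega \<alpha> b / (1 - cmod b)\<^sup>2)"
    let ?I = "\<lambda>b z. indicator (ball b (\<eta> * (1 - cmod b))) z :: ennreal"
    have [measurable]: "(\<lambda>z. ?I b z) \<in> borel_measurable area" for b
      by (intro borel_measurable_area borel_measurable_indicator) auto
    have [measurable]: "(\<lambda>b. ?I b z) \<in> borel_measurable area" if "z \<in> disk" for z
      using measurable_compose[OF measurable_Pair1'[of z area area] scaled_ball_measurable] that
      by simp
    have "(\<integral>\<^sup>+b. ?w b * (\<integral>\<^sup>+z. F z * ?I b z \<partial>area) \<partial>area)
        = (\<integral>\<^sup>+b. (\<integral>\<^sup>+z. ?w b * (F z * ?I b z) \<partial>area) \<partial>area)"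
      by (intro nn_integral_cong nn_integral_cmult[symmetric]) measurable
    also have "\<dots> = (\<integral>\<^sup>+z. (\<integral>\<^sup>+b. ?w b * (F z * ?I b z) \<partial>area) \<partial>area)"
      by (rule P.Fubini') (measurable, simp)
    also have "\<dots> = (\<integral>\<^sup>+z. F z * (\<integral>\<^sup>+b. ?w b * ?I b z \<partial>area) \<partial>area)"
      by (intro nn_integral_cong, subst nn_integral_cmult[symmetric]) (measurable, simp_all add: mult_ac)
    also have "\<dots> \<le> (\<integral>\<^sup>+z. F z * ennreal (C * omega \<alpha> z) \<partial>area)"
      using key by (intro nn_integral_mono mult_left_mono) auto
    also have "\<dots> = (\<integral>\<^sup>+z. ennreal C * (ennreal (omega \<alpha> z) * F z) \<partial>area)"
      using C omega_nonneg[OF al] by (intro nn_integral_cong) (simp add: ennreal_mult mult_ac)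
    also have "\<dots> = ennreal C * (\<integral>\<^sup>+z. F z \<partial>weighted_area \<alpha>)"
      by (simp add: nn_integral_cmult nn_integral_weighted_area)
    finally show "(\<integral>\<^sup>+b. ?w b * (\<integral>\<^sup>+z\<in>ball b (\<eta> * (1 - cmod b)). F z \<partial>area) \<partial>area)
      \<le> ennreal C * (\<integral>\<^sup>+z. F z \<partial>weighted_area \<alpha>)" .
  qed
qed

lemma scaled_ball_integral_measurable:
  assumes [measurable]: "F \<in> borel_measurable area"
  shows "(\<lambda>b. \<integral>\<^sup>+z\<in>ball b (\<eta> * (1 - cmod b)). F z \<partial>area) \<in> borel_measurable area"
proof -
  have "(\<lambda>(b, z). F z * indicator (ball b (\<eta> * (1 - cmod b))) z) \<in> borel_measurable (area \<Otimes>\<^sub>M area)"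
    using borel_measurable_times_ennreal[of "\<lambda>p. F (snd p)", OF _ scaled_ball_measurable]
    by (simp add: case_prod_unfold)
  then show ?thesis
    by (rule sigma_finite_measure.borel_measurable_nn_integral[OF area_sigma_finite])
qed

lemma reverse_carleson_of_inner_balls:
  assumes al: "\<alpha> > -1" and G [measurable]: "G \<in> sets area" and eta: "0 < \<eta>" "\<eta> < 1" and d: "0 < \<delta>"
    and inner: "\<And>b. b \<in> disk \<Longrightarrow> ennreal (\<delta> * (1 - cmod b)\<^sup>2) \<le> emeasure area (G \<inter> ball b (\<eta> * (1 - cmod b)))"
  obtains C :: real where "C > 0" "\<And>f. f holomorphic_on disk \<Longrightarrow>
    sq_integral (weighted_area \<alpha>) f < \<infinity> \<Longrightarrow>
    sq_integral (weighted_area \<alpha>) f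
      \<le> ennreal C * sq_integral_on (weighted_area \<alpha>) G f"
proof -
  define \<eta>' where "\<eta>' = (1 + \<eta>) / 2"
  have eta': "0 < \<eta>'" "\<eta> < \<eta>'" "\<eta>' < 1" using eta by (auto simp: \<eta>'_def)
  obtain C1 where C1: "C1 > 0" "\<And>F. F \<in> borel_measurable area \<Longrightarrow>
    (\<integral>\<^sup>+b. ennreal (omega \<alpha> b / (1 - cmod b)\<^sup>2) * (\<integral>\<^sup>+z\<in>ball b (\<eta>' * (1 - cmod b)). F z \<partial>area) \<partial>area)
      \<le> ennreal C1 * (\<integral>\<^sup>+z. F z \<partial>weighted_area \<alpha>)"
    by (rule scaled_ball_average_le[OF al eta'(1,3)]) blast
  obtain C2 where C2: "C2 > 0" "\<And>F. F \<in> borel_measurable area \<Longrightarrow>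
    (\<integral>\<^sup>+b. ennreal (omega \<alpha> b / (1 - cmod b)\<^sup>2) * (\<integral>\<^sup>+z\<in>ball b (\<eta> * (1 - cmod b)). F z \<partial>area) \<partial>area)
      \<le> ennreal C2 * (\<integral>\<^sup>+z. F z \<partial>weighted_area \<alpha>)"
    by (rule scaled_ball_average_le[OF al eta]) blast
  \<comment> \<open>Chosen so that the \<epsilon>-term, once averaged at the cost of
    \<open>C1\<close>, is exactly half of the left side.\<close>
  define \<epsilon> where "\<epsilon> = 1 / (2 * C1)"
  have e: "0 < \<epsilon>" using C1 by (simp add: \<epsilon>_def)
  obtain c where c: "c > 0" "\<And>f b G. f holomorphic_on disk \<Longrightarrow> b \<in> disk \<Longrightarrow> G \<in> sets area \<Longrightarrow>
      ennreal (\<delta> * (1 - cmod b)\<^sup>2) \<le> emeasure area (G \<inter> ball b (\<eta> * (1 - cmod b))) \<Longrightarrow>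
      ennreal ((1 - cmod b)\<^sup>2 * (cmod (f b))\<^sup>2)
        \<le> ennreal \<epsilon> * sq_integral_on area (ball b (\<eta>' * (1 - cmod b))) f
          + ennreal c * (\<integral>\<^sup>+z\<in>ball b (\<eta> * (1 - cmod b)). ennreal ((cmod (f z))\<^sup>2) * indicator G z \<partial>area)"
    by (rule local_lower_bound[OF eta(1) eta'(2,3) e d]) blast
  show thesis
  proof
    show "2 * c * C2 > 0" using c(1) C2(1) by simp
    fix f assume f: "f holomorphic_on disk"
      and fin: "sq_integral (weighted_area \<alpha>) f < \<infinity>"
    define F where "F z = ennreal ((cmod (f z))\<^sup>2)" for z
    have [measurable]: "F \<in> borel_measurable area"
      unfolding F_def using holomorphic_measurable_area[OF f] by measurable
    define X where "X = (\<integral>\<^sup>+z. F z \<partial>weighted_area \<alpha>)"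
    define Y where "Y = (\<integral>\<^sup>+z. F z * indicator G z \<partial>weighted_area \<alpha>)"
    define w where "w b = ennreal (omega \<alpha> b / (1 - cmod b)\<^sup>2)" for b
    have [measurable]: "w \<in> borel_measurable area" unfolding w_def by measurable
    define I1 where "I1 b = (\<integral>\<^sup>+z\<in>ball b (\<eta>' * (1 - cmod b)). F z \<partial>area)" for b
    define I2 where "I2 b = (\<integral>\<^sup>+z\<in>ball b (\<eta> * (1 - cmod b)). F z * indicator G z \<partial>area)" for b
    have [measurable]: "I1 \<in> borel_measurable area" "I2 \<in> borel_measurable area"
      unfolding I1_def I2_def by (intro scaled_ball_integral_measurable; measurable)+
    \<comment> \<open>The factor \<open>w b\<close> undoes the normalisation of the local bound: on
      the disk, \<open>w b * (1 - cmod b)\<^sup>2\<close> is the weight.\<close>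
    have "X = (\<integral>\<^sup>+b. w b * ennreal ((1 - cmod b)\<^sup>2 * (cmod (f b))\<^sup>2) \<partial>area)"
      unfolding X_def using omega_nonneg[OF al]
      by (subst nn_integral_weighted_area)
        (auto intro!: nn_integral_cong simp: w_def F_def simp flip: ennreal_mult)
    also have "\<dots> \<le> (\<integral>\<^sup>+b. w b * (ennreal \<epsilon> * I1 b + ennreal c * I2 b) \<partial>area)"
    proof (intro nn_integral_mono mult_left_mono)
      fix b assume "b \<in> space area"
      then have b: "b \<in> disk" by simp
      show "ennreal ((1 - cmod b)\<^sup>2 * (cmod (f b))\<^sup>2) \<le> ennreal \<epsilon> * I1 b + ennreal c * I2 b"
        unfolding I1_def I2_def F_def by (rule c(2)[OF f b G inner[OF b]])
    qed simp
    also have "\<dots> = (\<integral>\<^sup>+b. ennreal \<epsilon> * (w b * I1 b) + ennreal c * (w b * I2 b) \<partial>area)"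
      by (simp only: distrib_left mult.left_commute)
    also have "\<dots> = ennreal \<epsilon> * (\<integral>\<^sup>+b. w b * I1 b \<partial>area) + ennreal c * (\<integral>\<^sup>+b. w b * I2 b \<partial>area)"
      by (subst nn_integral_add) (measurable, simp add: nn_integral_cmult)
    also have "\<dots> \<le> ennreal \<epsilon> * (ennreal C1 * X) + ennreal c * (ennreal C2 * Y)"
      unfolding w_def I1_def I2_def X_def Y_def
      by (intro add_mono mult_left_mono C1(2) C2(2)) simp_all
    also have "ennreal \<epsilon> * (ennreal C1 * X) = ennreal (1 / 2) * X"
      using C1(1) e by (simp add: \<epsilon>_def mult.assoc[symmetric] flip: ennreal_mult)
    finally have le: "X \<le> ennreal (1 / 2) * X + ennreal c * (ennreal C2 * Y)" .
    \<comment> \<open>Absorption needs \<open>X\<close> finite, so that half of it can be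
      subtracted. For \<open>Y\<close> infinite the claim is trivial, its coefficient being
      positive.\<close>
    obtain x where x: "0 \<le> x" "X = ennreal x"
    proof -
      have "X < \<infinity>" using fin by (simp only: X_def F_def)
      then show ?thesis using that by (cases X) auto
    qed
    have "X \<le> ennreal (2 * c * C2) * Y"
    proof (cases Y)
      case (real y)
      have "ennreal (1 / 2 * x + c * (C2 * y)) = ennreal (1 / 2) * ennreal x + ennreal c * (ennreal C2 * ennreal y)"
        using x(1) real(1) c(1) C2(1)
        by (simp only: ennreal_plus ennreal_mult mult_nonneg_nonneg less_imp_le zero_le_divide_1_iff zero_le_numeral)
      then have "ennreal x \<le> ennreal (1 / 2 * x + c * (C2 * y))"
        using le x(2) real(2) by simp
      then have "x \<le> 1 / 2 * x + c * (C2 * y)"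
        using x(1) real c(1) C2(1) by (subst (asm) ennreal_le_iff) auto
      then have "x \<le> 2 * c * C2 * y" by simp
      then show ?thesis using x real c(1) C2(1) by (simp flip: ennreal_mult)
    next
      case top
      then show ?thesis using c(1) C2(1) by (simp add: ennreal_mult_top)
    qed
    then show "sq_integral (weighted_area \<alpha>) f
      \<le> ennreal (2 * c * C2) * sq_integral_on (weighted_area \<alpha>) G f"
      by (simp add: X_def Y_def F_def)
  qed
qed

section \<open>From boundary balls to inner disks\<close>

text \<open>After rotating \<open>w\<close> to 1 the set lies in a box of width
  \<open>\<epsilon> * \<rho>\<close> and height \<open>2 * \<rho>\<close>, and the normalisation
  contributes 2 / pi < 1.\<close>

lemma boundary_strip_area:
  assumes w: "cmod w = 1" and r: "0 < \<rho>" and e: "0 < \<epsilon>"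
  shows "{z \<in> disk \<inter> ball w \<rho>. Re (1 - cnj w * z) < \<epsilon> * \<rho>} \<in> sets area"
    and "measure area {z \<in> disk \<inter> ball w \<rho>. Re (1 - cnj w * z) < \<epsilon> * \<rho>} \<le> \<epsilon> * \<rho>\<^sup>2"
proof -
  define S where "S = {z \<in> disk \<inter> ball w \<rho>. Re (1 - cnj w * z) < \<epsilon> * \<rho>}"
  have "open ((disk \<inter> ball w \<rho>) \<inter> {z. Re (1 - cnj w * z) < \<epsilon> * \<rho>})"
    by (intro open_Int open_ball open_Collect_less continuous_intros)
  also have "(disk \<inter> ball w \<rho>) \<inter> {z. Re (1 - cnj w * z) < \<epsilon> * \<rho>} = S" by (auto simp: S_def)
  finally have B [measurable]: "S \<in> sets borel" by simp
  then show S: "S \<in> sets area" unfolding S_def by (intro borel_sets_area) auto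
  define Q where "Q = box (Complex (1 - \<epsilon> * \<rho>) (- \<rho>)) (Complex 1 \<rho>)"
  have "w * cnj w = 1" using w by (simp add: complex_norm_square[symmetric])
  then have ww: "cnj w * (w * y) = y" for y by (simp add: mult.assoc[symmetric] mult.commute)
  have sub: "y \<in> Q" if "w * y \<in> S" for y
  proof -
    have "cmod (w - w * y) = cmod (1 - y)"
      by (metis mult.right_neutral norm_mult right_diff_distrib w mult_1)
    then have 1: "cmod (1 - y) < \<rho>" "cmod y < 1" "Re (1 - y) < \<epsilon> * \<rho>"
      using that w unfolding S_def mem_Collect_eq ww by (auto simp: dist_norm norm_mult)
    have "\<bar>Im (1 - y)\<bar> < \<rho>" using abs_Im_le_cmod[of "1 - y"] 1 by linarith
    moreover have "Re y < 1" using complex_Re_le_cmod[of y] 1 by linarith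
    ultimately show ?thesis using 1 by (auto simp: Q_def box_def Basis_complex_def)
  qed
  have "emeasure lborel S = (\<integral>\<^sup>+y. indicator S (w * y) \<partial>lborel)"
    using nn_integral_lborel_rotation[of "indicator S" w] w by simp
  also have "\<dots> \<le> (\<integral>\<^sup>+y. indicator Q y \<partial>lborel)"
    using sub by (intro nn_integral_mono) (auto simp: indicator_def)
  also have "\<dots> = emeasure lborel Q" by (simp add: Q_def)
  also have "\<dots> = ennreal (2 * \<epsilon> * \<rho>\<^sup>2)"
    unfolding Q_def using r e
    by (subst emeasure_lborel_box) (auto simp: Basis_complex_def power2_eq_square mult_ac)
  finally have "emeasure area S \<le> ennreal (1 / pi) * ennreal (2 * \<epsilon> * \<rho>\<^sup>2)"
    by (subst emeasure_area[OF S]) (auto intro!: mult_left_mono)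
  also have "\<dots> \<le> ennreal (\<epsilon> * \<rho>\<^sup>2)"
  proof -
    have "2 * \<rho>\<^sup>2 \<le> pi * \<rho>\<^sup>2" using pi_gt3 by (intro mult_right_mono) auto
    then have "1 / pi * (2 * \<epsilon> * \<rho>\<^sup>2) \<le> \<epsilon> * \<rho>\<^sup>2" using e by (simp add: field_simps)
    then show ?thesis using e by (simp add: ennreal_leI flip: ennreal_mult)
  qed
  finally have "measure area S \<le> \<epsilon> * \<rho>\<^sup>2"
    using e by (simp add: area.emeasure_eq_measure)
  then show "measure area S \<le> \<epsilon> * \<rho>\<^sup>2" .
qed

text \<open>Write b = (1 - t) w and z = w (1 - v). Then |b - z|^2 = |v|^2 - 2 t Re v + t^2. With |v|
  < \<rho> = \<epsilon> t, and Re v at least \<epsilon> \<rho> off the strip, this is less than (1 -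
  \<epsilon>^2) t^2. So the boundary ball without its strip lies in a disk about b that stays away
  from the circle, which is where the radius \<open>sqrt (1 - \<epsilon>\<^sup>2)\<close> comes
  from.\<close>

lemma inner_balls_of_boundary_balls:
  assumes G [measurable]: "G \<in> sets area" and d: "0 < \<delta>" "\<delta> < 1"
    and bd: "\<forall>w\<in>sphere 0 1. \<forall>\<rho>>0. measure area (G \<inter> ball w \<rho>) \<ge> \<delta> * measure area (disk \<inter> ball w \<rho>)"
  obtains \<eta> \<delta>' where "0 < \<eta>" "\<eta> < 1" "0 < \<delta>'"
    "\<And>b. b \<in> disk \<Longrightarrow> ennreal (\<delta>' * (1 - cmod b)\<^sup>2) \<le> emeasure area (G \<inter> ball b (\<eta> * (1 - cmod b)))"
proof
  \<comment> \<open>The disk meets \<open>ball w \<rho>\<close> in area at least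
    \<open>\<rho>\<^sup>2 / 4\<close>, so \<open>G\<close> has at least
    \<open>2 * \<epsilon> * \<rho>\<^sup>2\<close> there and the strip takes at most half of it.
    What is left, \<open>\<epsilon> * \<rho>\<^sup>2\<close> with
    \<open>\<rho> = \<epsilon> * t\<close>, gives the witness
    \<open>\<epsilon> * \<epsilon>\<^sup>2\<close>.\<close>
  define \<epsilon> where "\<epsilon> = \<delta> / 8"
  have e: "0 < \<epsilon>" "\<epsilon> < 1" using d by (auto simp: \<epsilon>_def)
  have e2: "0 < \<epsilon>\<^sup>2" "\<epsilon>\<^sup>2 < 1" using e by (simp_all add: abs_square_less_1)
  let ?\<eta> = "sqrt (1 - \<epsilon>\<^sup>2)"
  show "0 < ?\<eta>" "?\<eta> < 1" using e2 by auto
  show "0 < \<epsilon> * \<epsilon>\<^sup>2" using e by simp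
  fix b assume b: "b \<in> disk"
  define t where "t = 1 - cmod b"
  define \<rho> where "\<rho> = \<epsilon> * t"
  \<comment> \<open>The radial projection of \<open>b\<close> to the circle; at the centre any
    boundary point will do.\<close>
  define w where "w = (if b = 0 then 1 else b / of_real (cmod b))"
  have t: "0 < t" "t \<le> 1" using b by (auto simp: t_def)
  have r: "0 < \<rho>" "\<rho> \<le> 1" using t e mult_mono[of \<epsilon> 1 t 1] by (auto simp: \<rho>_def)
  have w: "cmod w = 1" by (simp add: w_def norm_divide)
  have bw: "b = w * of_real (1 - t)" by (auto simp: w_def t_def)
  define S where "S = {z \<in> disk \<inter> ball w \<rho>. Re (1 - cnj w * z) < \<epsilon> * \<rho>}"
  have S [measurable]: "S \<in> sets area" and Sm: "measure area S \<le> \<epsilon> * \<rho>\<^sup>2"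
    using boundary_strip_area[OF w r(1) e(1)] by (simp_all add: S_def)
  \<comment> \<open>The disk of radius \<open>\<rho> / 2\<close> that touches the circle from inside
    at \<open>w\<close> gives the lower bound for the area.\<close>
  have inc: "ball (w * of_real (1 - \<rho> / 2)) (\<rho> / 2) \<subseteq> disk \<inter> ball w \<rho>"
  proof
    fix z assume "z \<in> ball (w * of_real (1 - \<rho> / 2)) (\<rho> / 2)"
    then have z: "cmod (z - w * of_real (1 - \<rho> / 2)) < \<rho> / 2" by (simp add: dist_norm norm_minus_commute)
    have "cmod (w * of_real (1 - \<rho> / 2)) = 1 - \<rho> / 2" using r w by (simp add: norm_mult del: of_real_diff of_real_divide)
    then have "cmod z < 1" using z norm_triangle_ineq2[of z "w * of_real (1 - \<rho> / 2)"] by simp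
    moreover have "cmod (w * of_real (1 - \<rho> / 2) - w) = \<rho> / 2"
    proof -
      have "w * of_real (1 - \<rho> / 2) - w = w * of_real (- (\<rho> / 2))" by (simp add: algebra_simps)
      then show ?thesis using r w by (simp add: norm_mult del: of_real_diff of_real_divide of_real_minus)
    qed
    then have "cmod (z - w) < \<rho>"
      using z norm_triangle_ineq[of "z - w * of_real (1 - \<rho> / 2)" "w * of_real (1 - \<rho> / 2) - w"] by simp
    ultimately show "z \<in> disk \<inter> ball w \<rho>" by (simp add: dist_norm norm_minus_commute)
  qed
  have mball: "disk \<inter> ball w \<rho> \<in> sets area" by (intro borel_sets_area) auto
  have "\<rho>\<^sup>2 / 4 = measure area (ball (w * of_real (1 - \<rho> / 2)) (\<rho> / 2))"
    using emeasure_area_ball(2)[of "\<rho> / 2" "w * of_real (1 - \<rho> / 2)"] inc r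
    by (simp add: measure_def power_divide)
  also have "\<dots> \<le> measure area (disk \<inter> ball w \<rho>)"
    by (intro area.finite_measure_mono inc mball)
  finally have "\<delta> * (\<rho>\<^sup>2 / 4) \<le> \<delta> * measure area (disk \<inter> ball w \<rho>)"
    using d by (intro mult_left_mono) auto
  also have "\<dots> \<le> measure area (G \<inter> ball w \<rho>)" using bd w r by (auto simp: sphere_def)
  also have "\<dots> \<le> measure area ((G \<inter> ball w \<rho> - S) \<union> S)"
  proof (intro area.finite_measure_mono)
    have "G \<inter> ball w \<rho> = G \<inter> (disk \<inter> ball w \<rho>)" using sets.sets_into_space[OF G] by auto
    then have [measurable]: "G \<inter> ball w \<rho> \<in> sets area" using mball by auto
    show "G \<inter> ball w \<rho> - S \<union> S \<in> sets area" by measurable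
  qed auto
  also have "\<dots> \<le> measure area (G \<inter> ball w \<rho> - S) + measure area S"
  proof (intro measure_subadditive)
    have "G \<inter> ball w \<rho> = G \<inter> (disk \<inter> ball w \<rho>)" using sets.sets_into_space[OF G] by auto
    then have [measurable]: "G \<inter> ball w \<rho> \<in> sets area" using mball by auto
    show "G \<inter> ball w \<rho> - S \<in> sets area" by measurable
  qed (auto simp: area.emeasure_finite)
  finally have "\<delta> * (\<rho>\<^sup>2 / 4) - \<epsilon> * \<rho>\<^sup>2 \<le> measure area (G \<inter> ball w \<rho> - S)" using Sm by simp
  moreover have "\<delta> * (\<rho>\<^sup>2 / 4) - \<epsilon> * \<rho>\<^sup>2 = \<epsilon> * \<epsilon>\<^sup>2 * t\<^sup>2" 
    unfolding \<epsilon>_def \<rho>_def power_mult_distrib by simp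
  moreover have "measure area (G \<inter> ball w \<rho> - S) \<le> measure area (G \<inter> ball b (?\<eta> * t))"
  proof (intro area.finite_measure_mono)
    have "G \<inter> ball b (?\<eta> * t) = G \<inter> (disk \<inter> ball b (?\<eta> * t))" using sets.sets_into_space[OF G] by auto
    moreover have "disk \<inter> ball b (?\<eta> * t) \<in> sets area" by (intro borel_sets_area) auto
    ultimately show "G \<inter> ball b (?\<eta> * t) \<in> sets area" by auto
    show "G \<inter> ball w \<rho> - S \<subseteq> G \<inter> ball b (?\<eta> * t)"
    proof
      fix z assume z: "z \<in> G \<inter> ball w \<rho> - S"
      have zd: "z \<in> disk" using z sets.sets_into_space[OF G] by auto
      define v where "v = 1 - cnj w * z"
      have "w * cnj w = 1" using w by (simp add: complex_norm_square[symmetric])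
      then have zv: "z = w * (1 - v)" by (simp add: v_def mult.assoc[symmetric])
      have "w - z = w * v" by (subst zv) (simp add: algebra_simps)
      then have "cmod v = dist w z" using w by (simp add: dist_norm norm_mult)
      then have v1: "cmod v < \<rho>" using z by simp
      have v2: "\<epsilon> * \<rho> \<le> Re v" using z zd by (auto simp: S_def v_def)
      have "b - z = w * (v - of_real t)" by (subst bw, subst zv) (simp add: algebra_simps)
      then have "(dist b z)\<^sup>2 = (cmod (v - of_real t))\<^sup>2" using w by (simp add: dist_norm norm_mult)
      also have "\<dots> = (cmod v)\<^sup>2 - 2 * t * Re v + t\<^sup>2"
        unfolding cmod_power2 by (simp add: power2_eq_square algebra_simps)
      also have "\<dots> < \<rho>\<^sup>2 - 2 * t * (\<epsilon> * \<rho>) + t\<^sup>2"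
      proof -
        have "(cmod v)\<^sup>2 < \<rho>\<^sup>2" using power_strict_mono[OF v1, of 2] by simp
        moreover have "2 * t * (\<epsilon> * \<rho>) \<le> 2 * t * Re v" using v2 t by (intro mult_left_mono) auto
        ultimately show ?thesis by linarith
      qed
      also have "\<dots> = (?\<eta> * t)\<^sup>2"
        using e2 by (simp add: \<rho>_def power_mult_distrib power2_eq_square algebra_simps)
      finally have "dist b z < ?\<eta> * t" using t e2 by (intro power2_less_imp_less[of "dist b z"]) auto
      then show "z \<in> G \<inter> ball b (?\<eta> * t)" using z by simp
    qed
  qed
  ultimately show "ennreal (\<epsilon> * \<epsilon>\<^sup>2 * (1 - cmod b)\<^sup>2) \<le> emeasure area (G \<inter> ball b (?\<eta> * (1 - cmod b)))"
    by (simp add: area.emeasure_eq_measure t_def)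
qed

subsection \<open>The space \<open>L2\<close> and a variational problem\<close>

text \<open>The liminf is stated as an eventual inequality with a margin \<open>e\<close>, the form
  that can be combined with the other limits along a sequence.\<close>

lemma Fatou_real:
  fixes u :: "nat \<Rightarrow> 'a \<Rightarrow> real"
  assumes int: "\<And>n. integrable M (u n)" and U [measurable]: "U \<in> borel_measurable M"
    and nn: "\<And>n. AE x in M. 0 \<le> u n x"
    and lim: "AE x in M. (\<lambda>n. u n x) \<longlonglongrightarrow> U x"
    and B: "\<And>n. integral\<^sup>L M (u n) \<le> B"
  shows "integrable M U" and "0 < e \<Longrightarrow> \<forall>\<^sub>F n in sequentially. integral\<^sup>L M U - e < integral\<^sup>L M (u n)"
proof -
  have [measurable]: "u n \<in> borel_measurable M" for n using int by auto
  have nn': "AE x in M. \<forall>n. 0 \<le> u n x" using nn by (simp add: AE_all_countable)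
  have Un: "AE x in M. 0 \<le> U x"
    using lim nn'
  proof eventually_elim
    case (elim x)
    then show ?case by (intro LIMSEQ_le_const[OF elim(1)]) auto
  qed
  have eq: "(\<integral>\<^sup>+x. ennreal (u n x) \<partial>M) = ennreal (integral\<^sup>L M (u n))" for n
    by (rule nn_integral_eq_integral[OF int nn])
  have "(\<integral>\<^sup>+x. ennreal (U x) \<partial>M) = (\<integral>\<^sup>+x. liminf (\<lambda>n. ennreal (u n x)) \<partial>M)"
  proof (rule nn_integral_cong_AE)
    show "AE x in M. ennreal (U x) = liminf (\<lambda>n. ennreal (u n x))"
      using lim
    proof eventually_elim
      case (elim x)
      have "(\<lambda>n. ennreal (u n x)) \<longlonglongrightarrow> ennreal (U x)" by (intro tendsto_ennrealI elim)
      then show ?case by (simp add: lim_imp_Liminf)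
    qed
  qed
  also have "\<dots> \<le> liminf (\<lambda>n. \<integral>\<^sup>+x. ennreal (u n x) \<partial>M)"
    by (rule nn_integral_liminf) simp
  finally have le: "(\<integral>\<^sup>+x. ennreal (U x) \<partial>M) \<le> liminf (\<lambda>n. ennreal (integral\<^sup>L M (u n)))"
    by (simp only: eq)
  also have "\<dots> \<le> liminf (\<lambda>n. ennreal B)"
    by (intro Liminf_mono always_eventually allI ennreal_leI B)
  also have "\<dots> = ennreal B" by (simp add: Liminf_const)
  finally have "(\<integral>\<^sup>+x. ennreal (U x) \<partial>M) < \<infinity>" by (simp add: le_less_trans)
  then show I: "integrable M U"
    using Un by (intro integrableI_nonneg) auto
  have "(\<integral>\<^sup>+x. ennreal (U x) \<partial>M) = ennreal (integral\<^sup>L M U)"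
    by (rule nn_integral_eq_integral[OF I Un])
  with le have le: "ennreal (integral\<^sup>L M U) \<le> liminf (\<lambda>n. ennreal (integral\<^sup>L M (u n)))" by simp
  show "\<forall>\<^sub>F n in sequentially. integral\<^sup>L M U - e < integral\<^sup>L M (u n)" if e: "0 < e"
  proof (cases "integral\<^sup>L M U - e < 0")
    \<comment> \<open>\<open>ennreal\<close> sends negative numbers to 0, so a negative left side is
      treated before passing to extended reals.\<close>
    case True
    have "0 \<le> integral\<^sup>L M (u n)" for n by (rule integral_nonneg_AE[OF nn])
    then show ?thesis using True by (intro always_eventually allI) (rule less_le_trans)
  next
    case False
    then have "ennreal (integral\<^sup>L M U - e) < ennreal (integral\<^sup>L M U)"
      using e by (intro ennreal_lessI) auto
    then have "ennreal (integral\<^sup>L M U - e) < liminf (\<lambda>n. ennreal (integral\<^sup>L M (u n)))"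
      using le by (rule less_le_trans)
    then have "\<forall>\<^sub>F n in sequentially. ennreal (integral\<^sup>L M U - e) < ennreal (integral\<^sup>L M (u n))"
      by (rule less_LiminfD)
    then show ?thesis
    proof eventually_elim
      case (elim n)
      show ?case
      proof (rule ccontr)
        assume "\<not> ?case"
        then show False using elim ennreal_leI[of "integral\<^sup>L M (u n)" "integral\<^sup>L M U - e"] by simp
      qed
    qed
  qed
qed

lemma norm_add_sq_le: "(cmod (a + b))\<^sup>2 \<le> 2 * (cmod a)\<^sup>2 + 2 * (cmod b)\<^sup>2"
proof -
  have "(cmod (a + b))\<^sup>2 + (cmod (a - b))\<^sup>2 = 2 * (cmod a)\<^sup>2 + 2 * (cmod b)\<^sup>2"
    unfolding cmod_power2 by (simp add: power2_eq_square algebra_simps)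
  then show ?thesis using zero_le_power2[of "cmod (a - b)"] by linarith
qed

lemma two_Re_mult_cnj_le:
  assumes "0 < c"
  shows "2 * Re (a * cnj b) \<le> c * (cmod a)\<^sup>2 + (cmod b)\<^sup>2 / c"
proof -
  have "0 \<le> (cmod (of_real (sqrt c) * a - b / of_real (sqrt c)))\<^sup>2" by simp
  also have "\<dots> = c * (cmod a)\<^sup>2 + (cmod b)\<^sup>2 / c - 2 * Re (a * cnj b)"
  proof -
    have "(cmod (of_real (sqrt c) * a - b / of_real (sqrt c)))\<^sup>2
        = (sqrt c)\<^sup>2 * (cmod a)\<^sup>2 + (cmod b)\<^sup>2 / (sqrt c)\<^sup>2 - 2 * Re (a * cnj b)"
      unfolding cmod_power2 using assms
      by (simp add: power2_eq_square field_simps Re_divide_of_real Im_divide_of_real)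
    then show ?thesis using assms by simp
  qed
  finally show ?thesis by simp
qed

abbreviation sqnorm :: "real \<Rightarrow> (complex \<Rightarrow> complex) \<Rightarrow> real" where
  "sqnorm \<alpha> f \<equiv> (LINT z|weighted_area \<alpha>. (cmod (f z))\<^sup>2)"

lemma sqnorm_nonneg: "0 \<le> sqnorm \<alpha> f" by simp

lemma L2_measurable: "f \<in> L2 \<alpha> \<Longrightarrow> f \<in> borel_measurable (weighted_area \<alpha>)"
  and L2_integrable: "f \<in> L2 \<alpha> \<Longrightarrow> integrable (weighted_area \<alpha>) (\<lambda>z. (cmod (f z))\<^sup>2)"
  by (simp_all add: L2_def)

lemma L2_add: 
  assumes f: "f \<in> L2 \<alpha>" and g: "g \<in> L2 \<alpha>"
  shows "(\<lambda>z. f z + g z) \<in> L2 \<alpha>"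
proof -
  note [measurable] = L2_measurable[OF f] L2_measurable[OF g]
  have "integrable (weighted_area \<alpha>) (\<lambda>z. (cmod (f z + g z))\<^sup>2)"
  proof (rule Bochner_Integration.integrable_bound)
    show "integrable (weighted_area \<alpha>) (\<lambda>z. 2 * (cmod (f z))\<^sup>2 + 2 * (cmod (g z))\<^sup>2)"
      using L2_integrable[OF f] L2_integrable[OF g] by simp
    show "AE z in weighted_area \<alpha>. norm ((cmod (f z + g z))\<^sup>2) \<le> norm (2 * (cmod (f z))\<^sup>2 + 2 * (cmod (g z))\<^sup>2)"
      by (rule AE_I2) (simp add: norm_add_sq_le)
  qed measurable
  then show ?thesis by (simp add: L2_def)
qed

lemma L2_mult_bounded:
  assumes f: "f \<in> L2 \<alpha>" and [measurable]: "\<phi> \<in> borel_measurable (weighted_area \<alpha>)"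
    and b: "AE z in weighted_area \<alpha>. cmod (\<phi> z) \<le> m"
  shows "(\<lambda>z. \<phi> z * f z) \<in> L2 \<alpha>" and "sqnorm \<alpha> (\<lambda>z. \<phi> z * f z) \<le> m\<^sup>2 * sqnorm \<alpha> f"
proof -
  note [measurable] = L2_measurable[OF f]
  have le: "AE z in weighted_area \<alpha>. (cmod (\<phi> z * f z))\<^sup>2 \<le> m\<^sup>2 * (cmod (f z))\<^sup>2"
    using b by eventually_elim (auto simp: norm_mult power_mult_distrib intro!: mult_right_mono power_mono)
  have I: "integrable (weighted_area \<alpha>) (\<lambda>z. (cmod (\<phi> z * f z))\<^sup>2)"
    by (rule Bochner_Integration.integrable_bound[where f = "\<lambda>z. m\<^sup>2 * (cmod (f z))\<^sup>2"])
      (use le L2_integrable[OF f] in simp_all)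
  then show "(\<lambda>z. \<phi> z * f z) \<in> L2 \<alpha>" by (simp add: L2_def)
  have "sqnorm \<alpha> (\<lambda>z. \<phi> z * f z) \<le> (LINT z|weighted_area \<alpha>. m\<^sup>2 * (cmod (f z))\<^sup>2)"
    by (rule integral_mono_AE[OF I _ le]) (use L2_integrable[OF f] in auto)
  then show "sqnorm \<alpha> (\<lambda>z. \<phi> z * f z) \<le> m\<^sup>2 * sqnorm \<alpha> f" by simp
qed

lemma L2_cmult: "f \<in> L2 \<alpha> \<Longrightarrow> (\<lambda>z. c * f z) \<in> L2 \<alpha>"
  by (rule L2_mult_bounded(1)[where m = "cmod c"]) auto

lemma L2_minus: "f \<in> L2 \<alpha> \<Longrightarrow> g \<in> L2 \<alpha> \<Longrightarrow> (\<lambda>z. f z - g z) \<in> L2 \<alpha>"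
  using L2_add[of f \<alpha> "\<lambda>z. (-1) * g z"] L2_cmult[of g \<alpha> "-1"] by simp

lemma L2_inner_integrable:
  assumes f: "f \<in> L2 \<alpha>" and g: "g \<in> L2 \<alpha>"
  shows "integrable (weighted_area \<alpha>) (\<lambda>z. f z * cnj (g z))"
proof -
  have [measurable]: "cnj \<in> borel_measurable borel"
    by (intro borel_measurable_continuous_onI continuous_intros)
  note [measurable] = L2_measurable[OF f] L2_measurable[OF g]
  have "cmod a * cmod b \<le> (cmod a)\<^sup>2 + (cmod b)\<^sup>2" for a b :: complex
  proof -
    have "0 \<le> cmod a * cmod b" by simp
    moreover have "2 * (cmod a * cmod b) \<le> (cmod a)\<^sup>2 + (cmod b)\<^sup>2"
      using sum_squares_bound[of "cmod a" "cmod b"] by (simp add: mult.assoc)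
    ultimately show ?thesis by linarith
  qed
  then have le: "AE z in weighted_area \<alpha>. norm (f z * cnj (g z)) \<le> norm ((cmod (f z))\<^sup>2 + (cmod (g z))\<^sup>2)"
    by (intro AE_I2) (simp add: norm_mult)
  show ?thesis
    by (rule Bochner_Integration.integrable_bound[OF _ _ le])
      (use L2_integrable[OF f] L2_integrable[OF g] in simp_all)
qed

lemma L2_inner_add_left:
  "f \<in> L2 \<alpha> \<Longrightarrow> g \<in> L2 \<alpha> \<Longrightarrow> h \<in> L2 \<alpha> \<Longrightarrow> L2_inner \<alpha> (\<lambda>z. f z + g z) h = L2_inner \<alpha> f h + L2_inner \<alpha> g h"
  unfolding L2_inner_def by (simp add: distrib_right L2_inner_integrable)

lemma L2_inner_diff_left:
  "f \<in> L2 \<alpha> \<Longrightarrow> g \<in> L2 \<alpha> \<Longrightarrow> h \<in> L2 \<alpha> \<Longrightarrow> L2_inner \<alpha> (\<lambda>z. f z - g z) h = L2_inner \<alpha> f h - L2_inner \<alpha> g h"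
  unfolding L2_inner_def by (simp add: left_diff_distrib L2_inner_integrable)

lemma L2_inner_add_right:
  "f \<in> L2 \<alpha> \<Longrightarrow> g \<in> L2 \<alpha> \<Longrightarrow> h \<in> L2 \<alpha> \<Longrightarrow> L2_inner \<alpha> h (\<lambda>z. f z + g z) = L2_inner \<alpha> h f + L2_inner \<alpha> h g"
  unfolding L2_inner_def by (simp add: distrib_left L2_inner_integrable)

lemma L2_inner_cmult_left: "L2_inner \<alpha> (\<lambda>z. c * f z) g = c * L2_inner \<alpha> f g"
  unfolding L2_inner_def by (simp add: mult.assoc)

lemma L2_inner_cmult_right: "L2_inner \<alpha> f (\<lambda>z. c * g z) = cnj c * L2_inner \<alpha> f g"
  unfolding L2_inner_def by (simp add: mult.left_commute)

lemma L2_inner_commute: "L2_inner \<alpha> g f = cnj (L2_inner \<alpha> f g)"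
proof -
  have "cnj (L2_inner \<alpha> f g) = (LINT z|weighted_area \<alpha>. cnj (f z * cnj (g z)))"
    unfolding L2_inner_def by (rule Bochner_Integration.integral_cnj[symmetric])
  also have "(\<lambda>z. cnj (f z * cnj (g z))) = (\<lambda>z. g z * cnj (f z))" by (simp add: mult.commute)
  finally show ?thesis by (simp add: L2_inner_def)
qed

lemma L2_inner_self: "L2_inner \<alpha> f f = of_real (sqnorm \<alpha> f)"
  unfolding L2_inner_def by (simp only: complex_norm_square[symmetric] integral_complex_of_real)

text \<open>A form of the Cauchy-Schwarz inequality without roots. The parameter \<open>c\<close> is
  chosen at each use so that the first term can be absorbed.\<close>

lemma two_Re_L2_inner_le:
  assumes f: "f \<in> L2 \<alpha>" and g: "g \<in> L2 \<alpha>" and c: "0 < c"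
  shows "2 * Re (L2_inner \<alpha> f g) \<le> c * sqnorm \<alpha> f + sqnorm \<alpha> g / c"
proof -
  have "2 * Re (L2_inner \<alpha> f g) = (LINT z|weighted_area \<alpha>. 2 * Re (f z * cnj (g z)))"
    unfolding L2_inner_def using L2_inner_integrable[OF f g]
    by (simp add: integral_Re del: times_complex.simps)
  also have "\<dots> \<le> (LINT z|weighted_area \<alpha>. c * (cmod (f z))\<^sup>2 + (cmod (g z))\<^sup>2 / c)"
    using L2_integrable[OF f] L2_integrable[OF g] L2_inner_integrable[OF f g]
    by (intro integral_mono two_Re_mult_cnj_le c)
       (auto intro!: integrable_Re simp del: times_complex.simps)
  also have "\<dots> = c * sqnorm \<alpha> f + sqnorm \<alpha> g / c"
    using L2_integrable[OF f] L2_integrable[OF g] by simp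
  finally show ?thesis .
qed

text \<open>Testing Fatou's lemma on \<open>cmod (f n + t * g)\<^sup>2\<close> for arbitrarily large \<open>t\<close> of either sign
  replaces any weak compactness argument.\<close>

lemma L2_inner_tendsto_0:
  fixes u :: "nat \<Rightarrow> complex \<Rightarrow> complex"
  assumes u: "\<And>n. u n \<in> L2 \<alpha>" and g: "g \<in> L2 \<alpha>" and B: "\<And>n. sqnorm \<alpha> (u n) \<le> B"
    and lim: "AE z in weighted_area \<alpha>. (\<lambda>n. u n z) \<longlonglongrightarrow> 0"
  shows "(\<lambda>n. L2_inner \<alpha> (u n) g) \<longlonglongrightarrow> 0"
proof -
  \<comment> \<open>Only a lower bound on the real part is needed: applied to \<open>k\<close> and
    \<open>-k\<close> it gives the limit of the real part, and the multiple \<i> of \<open>g\<close>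
    turns imaginary parts into real ones.\<close>
  have low: "\<forall>\<^sub>F n in sequentially. - e < Re (L2_inner \<alpha> (u n) k)" if k: "k \<in> L2 \<alpha>" and e: "0 < e" for k e
  proof -
    have B0: "0 \<le> B" using B[of 0] sqnorm_nonneg order_trans by blast
    \<comment> \<open>Expanding the squared norm of \<open>u n + t * k\<close> and comparing with
      Fatou's lemma (margin 1) leaves
      \<open>- (B + 1) < 2 * t * Re (L2_inner \<alpha> (u n) k)\<close>. This \<open>t\<close> makes
      the left side equal to \<open>- 2 * t * e\<close>.\<close>
    define t where "t = (B + 1) / (2 * e)"
    have t: "0 < t" using B0 e by (simp add: t_def)
    define v where "v n z = u n z + of_real t * k z" for n z
    have v: "v n \<in> L2 \<alpha>" for n unfolding v_def by (intro L2_add L2_cmult u k)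
    have tk: "(\<lambda>z. of_real t * k z) \<in> L2 \<alpha>" by (intro L2_cmult k)
    have ev: "sqnorm \<alpha> (v n) = sqnorm \<alpha> (u n) + 2 * t * Re (L2_inner \<alpha> (u n) k) + t\<^sup>2 * sqnorm \<alpha> k" for n
    proof -
      have "of_real (sqnorm \<alpha> (v n)) = L2_inner \<alpha> (v n) (v n)" by (simp only: L2_inner_self)
      also have "\<dots> = (L2_inner \<alpha> (u n) (u n) + L2_inner \<alpha> (u n) (\<lambda>z. of_real t * k z))
          + (L2_inner \<alpha> (\<lambda>z. of_real t * k z) (u n) + L2_inner \<alpha> (\<lambda>z. of_real t * k z) (\<lambda>z. of_real t * k z))"
        unfolding v_def by (simp only: L2_inner_add_left L2_inner_add_right L2_add tk u k)
      also have "\<dots> = of_real (sqnorm \<alpha> (u n)) + of_real t * L2_inner \<alpha> (u n) k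
          + of_real t * cnj (L2_inner \<alpha> (u n) k) + of_real t * (of_real t * of_real (sqnorm \<alpha> k))"
        by (simp only: L2_inner_cmult_left L2_inner_cmult_right L2_inner_self L2_inner_commute[of \<alpha> k "u n"] complex_cnj_complex_of_real) (simp add: algebra_simps)
      finally have "Re (of_real (sqnorm \<alpha> (v n))) = Re \<dots>" by (rule arg_cong)
      then show ?thesis by (simp add: power2_eq_square)
    qed
    have m: "\<forall>\<^sub>F n in sequentially. (LINT z|weighted_area \<alpha>. (cmod (of_real t * k z))\<^sup>2) - 1 < sqnorm \<alpha> (v n)"
    proof (rule Fatou_real(2)[where B = "2 * B + 2 * sqnorm \<alpha> (\<lambda>z. of_real t * k z)"])
      show "integrable (weighted_area \<alpha>) (\<lambda>z. (cmod (v n z))\<^sup>2)" for n by (rule L2_integrable[OF v])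
      show "(\<lambda>z. (cmod (of_real t * k z))\<^sup>2) \<in> borel_measurable (weighted_area \<alpha>)"
        using L2_measurable[OF k] by measurable
      show "AE z in weighted_area \<alpha>. (\<lambda>n. (cmod (v n z))\<^sup>2) \<longlonglongrightarrow> (cmod (of_real t * k z))\<^sup>2"
        using lim
      proof eventually_elim
        case (elim z)
        have "(\<lambda>n. (cmod (v n z))\<^sup>2) \<longlonglongrightarrow> (cmod (0 + of_real t * k z))\<^sup>2"
          unfolding v_def by (intro tendsto_intros elim)
        then show ?case by simp
      qed
      show "sqnorm \<alpha> (v n) \<le> 2 * B + 2 * sqnorm \<alpha> (\<lambda>z. of_real t * k z)" for n
      proof -
        have "sqnorm \<alpha> (v n) \<le> (LINT z|weighted_area \<alpha>. 2 * (cmod (u n z))\<^sup>2 + 2 * (cmod (of_real t * k z))\<^sup>2)"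
          using L2_integrable[OF v] L2_integrable[OF u] L2_integrable[OF tk] norm_add_sq_le
          by (intro integral_mono) (auto simp: v_def)
        also have "\<dots> = 2 * sqnorm \<alpha> (u n) + 2 * sqnorm \<alpha> (\<lambda>z. of_real t * k z)"
          using L2_integrable[OF u] L2_integrable[OF tk] by simp
        finally show ?thesis using B[of n] by linarith
      qed
    qed auto
    have tk2: "(LINT z|weighted_area \<alpha>. (cmod (of_real t * k z))\<^sup>2) = t\<^sup>2 * sqnorm \<alpha> k"
      by (simp add: norm_mult power_mult_distrib)
    from m show ?thesis
    proof eventually_elim
      case (elim n)
      note elim[unfolded tk2]
      then have "- (B + 1) < 2 * t * Re (L2_inner \<alpha> (u n) k)" using ev[of n] B[of n] by simp
      moreover have "B + 1 = 2 * t * e" using e by (simp add: t_def)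
      ultimately have "2 * t * (- e) < 2 * t * Re (L2_inner \<alpha> (u n) k)" by simp
      then show ?case using t by (subst (asm) mult_less_cancel_left_pos) auto
    qed
  qed
  have re: "(\<lambda>n. Re (L2_inner \<alpha> (u n) k)) \<longlonglongrightarrow> 0" if k: "k \<in> L2 \<alpha>" for k
  proof (rule tendstoI)
    fix e :: real assume e: "0 < e"
    have "(\<lambda>z. (-1) * k z) \<in> L2 \<alpha>" by (intro L2_cmult k)
    from low[OF k e] low[OF this e]
    show "\<forall>\<^sub>F n in sequentially. dist (Re (L2_inner \<alpha> (u n) k)) 0 < e"
      by eventually_elim (simp only: L2_inner_cmult_right, simp add: dist_real_def abs_less_iff)
  qed
  have "(\<lambda>n. Im (L2_inner \<alpha> (u n) g)) \<longlonglongrightarrow> 0"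
    using re[OF L2_cmult[OF g, of \<i>]] by (simp add: L2_inner_cmult_right)
  then show ?thesis using re[OF g] by (simp add: tendsto_complex_iff)
qed

lemma L2_sqnorm_diff_le:
  assumes f: "f \<in> L2 \<alpha>" and g: "g \<in> L2 \<alpha>"
  shows "sqnorm \<alpha> (\<lambda>z. f z - g z) \<le> 2 * sqnorm \<alpha> f + 2 * sqnorm \<alpha> g"
proof -
  have "sqnorm \<alpha> (\<lambda>z. f z - g z) \<le> (LINT z|weighted_area \<alpha>. 2 * (cmod (f z))\<^sup>2 + 2 * (cmod (g z))\<^sup>2)"
    using L2_integrable[OF L2_minus[OF f g]] L2_integrable[OF f] L2_integrable[OF g]
      norm_add_sq_le[of "f _" "- g _"]
    by (intro integral_mono) simp_all
  then show ?thesis using L2_integrable[OF f] L2_integrable[OF g] by simp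
qed

section \<open>Point evaluation and compactness in the Bergman space\<close>

lemma nn_integral_sqnorm:
  "f \<in> L2 \<alpha> \<Longrightarrow> sq_integral (weighted_area \<alpha>) f = ennreal (sqnorm \<alpha> f)"
  by (intro nn_integral_eq_integral L2_integrable) simp_all

lemma bergman_L2: "f \<in> bergman \<alpha> \<Longrightarrow> f \<in> L2 \<alpha>"
  and bergman_holomorphic: "f \<in> bergman \<alpha> \<Longrightarrow> f holomorphic_on disk"
  and bergman_outside: "f \<in> bergman \<alpha> \<Longrightarrow> z \<notin> disk \<Longrightarrow> f z = 0"
  by (simp_all add: bergman_def)

lemma bergman_add: "f \<in> bergman \<alpha> \<Longrightarrow> g \<in> bergman \<alpha> \<Longrightarrow> (\<lambda>z. f z + g z) \<in> bergman \<alpha>"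
  by (auto simp: bergman_def L2_add intro: holomorphic_on_add)

lemma bergman_cmult: "f \<in> bergman \<alpha> \<Longrightarrow> (\<lambda>z. c * f z) \<in> bergman \<alpha>"
  by (auto simp: bergman_def L2_cmult intro: holomorphic_on_mult)

lemma bergman_diff: "f \<in> bergman \<alpha> \<Longrightarrow> g \<in> bergman \<alpha> \<Longrightarrow> (\<lambda>z. f z - g z) \<in> bergman \<alpha>"
  by (auto simp: bergman_def L2_minus intro: holomorphic_on_diff)

lemma zero_in_bergman: "(\<lambda>_. 0) \<in> bergman \<alpha>"
  by (simp add: bergman_def L2_def)

lemma bergman_eq_0:
  assumes al: "\<alpha> > -1" and f: "f \<in> bergman \<alpha>" and 0: "sqnorm \<alpha> f = 0"
  shows "f = (\<lambda>_. 0)"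
proof
  fix z
  show "f z = 0"
  proof (cases "z \<in> disk")
    case True
    then have R: "0 \<le> cmod z" "cmod z < 1" by auto
    obtain C where C: "C > 0" "\<And>f w. f holomorphic_on disk \<Longrightarrow> w \<in> cball 0 (cmod z) \<Longrightarrow>
      ennreal ((cmod (f w))\<^sup>2) \<le> ennreal C * sq_integral (weighted_area \<alpha>) f"
      by (rule holomorphic_point_bound[OF al R]) blast
    have "ennreal ((cmod (f z))\<^sup>2) \<le> ennreal C * ennreal 0"
      using C(2)[OF bergman_holomorphic[OF f], of z] unfolding nn_integral_sqnorm[OF bergman_L2[OF f]] 0 by simp
    then show ?thesis by simp
  qed (simp add: bergman_outside[OF f])
qed

text \<open>Weak sequential compactness of bounded sets. Montel's theorem supplies a pointwise
  limit, Fatou's lemma puts it in \<open>L2\<close>, and the differences are bounded and tend to 0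
  pointwise, so \<open>L2_inner_tendsto_0\<close> applies.\<close>

lemma bergman_bounded_sequence:
  assumes al: "\<alpha> > -1" and f: "\<And>n. f n \<in> bergman \<alpha>" and B: "\<And>n. sqnorm \<alpha> (f n) \<le> B"
  obtains h and r :: "nat \<Rightarrow> nat" where "h \<in> bergman \<alpha>" "strict_mono r"
    "\<And>z. (\<lambda>n. f (r n) z) \<longlonglongrightarrow> h z"
    "\<And>F. F \<in> L2 \<alpha> \<Longrightarrow> (\<lambda>n. L2_inner \<alpha> (f (r n)) F) \<longlonglongrightarrow> L2_inner \<alpha> h F"
proof -
  have nB: "sq_integral (weighted_area \<alpha>) (f n) \<le> ennreal B" for n
    unfolding nn_integral_sqnorm[OF bergman_L2[OF f]] by (intro ennreal_leI B)
  obtain g r where g: "g holomorphic_on disk" "strict_mono (r :: nat \<Rightarrow> nat)"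
    "\<And>z. z \<in> disk \<Longrightarrow> (\<lambda>n. f (r n) z) \<longlonglongrightarrow> g z"
    by (rule bounded_L2_normal_family[of \<alpha> f, OF al bergman_holomorphic[OF f] nB]) blast
  define h where "h z = (if z \<in> disk then g z else 0)" for z
  have lim: "(\<lambda>n. f (r n) z) \<longlonglongrightarrow> h z" for z
    using g(3) bergman_outside[OF f] by (simp add: h_def)
  have hol: "h holomorphic_on disk"
    using g(1) by (rule holomorphic_transform) (simp add: h_def)
  have meas [measurable]: "h \<in> borel_measurable (weighted_area \<alpha>)"
    using holomorphic_measurable_area[OF hol] by (simp add: measurable_weighted_area)
  have "integrable (weighted_area \<alpha>) (\<lambda>z. (cmod (h z))\<^sup>2)"
  proof (rule Fatou_real(1))
    show "integrable (weighted_area \<alpha>) (\<lambda>z. (cmod (f (r n) z))\<^sup>2)" for n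
      by (rule L2_integrable[OF bergman_L2[OF f]])
    show "AE z in weighted_area \<alpha>. (\<lambda>n. (cmod (f (r n) z))\<^sup>2) \<longlonglongrightarrow> (cmod (h z))\<^sup>2"
      by (intro AE_I2 tendsto_intros lim)
    show "sqnorm \<alpha> (f (r n)) \<le> B" for n by (rule B)
    show "(\<lambda>z. (cmod (h z))\<^sup>2) \<in> borel_measurable (weighted_area \<alpha>)" by measurable
  qed simp
  then have h: "h \<in> bergman \<alpha>" using hol meas by (simp add: bergman_def L2_def h_def)
  have inner: "(\<lambda>n. L2_inner \<alpha> (f (r n)) F) \<longlonglongrightarrow> L2_inner \<alpha> h F" if F: "F \<in> L2 \<alpha>" for F
  proof -
    have "(\<lambda>n. L2_inner \<alpha> (\<lambda>z. f (r n) z - h z) F) \<longlonglongrightarrow> 0"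
    proof (rule L2_inner_tendsto_0[OF _ F])
      show "(\<lambda>z. f (r n) z - h z) \<in> L2 \<alpha>" for n by (intro L2_minus bergman_L2 f h)
      show "sqnorm \<alpha> (\<lambda>z. f (r n) z - h z) \<le> 2 * B + 2 * sqnorm \<alpha> h" for n
        using L2_sqnorm_diff_le[OF bergman_L2[OF f[of "r n"]] bergman_L2[OF h]] B[of "r n"] by linarith
      show "AE z in weighted_area \<alpha>. (\<lambda>n. f (r n) z - h z) \<longlonglongrightarrow> 0"
      proof (rule AE_I2)
        fix z show "(\<lambda>n. f (r n) z - h z) \<longlonglongrightarrow> 0" using lim[of z] by (simp add: LIM_zero_iff)
      qed
    qed
    then have "(\<lambda>n. L2_inner \<alpha> (f (r n)) F - L2_inner \<alpha> h F) \<longlonglongrightarrow> 0"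
      by (simp only: L2_inner_diff_left bergman_L2[OF f] bergman_L2[OF h] F)
    then show ?thesis by (simp add: LIM_zero_iff)
  qed
  show thesis by (rule that[OF h g(2) lim inner])
qed

text \<open>The first-order condition at a minimum, for the quadratic polynomial that arises by
  moving from the minimiser in one direction.\<close>

lemma linear_coefficient_eq_0:
  fixes a b :: real
  assumes "\<And>s. 0 \<le> s\<^sup>2 * a + 2 * s * b"
  shows "b = 0"
proof (rule ccontr)
  assume b: "b \<noteq> 0"
  \<comment> \<open>Since \<open>k\<close> is positive and exceeds \<open>a\<close>, the quadratic
    takes the value \<open>b\<^sup>2 * (a - 2 * k) / k\<^sup>2 < 0\<close> at
    \<open>s = - b / k\<close>.\<close>
  define k where "k = \<bar>a\<bar> + 1"
  have k: "0 < k" "a < k" by (auto simp: k_def)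
  have "0 \<le> (- b / k)\<^sup>2 * a + 2 * (- b / k) * b" by (rule assms)
  also have "\<dots> = b\<^sup>2 * (a - 2 * k) / k\<^sup>2" using k by (simp add: power2_eq_square field_simps)
  finally have "0 \<le> b\<^sup>2 * (a - 2 * k)" using k by (simp add: zero_le_divide_iff)
  moreover have "b\<^sup>2 * (a - 2 * k) < 0" using b k by (intro mult_pos_neg) auto
  ultimately show False by simp
qed

section \<open>The quadratic form of a bounded symbol and its minimisation\<close>

text \<open>Any positive essential upper bound serves as \<open>m\<close>. Besides the symbol of the
  theorem, the constant symbol 1 is an instance, and it produces the Bergman projection.\<close>

locale bounded_symbol =
  fixes \<alpha> :: real and \<phi> :: "complex \<Rightarrow> real" and m :: real
  assumes alpha: "\<alpha> > -1" and meas [measurable]: "\<phi> \<in> borel_measurable (weighted_area \<alpha>)"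
    and nonneg: "AE z in weighted_area \<alpha>. 0 \<le> \<phi> z"
    and bounded: "AE z in weighted_area \<alpha>. \<phi> z \<le> m" and m_pos: "0 < m"
begin

text \<open>On the Bergman space this is the quadratic form of the Toeplitz operator, and condition
  (5) is its coercivity.\<close>

definition energy :: "(complex \<Rightarrow> complex) \<Rightarrow> real" where
  "energy f = (LINT z|weighted_area \<alpha>. (cmod (f z))\<^sup>2 * \<phi> z)"

abbreviation mult_symbol :: "(complex \<Rightarrow> complex) \<Rightarrow> complex \<Rightarrow> complex" where
  "mult_symbol f \<equiv> (\<lambda>z. complex_of_real (\<phi> z) * f z)"

lemma mult_symbol_L2: "f \<in> L2 \<alpha> \<Longrightarrow> mult_symbol f \<in> L2 \<alpha>"
  and mult_symbol_sqnorm: "f \<in> L2 \<alpha> \<Longrightarrow> sqnorm \<alpha> (mult_symbol f) \<le> m\<^sup>2 * sqnorm \<alpha> f"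
proof -
  have b: "AE z in weighted_area \<alpha>. cmod (complex_of_real (\<phi> z)) \<le> m"
    using nonneg bounded by eventually_elim simp
  show "f \<in> L2 \<alpha> \<Longrightarrow> mult_symbol f \<in> L2 \<alpha>" by (rule L2_mult_bounded(1)[OF _ _ b]) simp_all
  show "f \<in> L2 \<alpha> \<Longrightarrow> sqnorm \<alpha> (mult_symbol f) \<le> m\<^sup>2 * sqnorm \<alpha> f"
    by (rule L2_mult_bounded(2)[OF _ _ b]) simp_all
qed

lemma energy_integrable:
  assumes f: "f \<in> L2 \<alpha>"
  shows "integrable (weighted_area \<alpha>) (\<lambda>z. (cmod (f z))\<^sup>2 * \<phi> z)"
proof -
  note [measurable] = L2_measurable[OF f]
  have le: "AE z in weighted_area \<alpha>. norm ((cmod (f z))\<^sup>2 * \<phi> z) \<le> norm (m * (cmod (f z))\<^sup>2)"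
    using nonneg bounded
  proof eventually_elim
    case (elim z)
    then have "(cmod (f z))\<^sup>2 * \<phi> z \<le> (cmod (f z))\<^sup>2 * m" by (intro mult_left_mono) auto
    then show ?case using elim m_pos by (simp add: abs_mult mult.commute)
  qed
  show ?thesis
    by (rule Bochner_Integration.integrable_bound[OF _ _ le]) (use L2_integrable[OF f] in simp_all)
qed

lemma mult_symbol_inner_self: "L2_inner \<alpha> (mult_symbol f) f = of_real (energy f)"
proof -
  have "complex_of_real (\<phi> z) * f z * cnj (f z) = of_real ((cmod (f z))\<^sup>2 * \<phi> z)" for z
    by (simp only: of_real_mult complex_norm_square mult_ac)
  then show ?thesis unfolding L2_inner_def energy_def by (simp only: integral_complex_of_real)
qed

text \<open>Multiplication by a real symbol is self-adjoint.\<close>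

lemma mult_symbol_inner_commute: "L2_inner \<alpha> (mult_symbol g) f = cnj (L2_inner \<alpha> (mult_symbol f) g)"
proof -
  have "L2_inner \<alpha> (mult_symbol g) f = L2_inner \<alpha> g (mult_symbol f)"
    unfolding L2_inner_def by (simp add: mult_ac)
  then show ?thesis by (simp only: L2_inner_commute[of \<alpha> g "mult_symbol f"])
qed

lemma energy_le: "f \<in> L2 \<alpha> \<Longrightarrow> sqnorm \<alpha> (mult_symbol f) \<le> m * energy f"
proof -
  assume f: "f \<in> L2 \<alpha>"
  have le: "AE z in weighted_area \<alpha>. (cmod (mult_symbol f z))\<^sup>2 \<le> m * ((cmod (f z))\<^sup>2 * \<phi> z)"
    using nonneg bounded
  proof eventually_elim
    case (elim z)
    have "(cmod (f z))\<^sup>2 * \<phi> z * \<phi> z \<le> (cmod (f z))\<^sup>2 * \<phi> z * m" using elim by (intro mult_left_mono) auto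
    then show ?case by (simp add: norm_mult power_mult_distrib power2_eq_square[of "\<phi> z"] mult_ac)
  qed
  have "sqnorm \<alpha> (mult_symbol f) \<le> (LINT z|weighted_area \<alpha>. m * ((cmod (f z))\<^sup>2 * \<phi> z))"
    using energy_integrable[OF f] L2_integrable[OF mult_symbol_L2[OF f]]
    by (intro integral_mono_AE le) simp_all
  then show ?thesis by (simp add: energy_def)
qed

lemma energy_add:
  assumes f: "f \<in> L2 \<alpha>" and g: "g \<in> L2 \<alpha>"
  shows "energy (\<lambda>z. f z + of_real s * g z)
    = energy f + 2 * s * Re (L2_inner \<alpha> (mult_symbol f) g) + s\<^sup>2 * energy g"
proof -
  let ?sg = "\<lambda>z. of_real s * g z"
  have sg: "?sg \<in> L2 \<alpha>" by (rule L2_cmult[OF g])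
  have ms: "mult_symbol ?sg = (\<lambda>z. of_real s * mult_symbol g z)" by (simp add: mult_ac)
  have "complex_of_real (energy (\<lambda>z. f z + ?sg z)) = L2_inner \<alpha> (mult_symbol (\<lambda>z. f z + ?sg z)) (\<lambda>z. f z + ?sg z)"
    by (simp only: mult_symbol_inner_self)
  also have "mult_symbol (\<lambda>z. f z + ?sg z) = (\<lambda>z. mult_symbol f z + mult_symbol ?sg z)"
    by (simp add: distrib_left)
  also have "L2_inner \<alpha> (\<lambda>z. mult_symbol f z + mult_symbol ?sg z) (\<lambda>z. f z + ?sg z)
      = (L2_inner \<alpha> (mult_symbol f) f + L2_inner \<alpha> (mult_symbol f) ?sg)
        + (L2_inner \<alpha> (mult_symbol ?sg) f + L2_inner \<alpha> (mult_symbol ?sg) ?sg)"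
    by (simp only: L2_inner_add_left L2_inner_add_right L2_add f sg mult_symbol_L2)
  also have "\<dots> = of_real (energy f) + of_real s * L2_inner \<alpha> (mult_symbol f) g
      + of_real s * cnj (L2_inner \<alpha> (mult_symbol f) g) + of_real s * (of_real s * of_real (energy g))"
    unfolding ms by (simp only: L2_inner_cmult_left L2_inner_cmult_right mult_symbol_inner_self
        mult_symbol_inner_commute[of g f] complex_cnj_complex_of_real) (simp add: algebra_simps)
  finally have "Re (of_real (energy (\<lambda>z. f z + ?sg z))) = Re \<dots>" by (rule arg_cong)
  then show ?thesis by (simp add: power2_eq_square)
qed

text \<open>The direct method: \<open>h\<close> minimises \<open>\<integral>\<phi>|f|\<^sup>2 - 2 Re \<langle>f, F\<rangle>\<close> over the Bergman space. With
  \<open>\<phi> = 1\<close> this is the existence of the Bergman projection, in general it is the surjectivity of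
  the Toeplitz operator.\<close>

lemma variational_solution:
  assumes C: "0 < C" and coercive: "\<And>f. f \<in> bergman \<alpha> \<Longrightarrow> C * sqnorm \<alpha> f \<le> energy f"
    and F: "F \<in> L2 \<alpha>"
  obtains h where "h \<in> bergman \<alpha>" "\<And>g. g \<in> bergman \<alpha> \<Longrightarrow> L2_inner \<alpha> (mult_symbol h) g = L2_inner \<alpha> F g"
proof -
  define J where "J f = energy f - 2 * Re (L2_inner \<alpha> f F)" for f
  \<comment> \<open>Half of the coercivity absorbs the linear term. The other half makes
    \<open>J\<close> bounded below and bounds the norms of a minimising sequence.\<close>
  have lower: "C / 2 * sqnorm \<alpha> f - 2 / C * sqnorm \<alpha> F \<le> J f" if f: "f \<in> bergman \<alpha>" for f
  proof -
    have "sqnorm \<alpha> F / (C / 2) = 2 / C * sqnorm \<alpha> F" "C * sqnorm \<alpha> f = C / 2 * sqnorm \<alpha> f + C / 2 * sqnorm \<alpha> f"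
      by simp_all
    then show ?thesis
      using two_Re_L2_inner_le[OF bergman_L2[OF f] F, of "C / 2"] coercive[OF f] C by (simp only: J_def) linarith
  qed
  have bdd: "bdd_below (J ` bergman \<alpha>)"
  proof (rule bdd_belowI2)
    fix f assume f: "f \<in> bergman \<alpha>"
    have "0 \<le> C / 2 * sqnorm \<alpha> f" using C by simp
    then show "- (2 / C * sqnorm \<alpha> F) \<le> J f" using lower[OF f] by linarith
  qed
  define d where "d = Inf (J ` bergman \<alpha>)"
  have "\<exists>f\<in>bergman \<alpha>. J f < d + 1 / real (Suc n)" for n
  proof -
    have "Inf (J ` bergman \<alpha>) < d + 1 / real (Suc n)" by (simp add: d_def)
    then show ?thesis using zero_in_bergman by (subst (asm) cInf_less_iff[OF _ bdd]) auto
  qed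
  then obtain f where f: "\<And>n. f n \<in> bergman \<alpha>" and Jf: "\<And>n. J (f n) < d + 1 / real (Suc n)"
    by metis
  have B: "sqnorm \<alpha> (f n) \<le> 2 / C * (d + 1 + 2 / C * sqnorm \<alpha> F)" for n
  proof -
    have "1 / real (Suc n) \<le> 1" by simp
    then have "C / 2 * sqnorm \<alpha> (f n) \<le> d + 1 + 2 / C * sqnorm \<alpha> F" using lower[OF f[of n]] Jf[of n] by linarith
    then have "2 / C * (C / 2 * sqnorm \<alpha> (f n)) \<le> 2 / C * (d + 1 + 2 / C * sqnorm \<alpha> F)"
      using C by (intro mult_left_mono) auto
    then show ?thesis using C by simp
  qed
  obtain h r where h: "h \<in> bergman \<alpha>" and r: "strict_mono (r :: nat \<Rightarrow> nat)"
    and lim: "\<And>z. (\<lambda>n. f (r n) z) \<longlonglongrightarrow> h z"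
    and inner: "\<And>F. F \<in> L2 \<alpha> \<Longrightarrow> (\<lambda>n. L2_inner \<alpha> (f (r n)) F) \<longlonglongrightarrow> L2_inner \<alpha> h F"
    by (rule bergman_bounded_sequence[of \<alpha> f, OF alpha f B]) blast
  note [measurable] = L2_measurable[OF bergman_L2[OF h]]
  have "J h \<le> d"
  proof (rule field_le_epsilon)
    \<comment> \<open>The energy is only lower semicontinuous along the sequence, which is enough at
      a minimum; the linear term converges. The margin is spent as \<open>e / 4\<close> on the
      energy, \<open>e / 2\<close> on the doubled linear term and \<open>e / 4\<close> on the
      distance to the infimum.\<close>
    fix e :: real assume e: "0 < e"
    have "\<forall>\<^sub>F n in sequentially. energy h - e / 4 < energy (f (r n))"
      unfolding energy_def
    proof (rule Fatou_real(2))
      show "integrable (weighted_area \<alpha>) (\<lambda>z. (cmod (f (r n) z))\<^sup>2 * \<phi> z)" for n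
        by (intro energy_integrable bergman_L2 f)
      show "AE z in weighted_area \<alpha>. 0 \<le> (cmod (f (r n) z))\<^sup>2 * \<phi> z" for n
        using nonneg by eventually_elim simp
      show "AE z in weighted_area \<alpha>. (\<lambda>n. (cmod (f (r n) z))\<^sup>2 * \<phi> z) \<longlonglongrightarrow> (cmod (h z))\<^sup>2 * \<phi> z"
        by (intro AE_I2 tendsto_intros lim)
      show "(LINT z|weighted_area \<alpha>. (cmod (f (r n) z))\<^sup>2 * \<phi> z) \<le> m * (2 / C * (d + 1 + 2 / C * sqnorm \<alpha> F))" for n
      proof -
        have "energy (f (r n)) \<le> (LINT z|weighted_area \<alpha>. m * (cmod (f (r n) z))\<^sup>2)"
          unfolding energy_def
        proof (rule integral_mono_AE)
          show "AE z in weighted_area \<alpha>. (cmod (f (r n) z))\<^sup>2 * \<phi> z \<le> m * (cmod (f (r n) z))\<^sup>2"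
            using bounded by eventually_elim (simp add: mult.commute mult_right_mono)
        qed (use energy_integrable L2_integrable bergman_L2 f in simp_all)
        also have "\<dots> = m * sqnorm \<alpha> (f (r n))" by simp
        also have "\<dots> \<le> m * (2 / C * (d + 1 + 2 / C * sqnorm \<alpha> F))"
          using m_pos B by (intro mult_left_mono) auto
        finally show ?thesis by (simp add: energy_def)
      qed
    qed (use e in simp_all)
    moreover have "(\<lambda>n. Re (L2_inner \<alpha> (f (r n)) F)) \<longlonglongrightarrow> Re (L2_inner \<alpha> h F)"
      by (intro tendsto_Re inner F)
    then have "\<forall>\<^sub>F n in sequentially. Re (L2_inner \<alpha> (f (r n)) F) < Re (L2_inner \<alpha> h F) + e / 4"
      using e by (intro order_tendstoD) auto
    moreover have "(\<lambda>n. 1 / real (Suc n)) \<longlonglongrightarrow> 0"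
      using LIMSEQ_inverse_real_of_nat by (simp only: inverse_eq_divide)
    then have "(\<lambda>n. 1 / real (Suc (r n))) \<longlonglongrightarrow> 0"
      using LIMSEQ_subseq_LIMSEQ[OF _ r] by (fastforce simp: o_def)
    then have "\<forall>\<^sub>F n in sequentially. 1 / real (Suc (r n)) < e / 4"
      using e by (intro order_tendstoD) auto
    ultimately have "\<forall>\<^sub>F n in sequentially. J h \<le> d + e"
    proof eventually_elim
      case (elim n)
      then show ?case using Jf[of "r n"] by (simp add: J_def)
    qed
    then show "J h \<le> d + e" by (simp add: eventually_const)
  qed
  have min: "J h \<le> J f" if "f \<in> bergman \<alpha>" for f
    using \<open>J h \<le> d\<close> cInf_lower[OF imageI[OF that] bdd] by (simp add: d_def)
  have re: "Re (L2_inner \<alpha> (mult_symbol h) g) = Re (L2_inner \<alpha> F g)" if g: "g \<in> bergman \<alpha>" for g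
  proof -
    \<comment> \<open>Minimality of \<open>h\<close> along the real line
      \<open>h + s * g\<close>.\<close>
    have "0 \<le> s\<^sup>2 * energy g + 2 * s * (Re (L2_inner \<alpha> (mult_symbol h) g) - Re (L2_inner \<alpha> F g))" for s
    proof -
      let ?sg = "\<lambda>z. of_real s * g z"
      have "J h \<le> J (\<lambda>z. h z + ?sg z)" by (intro min bergman_add bergman_cmult h g)
      moreover have "L2_inner \<alpha> (\<lambda>z. h z + ?sg z) F = L2_inner \<alpha> h F + of_real s * L2_inner \<alpha> g F"
        by (simp only: L2_inner_add_left L2_cmult bergman_L2[OF h] bergman_L2[OF g] F L2_inner_cmult_left)
      moreover have "Re (L2_inner \<alpha> g F) = Re (L2_inner \<alpha> F g)"
        by (subst L2_inner_commute) simp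
      ultimately show ?thesis
        unfolding J_def energy_add[OF bergman_L2[OF h] bergman_L2[OF g]] by (simp add: algebra_simps)
    qed
    from linear_coefficient_eq_0[OF this] show ?thesis by simp
  qed
  \<comment> \<open>Testing with \<i> times \<open>g\<close>, which is again in the Bergman space,
    supplies the imaginary parts.\<close>
  have "L2_inner \<alpha> (mult_symbol h) g = L2_inner \<alpha> F g" if g: "g \<in> bergman \<alpha>" for g
    using re[OF g] re[OF bergman_cmult[OF g, of \<i>]]
    by (simp add: L2_inner_cmult_right complex_eq_iff)
  then show thesis using that[OF h] by blast
qed

end

subsection \<open>Toeplitz operators\<close>

lemma bergman_inner_ext:
  assumes al: "\<alpha> > -1" and h: "h \<in> bergman \<alpha>" and k: "k \<in> bergman \<alpha>"
    and eq: "\<And>g. g \<in> bergman \<alpha> \<Longrightarrow> L2_inner \<alpha> h g = L2_inner \<alpha> k g"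
  shows "h = k"
proof -
  let ?d = "\<lambda>z. h z - k z"
  have d: "?d \<in> bergman \<alpha>" by (rule bergman_diff[OF h k])
  have "L2_inner \<alpha> ?d ?d = 0"
    using eq[OF d] by (simp only: L2_inner_diff_left bergman_L2[OF h] bergman_L2[OF k] bergman_L2[OF d]) simp
  then have "sqnorm \<alpha> ?d = 0" by (simp add: L2_inner_self)
  from bergman_eq_0[OF al d this] show ?thesis by (simp add: fun_eq_iff)
qed

text \<open>The projection is defined by \<open>THE\<close>, so it is identified through uniqueness:
  two candidates have the same inner products with the whole Bergman space and are equal by
  \<open>bergman_inner_ext\<close>.\<close>

lemma bergman_projection_eqI:
  assumes al: "\<alpha> > -1" and h: "h \<in> bergman \<alpha>" and F: "F \<in> L2 \<alpha>"
    and eq: "\<And>g. g \<in> bergman \<alpha> \<Longrightarrow> L2_inner \<alpha> h g = L2_inner \<alpha> F g"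
  shows "bergman_projection \<alpha> F = h"
  unfolding bergman_projection_def
proof (rule the_equality)
  show "h \<in> bergman \<alpha> \<and> (\<forall>g\<in>bergman \<alpha>. L2_inner \<alpha> (\<lambda>z. F z - h z) g = 0)"
    using h eq by (simp add: L2_inner_diff_left F bergman_L2)
  fix k assume k: "k \<in> bergman \<alpha> \<and> (\<forall>g\<in>bergman \<alpha>. L2_inner \<alpha> (\<lambda>z. F z - k z) g = 0)"
  show "k = h"
  proof (rule bergman_inner_ext[OF al _ h])
    show "k \<in> bergman \<alpha>" using k by simp
    show "L2_inner \<alpha> k g = L2_inner \<alpha> h g" if g: "g \<in> bergman \<alpha>" for g
    proof -
      have "L2_inner \<alpha> (\<lambda>z. F z - k z) g = 0" "k \<in> bergman \<alpha>" using k g by auto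
      then show ?thesis using eq[OF g] by (simp add: L2_inner_diff_left F bergman_L2 g)
    qed
  qed
qed

lemma bergman_projection:
  assumes al: "\<alpha> > -1" and F: "F \<in> L2 \<alpha>"
  shows "bergman_projection \<alpha> F \<in> bergman \<alpha>"
    and "g \<in> bergman \<alpha> \<Longrightarrow> L2_inner \<alpha> (bergman_projection \<alpha> F) g = L2_inner \<alpha> F g"
proof -
  \<comment> \<open>For the symbol 1 the energy is the squared norm, so coercivity holds with
    constant 1.\<close>
  interpret one: bounded_symbol \<alpha> "\<lambda>_. 1" 1
    by unfold_locales (use al in auto)
  obtain h where h: "h \<in> bergman \<alpha>" "\<And>g. g \<in> bergman \<alpha> \<Longrightarrow> L2_inner \<alpha> (one.mult_symbol h) g = L2_inner \<alpha> F g"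
    by (rule one.variational_solution[of 1, OF _ _ F]) (simp_all add: one.energy_def)
  then have "bergman_projection \<alpha> F = h"
    by (intro bergman_projection_eqI al F) simp_all
  with h show "bergman_projection \<alpha> F \<in> bergman \<alpha>"
    and "g \<in> bergman \<alpha> \<Longrightarrow> L2_inner \<alpha> (bergman_projection \<alpha> F) g = L2_inner \<alpha> F g"
    by simp_all
qed

context bounded_symbol
begin

abbreviation T :: "(complex \<Rightarrow> complex) \<Rightarrow> complex \<Rightarrow> complex" where
  "T \<equiv> toeplitz \<alpha> (\<lambda>z. complex_of_real (\<phi> z))"

lemma toeplitz_bergman: "f \<in> bergman \<alpha> \<Longrightarrow> T f \<in> bergman \<alpha>"
  and toeplitz_inner: "f \<in> bergman \<alpha> \<Longrightarrow> g \<in> bergman \<alpha> \<Longrightarrow> L2_inner \<alpha> (T f) g = L2_inner \<alpha> (mult_symbol f) g"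
  unfolding toeplitz_def by (simp_all add: bergman_projection alpha mult_symbol_L2 bergman_L2)

lemma toeplitz_eqI:
  assumes "f \<in> bergman \<alpha>" "h \<in> bergman \<alpha>" "\<And>g. g \<in> bergman \<alpha> \<Longrightarrow> L2_inner \<alpha> h g = L2_inner \<alpha> (mult_symbol f) g"
  shows "T f = h"
  unfolding toeplitz_def by (rule bergman_projection_eqI) (use assms in \<open>simp_all add: alpha mult_symbol_L2 bergman_L2\<close>)

text \<open>A projection is a contraction: the inner product of \<open>mult_symbol f\<close> with
  \<open>T f\<close> is the squared norm of \<open>T f\<close>, and
  \<open>two_Re_L2_inner_le\<close> with constant 1 bounds twice this number.\<close>

lemma toeplitz_sqnorm_le:
  assumes f: "f \<in> bergman \<alpha>"
  shows "sqnorm \<alpha> (T f) \<le> sqnorm \<alpha> (mult_symbol f)"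
proof -
  have "L2_inner \<alpha> (mult_symbol f) (T f) = of_real (sqnorm \<alpha> (T f))"
    using toeplitz_inner[OF f toeplitz_bergman[OF f]] by (simp only: L2_inner_self)
  then show ?thesis
    using two_Re_L2_inner_le[OF mult_symbol_L2[OF bergman_L2[OF f]] bergman_L2[OF toeplitz_bergman[OF f]], of 1]
    by simp
qed

lemma mult_symbol_inner_add:
  "f \<in> bergman \<alpha> \<Longrightarrow> g \<in> bergman \<alpha> \<Longrightarrow> k \<in> bergman \<alpha> \<Longrightarrow>
    L2_inner \<alpha> (mult_symbol (\<lambda>z. f z + g z)) k = L2_inner \<alpha> (mult_symbol f) k + L2_inner \<alpha> (mult_symbol g) k"
  by (simp add: distrib_left L2_inner_add_left mult_symbol_L2 bergman_L2)

lemma mult_symbol_inner_cmult: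
  "L2_inner \<alpha> (mult_symbol (\<lambda>z. c * f z)) k = c * L2_inner \<alpha> (mult_symbol f) k"
  by (simp only: mult.left_commute[of _ c] L2_inner_cmult_left)

lemma toeplitz_bounded_operator: "bounded_operator \<alpha> T"
  unfolding bounded_operator_def
proof (intro conjI ballI allI)
  fix f g assume f: "f \<in> bergman \<alpha>" and g: "g \<in> bergman \<alpha>"
  show "T (\<lambda>z. f z + g z) = (\<lambda>z. T f z + T g z)"
    by (rule toeplitz_eqI)
      (use f g in \<open>simp_all add: bergman_add toeplitz_bergman mult_symbol_inner_add L2_inner_add_left bergman_L2 toeplitz_inner\<close>)
next
  fix c f assume f: "f \<in> bergman \<alpha>"
  show "T (\<lambda>z. c * f z) = (\<lambda>z. c * T f z)"
    by (rule toeplitz_eqI)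
      (use f in \<open>simp_all add: bergman_cmult toeplitz_bergman mult_symbol_inner_cmult L2_inner_cmult_left toeplitz_inner\<close>)
next
  have "L2_norm \<alpha> (T f) \<le> m * L2_norm \<alpha> f" if f: "f \<in> bergman \<alpha>" for f
  proof -
    have "sqnorm \<alpha> (T f) \<le> m\<^sup>2 * sqnorm \<alpha> f"
      using toeplitz_sqnorm_le[OF f] mult_symbol_sqnorm[OF bergman_L2[OF f]] by linarith
    then have "sqrt (sqnorm \<alpha> (T f)) \<le> sqrt (m\<^sup>2 * sqnorm \<alpha> f)" by (rule real_sqrt_le_mono)
    also have "\<dots> = m * sqrt (sqnorm \<alpha> f)" using m_pos by (simp add: real_sqrt_mult)
    finally show ?thesis by (simp add: L2_norm_def)
  qed
  then show "\<exists>C. \<forall>f\<in>bergman \<alpha>. L2_norm \<alpha> (T f) \<le> C * L2_norm \<alpha> f" by blast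
qed (rule toeplitz_bergman)

lemma coercive_of_invertible:
  assumes inv: "invertible_operator \<alpha> T"
  shows "\<exists>C>0. \<forall>f\<in>bergman \<alpha>. energy f \<ge> C * sqnorm \<alpha> f"
proof -
  obtain S where S: "\<And>f. f \<in> bergman \<alpha> \<Longrightarrow> S (T f) = f" and "bounded_operator \<alpha> S"
    using inv unfolding invertible_operator_def by blast
  then obtain C where C: "\<And>f. f \<in> bergman \<alpha> \<Longrightarrow> L2_norm \<alpha> (S f) \<le> C * L2_norm \<alpha> f"
    unfolding bounded_operator_def by blast
  \<comment> \<open>The bound in \<open>bounded_operator\<close> may be any real number; it is
    enlarged so that it can be squared and divided by.\<close>
  define D where "D = max C 1"
  have D: "0 < D" "C \<le> D" by (auto simp: D_def)
  have "1 / (D\<^sup>2 * m) * sqnorm \<alpha> f \<le> energy f" if f: "f \<in> bergman \<alpha>" for f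
  proof -
    have "L2_norm \<alpha> f \<le> C * L2_norm \<alpha> (T f)" using C[OF toeplitz_bergman[OF f]] S[OF f] by simp
    also have "\<dots> \<le> D * L2_norm \<alpha> (T f)" using D by (intro mult_right_mono) (simp_all add: L2_norm_def)
    finally have "(L2_norm \<alpha> f)\<^sup>2 \<le> (D * L2_norm \<alpha> (T f))\<^sup>2"
      by (intro power_mono) (simp_all add: L2_norm_def)
    then have "sqnorm \<alpha> f \<le> D\<^sup>2 * sqnorm \<alpha> (T f)" by (simp add: L2_norm_def power_mult_distrib)
    also have "\<dots> \<le> D\<^sup>2 * (m * energy f)"
      using toeplitz_sqnorm_le[OF f] energy_le[OF bergman_L2[OF f]] by (intro mult_left_mono) auto
    finally show ?thesis using D m_pos by (simp add: field_simps)
  qed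
  moreover have "0 < 1 / (D\<^sup>2 * m)" using D m_pos by simp
  ultimately show ?thesis by blast
qed

text \<open>The inverse \<open>S\<close> picks a variational solution for each right-hand side. By
  coercivity such solutions are unique (\<open>inj\<close>); the linearity of \<open>S\<close> and
  \<open>S (T f) = f\<close> follow from this uniqueness. The norm bound comes from testing the
  equation for \<open>S g\<close> with \<open>S g\<close> itself.\<close>

lemma invertible_of_coercive:
  assumes C: "0 < C" and coercive: "\<And>f. f \<in> bergman \<alpha> \<Longrightarrow> C * sqnorm \<alpha> f \<le> energy f"
  shows "invertible_operator \<alpha> T"
proof -
  have "\<exists>h\<in>bergman \<alpha>. \<forall>k\<in>bergman \<alpha>. L2_inner \<alpha> (mult_symbol h) k = L2_inner \<alpha> g k" if g: "g \<in> bergman \<alpha>" for g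
    by (rule variational_solution[OF C coercive bergman_L2[OF g]]) blast+
  then obtain S where S: "\<And>g. g \<in> bergman \<alpha> \<Longrightarrow> S g \<in> bergman \<alpha>"
    and SI: "\<And>g k. g \<in> bergman \<alpha> \<Longrightarrow> k \<in> bergman \<alpha> \<Longrightarrow> L2_inner \<alpha> (mult_symbol (S g)) k = L2_inner \<alpha> g k"
    by metis
  have inj: "h = k" if h: "h \<in> bergman \<alpha>" and k: "k \<in> bergman \<alpha>"
    and eq: "\<And>g. g \<in> bergman \<alpha> \<Longrightarrow> L2_inner \<alpha> (mult_symbol h) g = L2_inner \<alpha> (mult_symbol k) g" for h k
  proof -
    let ?d = "\<lambda>z. h z - k z"
    have d: "?d \<in> bergman \<alpha>" by (rule bergman_diff[OF h k])
    have ms: "mult_symbol ?d = (\<lambda>z. mult_symbol h z - mult_symbol k z)" by (simp add: right_diff_distrib)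
    have "L2_inner \<alpha> (mult_symbol ?d) ?d = 0"
      using eq[OF d] unfolding ms by (simp add: L2_inner_diff_left mult_symbol_L2 bergman_L2 h k d)
    then have "energy ?d = 0" by (simp only: mult_symbol_inner_self of_real_eq_0_iff)
    then have "C * sqnorm \<alpha> ?d \<le> 0" using coercive[OF d] by simp
    then have "sqnorm \<alpha> ?d = 0" using C sqnorm_nonneg[of \<alpha> ?d] by (simp add: mult_le_0_iff)
    from bergman_eq_0[OF alpha d this] show ?thesis by (simp add: fun_eq_iff)
  qed
  have "bounded_operator \<alpha> S"
    unfolding bounded_operator_def
  proof (intro conjI ballI allI)
    fix f g assume f: "f \<in> bergman \<alpha>" and g: "g \<in> bergman \<alpha>"
    show "S (\<lambda>z. f z + g z) = (\<lambda>z. S f z + S g z)"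
      by (rule inj) (use f g in \<open>simp_all add: S SI bergman_add mult_symbol_inner_add L2_inner_add_left bergman_L2\<close>)
  next
    fix c f assume f: "f \<in> bergman \<alpha>"
    show "S (\<lambda>z. c * f z) = (\<lambda>z. c * S f z)"
      by (rule inj) (use f in \<open>simp_all add: S SI bergman_cmult mult_symbol_inner_cmult L2_inner_cmult_left\<close>)
  next
    have "L2_norm \<alpha> (S g) \<le> 1 / C * L2_norm \<alpha> g" if g: "g \<in> bergman \<alpha>" for g
    proof -
      have "C * sqnorm \<alpha> (S g) \<le> energy (S g)" by (rule coercive[OF S[OF g]])
      also have "energy (S g) = Re (L2_inner \<alpha> g (S g))"
        using SI[OF g S[OF g]] mult_symbol_inner_self[of "S g"] by (metis Re_complex_of_real)
      finally have "2 * (C * sqnorm \<alpha> (S g)) \<le> 2 * Re (L2_inner \<alpha> (S g) g)"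
        by (subst L2_inner_commute) simp
      also have "\<dots> \<le> C * sqnorm \<alpha> (S g) + sqnorm \<alpha> g / C"
        by (rule two_Re_L2_inner_le[OF bergman_L2[OF S[OF g]] bergman_L2[OF g] C])
      finally have "sqnorm \<alpha> (S g) \<le> (1 / C)\<^sup>2 * sqnorm \<alpha> g"
        using C by (simp add: field_simps power2_eq_square)
      then have "sqrt (sqnorm \<alpha> (S g)) \<le> sqrt ((1 / C)\<^sup>2 * sqnorm \<alpha> g)" by (rule real_sqrt_le_mono)
      also have "\<dots> = 1 / C * sqrt (sqnorm \<alpha> g)" using C by (simp only: real_sqrt_mult real_sqrt_abs) simp
      finally show ?thesis by (simp add: L2_norm_def)
    qed
    then show "\<exists>D. \<forall>g\<in>bergman \<alpha>. L2_norm \<alpha> (S g) \<le> D * L2_norm \<alpha> g" by blast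
  qed (rule S)
  moreover have "S (T f) = f" if f: "f \<in> bergman \<alpha>" for f
    by (rule inj) (use f in \<open>simp_all add: S SI toeplitz_bergman toeplitz_inner\<close>)
  moreover have "T (S f) = f" if f: "f \<in> bergman \<alpha>" for f
    by (rule toeplitz_eqI) (use f in \<open>simp_all add: S SI\<close>)
  ultimately show ?thesis
    unfolding invertible_operator_def using toeplitz_bounded_operator by blast
qed

end

subsection \<open>The weighted mass near a boundary point\<close>

text \<open>The imaginary part is the first component, so that in iterated integrals the real part
  is integrated innermost, along horizontal lines.\<close>

lemma lborel_complex_eq: "distr (lborel \<Otimes>\<^sub>M lborel) borel (\<lambda>(y, x). Complex x y) = lborel"
proof (rule lborel_eqI[symmetric])
  have [measurable]: "(\<lambda>(y, x). Complex x y) \<in> borel_measurable (lborel \<Otimes>\<^sub>M lborel)"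
    by (simp add: Complex_eq case_prod_unfold)
  fix l u :: complex
  assume le: "\<And>b. b \<in> Basis \<Longrightarrow> l \<bullet> b \<le> u \<bullet> b"
  have "Re l \<le> Re u" "Im l \<le> Im u" using le[of 1] le[of \<i>] by (simp_all add: Basis_complex_def)
  have "emeasure (distr (lborel \<Otimes>\<^sub>M lborel) borel (\<lambda>(y, x). Complex x y)) (box l u)
      = emeasure (lborel \<Otimes>\<^sub>M lborel) ((\<lambda>(y, x). Complex x y) -` box l u \<inter> space (lborel \<Otimes>\<^sub>M lborel))"
    by (rule emeasure_distr) auto
  also have "(\<lambda>(y, x). Complex x y) -` box l u \<inter> space (lborel \<Otimes>\<^sub>M lborel)
      = {Im l<..<Im u} \<times> {Re l<..<Re u}"
    by (auto simp: box_def Basis_complex_def space_pair_measure)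
  also have "emeasure (lborel \<Otimes>\<^sub>M lborel) \<dots> = ennreal (Im u - Im l) * ennreal (Re u - Re l)"
    using \<open>Re l \<le> Re u\<close> \<open>Im l \<le> Im u\<close> by (subst lborel.emeasure_pair_measure_Times) auto
  also have "\<dots> = ennreal (\<Prod>b\<in>Basis. (u - l) \<bullet> b)"
    using \<open>Re l \<le> Re u\<close> \<open>Im l \<le> Im u\<close>
    by (simp add: Basis_complex_def ennreal_mult mult.commute)
  finally show "emeasure (distr (lborel \<Otimes>\<^sub>M lborel) borel (\<lambda>(y, x). Complex x y)) (box l u)
      = ennreal (\<Prod>b\<in>Basis. (u - l) \<bullet> b)" .
qed simp

lemma nn_integral_lborel_complex:
  assumes [measurable]: "f \<in> borel_measurable borel"
  shows "(\<integral>\<^sup>+z. f z \<partial>lborel) = (\<integral>\<^sup>+y. (\<integral>\<^sup>+x. f (Complex x y) \<partial>lborel) \<partial>lborel)"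
proof -
  have m [measurable]: "(\<lambda>(y, x). Complex x y) \<in> borel_measurable (lborel \<Otimes>\<^sub>M lborel)"
    by (simp add: Complex_eq case_prod_unfold)
  have "(\<integral>\<^sup>+z. f z \<partial>lborel) = (\<integral>\<^sup>+z. f z \<partial>distr (lborel \<Otimes>\<^sub>M lborel) borel (\<lambda>(y, x). Complex x y))"
    by (simp add: lborel_complex_eq)
  also have "\<dots> = (\<integral>\<^sup>+p. f (case p of (y, x) \<Rightarrow> Complex x y) \<partial>(lborel \<Otimes>\<^sub>M lborel))"
    by (rule nn_integral_distr) simp_all
  also have "\<dots> = (\<integral>\<^sup>+y. (\<integral>\<^sup>+x. f (Complex x y) \<partial>lborel) \<partial>lborel)"
    by (subst lborel.nn_integral_fst[symmetric]) simp_all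
  finally show ?thesis .
qed

lemma nn_integral_powr_from_0:
  fixes a c :: real
  assumes "a > -1" "0 \<le> c"
  shows "(\<integral>\<^sup>+x. ennreal (x powr a) * indicator {0<..<c} x \<partial>lborel) = ennreal (c powr (a + 1) / (a + 1))"
proof -
  have "((\<lambda>x. x powr a) has_integral (c powr (a + 1) / (a + 1))) {0..c}"
    by (rule has_integral_powr_from_0[OF assms])
  then have "(\<integral>\<^sup>+x. ennreal (x powr a) * indicator {0..c} x \<partial>lborel) = ennreal (c powr (a + 1) / (a + 1))"
    by (rule nn_integral_has_integral_lebesgue'[rotated]) simp
  moreover have "AE x in lborel. x \<noteq> c" by (rule AE_lborel_singleton)
  then have "AE x in lborel. ennreal (x powr a) * indicator {0..c} x = ennreal (x powr a) * indicator {0<..<c} x"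
    by eventually_elim (auto simp: indicator_def)
  then have "(\<integral>\<^sup>+x. ennreal (x powr a) * indicator {0..c} x \<partial>lborel) = (\<integral>\<^sup>+x. ennreal (x powr a) * indicator {0<..<c} x \<partial>lborel)"
    by (rule nn_integral_cong_AE)
  ultimately show ?thesis by simp
qed

lemma open_strip: "open {z \<in> disk \<inter> ball w s. 1 - cmod z < t}"
proof -
  have "open ((disk \<inter> ball w s) \<inter> {z. 1 - cmod z < t})"
    by (intro open_Int open_ball open_Collect_less continuous_intros)
  also have "(disk \<inter> ball w s) \<inter> {z. 1 - cmod z < t} = {z \<in> disk \<inter> ball w s. 1 - cmod z < t}" by auto
  finally show ?thesis .
qed

lemma open_sector: "open {z \<in> disk \<inter> ball w s. 1 - cmod z < t \<and> 1 / 2 < Re (c * z)}"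
proof -
  have "open ({z \<in> disk \<inter> ball w s. 1 - cmod z < t} \<inter> {z. 1 / 2 < Re (c * z)})"
    by (intro open_Int open_strip open_Collect_less continuous_intros)
  also have "{z \<in> disk \<inter> ball w s. 1 - cmod z < t} \<inter> {z. 1 / 2 < Re (c * z)}
      = {z \<in> disk \<inter> ball w s. 1 - cmod z < t \<and> 1 / 2 < Re (c * z)}" by auto
  finally show ?thesis .
qed

text \<open>The horizontal line at height \<open>y\<close> leaves the disk on the right at
  \<open>X y\<close>, and 1 - |z|^2 = (X y - x) (X y + x). For Re z > 1/2 the second factor is
  between 1 and 2, so the weight is at most a multiple of \<open>(X y - x) powr \<alpha>\<close>,
  and \<open>X y - x < 2 * t\<close> in the strip. The inner integral is thus of order
  \<open>t powr (\<alpha> + 1)\<close>, and \<open>y\<close> ranges over an interval of length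
  \<open>2 * s\<close>.\<close>

lemma sector_strip_integral:
  assumes al: "\<alpha> > -1" and t: "0 < t" and s: "0 < s"
  shows "(\<integral>\<^sup>+z. ennreal (omega \<alpha> z) * indicator {z \<in> disk \<inter> ball w s. 1 - cmod z < t \<and> 1 / 2 < Re z} z \<partial>lborel)
    \<le> ennreal ((1 + 2 powr \<alpha>) * 2 powr (\<alpha> + 2) * (s * t powr (\<alpha> + 1)))"
proof -
  define X where "X y = sqrt (1 - y\<^sup>2)" for y :: real
  define A where "A = {z \<in> disk \<inter> ball w s. 1 - cmod z < t \<and> 1 / 2 < Re z}"
  have [measurable]: "A \<in> sets borel"
    using open_sector[of w s t 1] by (simp add: A_def)
  have [measurable]: "omega \<alpha> \<in> borel_measurable borel" unfolding omega_def by measurable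
  define k where "k = (1 + \<alpha>) * (1 + 2 powr \<alpha>)"
  have k: "0 \<le> k" using al by (simp add: k_def)
  define I where "I = {Im w - s<..<Im w + s}"
  have pt: "ennreal (omega \<alpha> (Complex x y)) * indicator A (Complex x y)
      \<le> ennreal k * indicator I y * (ennreal ((X y - x) powr \<alpha>) * indicator {0<..<2 * t} (X y - x))" for x y
  proof (cases "Complex x y \<in> A")
    case True
    define z where "z = Complex x y"
    have z: "cmod z < 1" "dist w z < s" "1 - cmod z < t" "1 / 2 < x" using True by (auto simp: A_def z_def)
    have cz: "(cmod z)\<^sup>2 = x\<^sup>2 + y\<^sup>2" by (simp add: z_def cmod_power2)
    have lt1: "x\<^sup>2 + y\<^sup>2 < 1" using disk_square_less[OF z(1)] cz by simp
    have y2: "y\<^sup>2 \<le> 1" using lt1 zero_le_power2[of x] by linarith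
    have Xy: "(X y)\<^sup>2 = 1 - y\<^sup>2" and X0: "0 \<le> X y" using y2 by (simp_all add: X_def)
    have xX: "x < X y" using lt1 Xy X0 by (intro power2_less_imp_less[of x "X y"]) auto
    have X1: "X y \<le> 1" by (simp add: X_def)
    have fac: "1 - (cmod z)\<^sup>2 = (X y - x) * (X y + x)"
      using Xy cz by (simp add: power2_eq_square algebra_simps)
    have sum: "1 \<le> X y + x" "X y + x \<le> 2" using z(4) xX X1 by auto
    have "X y - x \<le> (X y - x) * (X y + x)" using sum xX by simp
    also have "\<dots> = (1 - cmod z) * (1 + cmod z)" unfolding fac[symmetric] by (simp add: power2_eq_square algebra_simps)
    also have "\<dots> < t * 2" using z t by (intro mult_strict_mono) auto
    finally have d: "X y - x < 2 * t" by simp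
    have "\<bar>Im (w - z)\<bar> < s" using abs_Im_le_cmod[of "w - z"] z(2) by (simp add: dist_norm)
    then have yI: "y \<in> I" by (auto simp: I_def z_def)
    have "(X y + x) powr \<alpha> \<le> 1 powr \<alpha> + 2 powr \<alpha>" using sum by (intro powr_le_powr_add_powr) auto
    then have "(X y - x) powr \<alpha> * (X y + x) powr \<alpha> \<le> (X y - x) powr \<alpha> * (1 + 2 powr \<alpha>)"
      by (intro mult_left_mono) auto
    then have "omega \<alpha> z \<le> k * (X y - x) powr \<alpha>"
      using al sum xX unfolding omega_def fac k_def by (simp add: powr_mult mult_ac)
    then show ?thesis
      using True yI d xX k by (simp add: z_def ennreal_mult[symmetric] ennreal_leI)
  qed simp
  have "(\<integral>\<^sup>+z. ennreal (omega \<alpha> z) * indicator A z \<partial>lborel)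
      = (\<integral>\<^sup>+y. (\<integral>\<^sup>+x. ennreal (omega \<alpha> (Complex x y)) * indicator A (Complex x y) \<partial>lborel) \<partial>lborel)"
    by (rule nn_integral_lborel_complex) measurable
  also have "\<dots> \<le> (\<integral>\<^sup>+y. (\<integral>\<^sup>+x. ennreal k * indicator I y * (ennreal ((X y - x) powr \<alpha>) * indicator {0<..<2 * t} (X y - x)) \<partial>lborel) \<partial>lborel)"
    by (intro nn_integral_mono pt)
  also have "\<dots> = (\<integral>\<^sup>+y. ennreal k * indicator I y * (\<integral>\<^sup>+x. ennreal ((X y - x) powr \<alpha>) * indicator {0<..<2 * t} (X y - x) \<partial>lborel) \<partial>lborel)"
    by (intro nn_integral_cong nn_integral_cmult) measurable
  also have "\<dots> = (\<integral>\<^sup>+y. ennreal k * indicator I y * ennreal ((2 * t) powr (\<alpha> + 1) / (\<alpha> + 1)) \<partial>lborel)"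
  proof (intro nn_integral_cong arg_cong2[where f = "(*)"] refl)
    fix y
    have "(\<integral>\<^sup>+x. ennreal ((X y - x) powr \<alpha>) * indicator {0<..<2 * t} (X y - x) \<partial>lborel)
        = (\<integral>\<^sup>+x. ennreal (x powr \<alpha>) * indicator {0<..<2 * t} x \<partial>lborel)"
      \<comment> \<open>The reflection of \<open>x\<close> at half of \<open>X y\<close> moves the
        singularity of the weight to 0.\<close>
      using nn_integral_real_affine[of "\<lambda>x. ennreal (x powr \<alpha>) * indicator {0<..<2 * t} x" "-1" "X y"] by simp
    also have "\<dots> = ennreal ((2 * t) powr (\<alpha> + 1) / (\<alpha> + 1))"
      using al t by (intro nn_integral_powr_from_0) auto
    finally show "(\<integral>\<^sup>+x. ennreal ((X y - x) powr \<alpha>) * indicator {0<..<2 * t} (X y - x) \<partial>lborel)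
      = ennreal ((2 * t) powr (\<alpha> + 1) / (\<alpha> + 1))" .
  qed
  also have "\<dots> = ennreal k * ennreal (2 * s) * ennreal ((2 * t) powr (\<alpha> + 1) / (\<alpha> + 1))"
    using s by (simp add: nn_integral_multc nn_integral_cmult I_def)
  also have "\<dots> = ennreal (k * (2 * s) * ((2 * t) powr (\<alpha> + 1) / (\<alpha> + 1)))"
  proof -
    have nn: "0 \<le> k" "0 \<le> 2 * s" "0 \<le> (2 * t) powr (\<alpha> + 1) / (\<alpha> + 1)" "0 \<le> k * (2 * s)" using k s al by auto
    show ?thesis by (simp only: ennreal_mult[OF nn(4,3)] ennreal_mult[OF nn(1,2)])
  qed
  also have "k * (2 * s) * ((2 * t) powr (\<alpha> + 1) / (\<alpha> + 1))
      = (1 + 2 powr \<alpha>) * 2 powr (\<alpha> + 2) * (s * t powr (\<alpha> + 1))"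
  proof -
    have "2 powr (\<alpha> + 2) = 2 * 2 powr (\<alpha> + 1)" using powr_add[of 2 1 "\<alpha> + 1"] by (simp add: add.commute)
    then show ?thesis using al t by (simp add: k_def powr_mult field_simps)
  qed
  finally show ?thesis unfolding A_def .
qed

lemma rotated_sector_strip_integral:
  assumes al: "\<alpha> > -1" and t: "0 < t" and s: "0 < s" and c: "cmod c = 1"
  shows "(\<integral>\<^sup>+z. ennreal (omega \<alpha> z) * indicator {z \<in> disk \<inter> ball w s. 1 - cmod z < t \<and> 1 / 2 < Re (c * z)} z \<partial>lborel)
    \<le> ennreal ((1 + 2 powr \<alpha>) * 2 powr (\<alpha> + 2) * (s * t powr (\<alpha> + 1)))"
proof -
  define A where "A = {z \<in> disk \<inter> ball (c * w) s. 1 - cmod z < t \<and> 1 / 2 < Re z}"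
  have [measurable]: "A \<in> sets borel"
    using open_sector[of "c * w" s t 1] by (simp add: A_def)
  have [measurable]: "omega \<alpha> \<in> borel_measurable borel" unfolding omega_def by measurable
  have d: "dist (c * w) (c * z) = dist w z" for z
    using c by (simp add: dist_norm norm_mult flip: right_diff_distrib)
  have "ennreal (omega \<alpha> z) * indicator {z \<in> disk \<inter> ball w s. 1 - cmod z < t \<and> 1 / 2 < Re (c * z)} z
      = ennreal (omega \<alpha> (c * z)) * indicator A (c * z)" for z
    using c d[of z] by (auto simp: A_def omega_def norm_mult indicator_def)
  then have "(\<integral>\<^sup>+z. ennreal (omega \<alpha> z) * indicator {z \<in> disk \<inter> ball w s. 1 - cmod z < t \<and> 1 / 2 < Re (c * z)} z \<partial>lborel)
      = (\<integral>\<^sup>+z. ennreal (omega \<alpha> (c * z)) * indicator A (c * z) \<partial>lborel)"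
    by simp
  also have "\<dots> = (\<integral>\<^sup>+z. ennreal (omega \<alpha> z) * indicator A z \<partial>lborel)"
    by (rule nn_integral_lborel_rotation[OF _ c]) measurable
  also have "\<dots> \<le> ennreal ((1 + 2 powr \<alpha>) * 2 powr (\<alpha> + 2) * (s * t powr (\<alpha> + 1)))"
    unfolding A_def by (rule sector_strip_integral[OF al t s])
  finally show ?thesis .
qed

lemma strip_in_sets: "{z \<in> disk \<inter> ball w s. 1 - cmod z < t} \<in> sets area"
  by (intro borel_sets_area borel_open open_strip) auto

text \<open>The sectors for c = 1, -1, \<i>, -\<i> cover every point with |Re z| > 1/2 or |Im z| >
  1/2. A strip point outside them has modulus at most 3/4, which forces \<open>t\<close>, and with
  it \<open>s\<close>, to be at least 1/4; a constant bound then suffices.\<close>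

lemma weighted_strip_le:
  assumes al: "\<alpha> > -1"
  obtains C :: real where "C > 0" "\<And>w s t. 0 < t \<Longrightarrow> t \<le> s \<Longrightarrow>
    emeasure (weighted_area \<alpha>) {z \<in> disk \<inter> ball w s. 1 - cmod z < t} \<le> ennreal (C * (s * t powr (\<alpha> + 1)))"
proof -
  define K where "K = (1 + 2 powr \<alpha>) * 2 powr (\<alpha> + 2)"
  \<comment> \<open>For the part outside the sectors: the weight there is at most
    \<open>(1 + \<alpha>) * ((1 / 2) powr \<alpha> + 1)\<close>, the disk has Lebesgue area
    \<open>pi\<close>, and the last factor times \<open>P\<close> is at least 1 because
    \<open>s\<close> and \<open>t\<close> are at least 1/4.\<close>
  define L where "L = (1 + \<alpha>) * ((1 / 2) powr \<alpha> + 1) * pi * (4 * 4 powr (\<alpha> + 1))"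
  have K: "0 < K" unfolding K_def by (intro mult_pos_pos add_pos_pos) auto
  have L: "0 < L" unfolding L_def using al by (intro mult_pos_pos) (auto intro: add_nonneg_pos)
  show thesis
  proof
    show "1 / pi * (4 * K + L) > 0" using K L by simp
    fix w :: complex and s t :: real assume t: "0 < t" and ts: "t \<le> s"
    then have s: "0 < s" by simp
    define P where "P = s * t powr (\<alpha> + 1)"
    have P: "0 \<le> P" using s by (simp add: P_def)
    define A where "A = {z \<in> disk \<inter> ball w s. 1 - cmod z < t}"
    have A [measurable]: "A \<in> sets area" unfolding A_def by (rule strip_in_sets)
    have AB [measurable]: "A \<in> sets borel" unfolding A_def by (intro borel_open open_strip)
    define S where "S c = {z \<in> disk \<inter> ball w s. 1 - cmod z < t \<and> 1 / 2 < Re (c * z)}" for c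
    have S [measurable]: "S c \<in> sets borel" for c
      unfolding S_def by (intro borel_open open_sector)
    have [measurable]: "omega \<alpha> \<in> borel_measurable borel" unfolding omega_def by measurable
    have [measurable]: "disk \<in> sets borel" by simp
    have pt: "ennreal (omega \<alpha> z) * indicator A z \<le>
        ennreal (omega \<alpha> z) * indicator (S 1) z + ennreal (omega \<alpha> z) * indicator (S (-1)) z
        + ennreal (omega \<alpha> z) * indicator (S \<i>) z + ennreal (omega \<alpha> z) * indicator (S (-\<i>)) z
        + ennreal (L / pi * P) * indicator disk z" for z
    proof (cases "z \<in> A \<and> z \<notin> S 1 \<and> z \<notin> S (-1) \<and> z \<notin> S \<i> \<and> z \<notin> S (-\<i>)")
      case True
      then have zA: "cmod z < 1" "1 - cmod z < t" by (auto simp: A_def)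
      have "\<bar>Re z\<bar> \<le> 1 / 2" "\<bar>Im z\<bar> \<le> 1 / 2" using True by (auto simp: A_def S_def)
      then have "(Re z)\<^sup>2 \<le> (1 / 2)\<^sup>2" "(Im z)\<^sup>2 \<le> (1 / 2)\<^sup>2" by (simp_all add: abs_le_square_iff[symmetric])
      then have sq: "(cmod z)\<^sup>2 \<le> 1 / 2" by (simp add: cmod_power2 power_divide)
      have "cmod z \<le> 3 / 4"
      proof (rule power2_le_imp_le)
        show "(cmod z)\<^sup>2 \<le> (3 / 4)\<^sup>2" using sq by (simp add: power_divide)
      qed simp
      then have t4: "1 / 4 \<le> t" using zA by simp
      have "(1 / 4) powr (\<alpha> + 1) \<le> t powr (\<alpha> + 1)" using t4 al by (intro powr_mono2) auto
      then have "1 / 4 * (1 / 4) powr (\<alpha> + 1) \<le> P" unfolding P_def using t4 ts by (intro mult_mono) auto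
      then have P1: "1 \<le> (4 * 4 powr (\<alpha> + 1)) * P" by (simp add: powr_divide field_simps)
      have "(1 - (cmod z)\<^sup>2) powr \<alpha> \<le> (1 / 2) powr \<alpha> + 1 powr \<alpha>"
        using sq by (intro powr_le_powr_add_powr) auto
      then have "omega \<alpha> z \<le> (1 + \<alpha>) * ((1 / 2) powr \<alpha> + 1) * 1"
        using al by (simp add: omega_def mult_left_mono)
      also have "\<dots> \<le> (1 + \<alpha>) * ((1 / 2) powr \<alpha> + 1) * ((4 * 4 powr (\<alpha> + 1)) * P)"
        using P1 al by (intro mult_left_mono) auto
      also have "\<dots> = L / pi * P" by (simp add: L_def)
      finally have "omega \<alpha> z \<le> L / pi * P" .
      then show ?thesis using zA by (simp add: indicator_def ennreal_leI add_increasing)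
    next
      case False
      then show ?thesis by (auto simp: indicator_def add_increasing add_increasing2)
    qed
    have "emeasure (weighted_area \<alpha>) A = (\<integral>\<^sup>+z. indicator A z \<partial>weighted_area \<alpha>)"
      using A by (simp add: sets_area sets_weighted_area)
    also have "\<dots> = (\<integral>\<^sup>+z. ennreal (omega \<alpha> z) * indicator A z \<partial>area)"
      by (rule nn_integral_weighted_area) measurable
    also have "\<dots> = ennreal (1 / pi) * (\<integral>\<^sup>+z. ennreal (omega \<alpha> z) * indicator A z * indicator disk z \<partial>lebesgue)"
      by (rule nn_integral_area) measurable
    also have "(\<integral>\<^sup>+z. ennreal (omega \<alpha> z) * indicator A z * indicator disk z \<partial>lebesgue)
        \<le> (\<integral>\<^sup>+z. ennreal (omega \<alpha> z) * indicator A z \<partial>lborel)"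
      unfolding nn_integral_completion by (intro nn_integral_mono) (auto simp: indicator_def)
    also have "\<dots> \<le> (\<integral>\<^sup>+z. ennreal (omega \<alpha> z) * indicator (S 1) z + ennreal (omega \<alpha> z) * indicator (S (-1)) z
        + ennreal (omega \<alpha> z) * indicator (S \<i>) z + ennreal (omega \<alpha> z) * indicator (S (-\<i>)) z
        + ennreal (L / pi * P) * indicator disk z \<partial>lborel)"
      by (intro nn_integral_mono pt)
    also have "\<dots> = (\<integral>\<^sup>+z. ennreal (omega \<alpha> z) * indicator (S 1) z \<partial>lborel) + (\<integral>\<^sup>+z. ennreal (omega \<alpha> z) * indicator (S (-1)) z \<partial>lborel)
        + (\<integral>\<^sup>+z. ennreal (omega \<alpha> z) * indicator (S \<i>) z \<partial>lborel) + (\<integral>\<^sup>+z. ennreal (omega \<alpha> z) * indicator (S (-\<i>)) z \<partial>lborel)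
        + (\<integral>\<^sup>+z. ennreal (L / pi * P) * indicator disk z \<partial>lborel)"
      by (simp add: nn_integral_add)
    also have "\<dots> \<le> ennreal (K * P) + ennreal (K * P) + ennreal (K * P) + ennreal (K * P) + ennreal (L * P)"
    proof (intro add_mono)
      have Sb: "(\<integral>\<^sup>+z. ennreal (omega \<alpha> z) * indicator (S c) z \<partial>lborel) \<le> ennreal (K * P)" if "cmod c = 1" for c
        unfolding S_def K_def P_def by (rule rotated_sector_strip_integral[OF al t s that])
      show "(\<integral>\<^sup>+z. ennreal (omega \<alpha> z) * indicator (S 1) z \<partial>lborel) \<le> ennreal (K * P)"
        "(\<integral>\<^sup>+z. ennreal (omega \<alpha> z) * indicator (S (-1)) z \<partial>lborel) \<le> ennreal (K * P)"
        "(\<integral>\<^sup>+z. ennreal (omega \<alpha> z) * indicator (S \<i>) z \<partial>lborel) \<le> ennreal (K * P)"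
        "(\<integral>\<^sup>+z. ennreal (omega \<alpha> z) * indicator (S (-\<i>)) z \<partial>lborel) \<le> ennreal (K * P)"
        by (intro Sb; simp)+
      have "emeasure lborel disk = ennreal pi" by (simp add: emeasure_ball unit_ball_vol_2)
      then have "(\<integral>\<^sup>+z. ennreal (L / pi * P) * indicator disk z \<partial>lborel) = ennreal (L / pi * P) * ennreal pi"
        by (subst nn_integral_cmult_indicator) auto
      also have "\<dots> = ennreal (L * P)" using L P by (simp flip: ennreal_mult)
      finally show "(\<integral>\<^sup>+z. ennreal (L / pi * P) * indicator disk z \<partial>lborel) \<le> ennreal (L * P)" by simp
    qed
    also have "\<dots> = ennreal ((4 * K + L) * P)"
      using K L P by (simp add: algebra_simps flip: ennreal_plus)
    finally have "emeasure (weighted_area \<alpha>) A \<le> ennreal (1 / pi) * ennreal ((4 * K + L) * P)"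
      by (simp add: mult_left_mono)
    also have "\<dots> = ennreal (1 / pi * (4 * K + L) * P)"
      using K L P by (simp flip: ennreal_mult)
    finally show "emeasure (weighted_area \<alpha>) {z \<in> disk \<inter> ball w s. 1 - cmod z < t}
        \<le> ennreal (1 / pi * (4 * K + L) * (s * t powr (\<alpha> + 1)))"
      by (simp add: A_def P_def)
  qed
qed

text \<open>The strip estimate with \<open>t = s\<close>: a point closer than \<open>s\<close> to
  the circle point \<open>w\<close> is closer than \<open>s\<close> to the circle.\<close>

lemma weighted_ball_le:
  assumes al: "\<alpha> > -1"
  obtains C :: real where "C > 0" "\<And>w s. cmod w = 1 \<Longrightarrow> 0 < s \<Longrightarrow>
    emeasure (weighted_area \<alpha>) (disk \<inter> ball w s) \<le> ennreal (C * s powr (\<alpha> + 2))"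
proof -
  obtain C where C: "C > 0" "\<And>w s t. 0 < t \<Longrightarrow> t \<le> s \<Longrightarrow>
    emeasure (weighted_area \<alpha>) {z \<in> disk \<inter> ball w s. 1 - cmod z < t} \<le> ennreal (C * (s * t powr (\<alpha> + 1)))"
    by (rule weighted_strip_le[OF al]) blast
  show thesis
  proof (rule that[OF C(1)])
    fix w :: complex and s :: real assume w: "cmod w = 1" and s: "0 < s"
    have "1 - cmod z < s" if "z \<in> ball w s" for z
      using that w norm_triangle_ineq2[of w z] by (simp add: dist_norm)
    then have "disk \<inter> ball w s = {z \<in> disk \<inter> ball w s. 1 - cmod z < s}" by auto
    moreover have "s powr (\<alpha> + 2) = s * s powr (\<alpha> + 1)" using s powr_add[of s 1 "\<alpha> + 1"] by (simp add: add.commute)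
    ultimately show "emeasure (weighted_area \<alpha>) (disk \<inter> ball w s) \<le> ennreal (C * s powr (\<alpha> + 2))"
      using C(2)[OF s order_refl, of w] by simp
  qed
qed

lemma weighted_area_finite: "\<alpha> > -1 \<Longrightarrow> finite_measure (weighted_area \<alpha>)"
proof
  assume al: "\<alpha> > -1"
  obtain C where C: "C > 0" "\<And>w s. cmod w = 1 \<Longrightarrow> 0 < s \<Longrightarrow>
    emeasure (weighted_area \<alpha>) (disk \<inter> ball w s) \<le> ennreal (C * s powr (\<alpha> + 2))"
    by (rule weighted_ball_le[OF al]) blast
  have "disk \<inter> ball 1 2 = disk"
  proof -
    have "dist 1 z < 2" if "z \<in> disk" for z
      using that norm_triangle_ineq4[of 1 z] by (simp add: dist_norm)
    then show ?thesis by auto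
  qed
  then have "emeasure (weighted_area \<alpha>) disk \<le> ennreal (C * 2 powr (\<alpha> + 2))" using C(2)[of 1 2] by simp
  then show "emeasure (weighted_area \<alpha>) (space (weighted_area \<alpha>)) \<noteq> \<infinity>" by (auto simp: top_unique)
qed

subsection \<open>Reproducing kernels and the Berezin transform\<close>

definition kernel_sq :: "real \<Rightarrow> complex \<Rightarrow> complex \<Rightarrow> real" where
  "kernel_sq \<alpha> z w = cmod (1 - cnj z * w) powr (- (2 * (2 + \<alpha>)))"

lemma bergman_kernel_sq: "(cmod (bergman_kernel \<alpha> z w))\<^sup>2 = kernel_sq \<alpha> z w"
proof -
  have "cmod (bergman_kernel \<alpha> z w) = cmod (1 - cnj z * w) powr (- (2 + \<alpha>))"
    unfolding bergman_kernel_def by (subst norm_powr_real_powr') simp_all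
  then show ?thesis by (simp add: kernel_sq_def power2_eq_square flip: powr_add)
qed

lemma kernel_sq_nonneg: "0 \<le> kernel_sq \<alpha> z w"
  by (simp add: kernel_sq_def)

lemma kernel_sq_measurable [measurable]: "kernel_sq \<alpha> z \<in> borel_measurable area"
  by (rule borel_measurable_area) (unfold kernel_sq_def, measurable)

lemma kernel_base_ge:
  assumes "z \<in> disk" "w \<in> disk"
  shows "1 - cmod z \<le> cmod (1 - cnj z * w)"
proof -
  have "cmod (cnj z * w) \<le> cmod z" using assms by (simp add: norm_mult mult_left_le)
  then show ?thesis using norm_triangle_ineq2[of 1 "cnj z * w"] by simp
qed

lemma kernel_sq_le_of_base_ge:
  assumes "\<alpha> > -1" "0 < b" "b \<le> cmod (1 - cnj z * w)"
  shows "kernel_sq \<alpha> z w \<le> b powr (- (2 * (2 + \<alpha>)))"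
  unfolding kernel_sq_def using assms by (intro powr_mono2') auto

lemma kernel_sq_integrable:
  assumes al: "\<alpha> > -1" and z: "z \<in> disk"
  shows "integrable (weighted_area \<alpha>) (kernel_sq \<alpha> z)"
proof -
  interpret finite_measure "weighted_area \<alpha>" by (rule weighted_area_finite[OF al])
  show ?thesis
  proof (rule integrable_const_bound)
    show "AE w in weighted_area \<alpha>. norm (kernel_sq \<alpha> z w) \<le> (1 - cmod z) powr (- (2 * (2 + \<alpha>)))"
    proof (rule AE_I2)
      fix w assume "w \<in> space (weighted_area \<alpha>)"
      then have w: "w \<in> disk" by simp
      then show "norm (kernel_sq \<alpha> z w) \<le> (1 - cmod z) powr (- (2 * (2 + \<alpha>)))"
        using kernel_sq_le_of_base_ge[OF al _ kernel_base_ge[OF z w]] z kernel_sq_nonneg by simp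
    qed
    show "kernel_sq \<alpha> z \<in> borel_measurable (weighted_area \<alpha>)"
      unfolding measurable_weighted_area by measurable
  qed
qed

text \<open>Elements of \<open>bergman\<close> vanish off the disk, hence the truncation. On the
  disk the base has positive real part and so avoids the branch cut.\<close>

lemma kernel_in_bergman:
  assumes al: "\<alpha> > -1" and z: "z \<in> disk"
  shows "(\<lambda>w. if w \<in> disk then bergman_kernel \<alpha> z w else 0) \<in> bergman \<alpha>"
proof -
  let ?k = "\<lambda>w. if w \<in> disk then bergman_kernel \<alpha> z w else 0"
  have "bergman_kernel \<alpha> z holomorphic_on disk"
    unfolding bergman_kernel_def
  proof (intro holomorphic_intros)
    fix w assume w: "w \<in> disk"
    have "cmod (cnj z * w) \<le> cmod z" using w by (simp add: norm_mult mult_left_le)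
    then have "cmod (cnj z * w) < 1" using z by simp
    then have "Re (1 - cnj z * w) > 0" using complex_Re_le_cmod[of "cnj z * w"] by simp
    then show "1 - cnj z * w \<notin> \<real>\<^sub>\<le>\<^sub>0" by (auto simp: complex_nonpos_Reals_iff)
  qed
  then have hol: "?k holomorphic_on disk" by (rule holomorphic_transform) simp
  have "integrable (weighted_area \<alpha>) (\<lambda>w. (cmod (?k w))\<^sup>2)"
    using kernel_sq_integrable[OF al z]
    by (rule Bochner_Integration.integrable_cong[THEN iffD1, rotated 2]) (simp_all add: bergman_kernel_sq)
  then show ?thesis
    using hol holomorphic_measurable_area[OF hol] by (simp add: bergman_def L2_def measurable_weighted_area)
qed

text \<open>Only the disk of radius \<open>d / 2\<close> about \<open>z\<close> is used, where d = 1
  - |z|. There the weight is at least of order d^\<alpha>, the base of the kernel is at most 3 d,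
  and the area is d^2 / 4; the exponents add up to \<alpha> - 2 (2 + \<alpha>) + 2 = - (2 +
  \<alpha>).\<close>

lemma kernel_sqnorm_ge:
  assumes al: "\<alpha> > -1"
  obtains c :: real where "c > 0" "\<And>z. z \<in> disk \<Longrightarrow>
    ennreal (c * (1 - cmod z) powr (- (2 + \<alpha>))) \<le> (\<integral>\<^sup>+w. ennreal (kernel_sq \<alpha> z w) \<partial>weighted_area \<alpha>)"
proof -
  \<comment> \<open>\<open>K\<close> compares the weights at \<open>z\<close> and at points of the
    disk about it, and \<open>L\<close> bounds \<open>(1 + cmod z) powr (- \<alpha>)\<close>.
    Together they make \<open>c0 * d powr \<alpha>\<close> a lower bound for the weight on that
    disk.\<close>
  define K where "K = (1 / 2 / 2) powr \<alpha> + (2 * 2) powr \<alpha>"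
  define L where "L = 1 + 2 powr (- \<alpha>)"
  define c0 where "c0 = (1 + \<alpha>) / (K * L)"
  have K: "0 < K" unfolding K_def by (intro add_pos_pos) auto
  have L: "0 < L" unfolding L_def by (intro add_pos_nonneg) auto
  have c0: "0 < c0" unfolding c0_def using al K L by simp
  define c where "c = c0 * 3 powr (- (2 * (2 + \<alpha>))) / 4"
  have c: "0 < c" using c0 by (simp add: c_def)
  show thesis
  proof (rule that[OF c])
    fix z assume z: "z \<in> disk"
    define d where "d = 1 - cmod z"
    have d: "0 < d" using z by (simp add: d_def)
    have sub: "ball z (d / 2) \<subseteq> disk"
      using scaled_ball_subset_disk[OF z, of "1 / 2"] by (simp add: d_def)
    define B where "B = ball z (d / 2)"
    have B [measurable]: "B \<in> sets area" unfolding B_def by (intro borel_sets_area sub) auto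
    define v where "v = c0 * d powr \<alpha> * (3 * d) powr (- (2 * (2 + \<alpha>)))"
    have v: "0 \<le> v" using c0 by (simp add: v_def)
    have pt: "ennreal v * indicator B w \<le> ennreal (omega \<alpha> w) * ennreal (kernel_sq \<alpha> z w)" for w
    proof (cases "w \<in> B")
      case True
      then have zw: "cmod (z - w) < d / 2" by (simp add: B_def dist_norm)
      have w: "w \<in> disk" using True sub by (auto simp: B_def)
      have "cmod w - cmod z \<le> cmod (z - w)" "cmod z - cmod w \<le> cmod (z - w)"
        using norm_triangle_ineq2[of w z] norm_triangle_ineq2[of z w] by (simp_all add: norm_minus_commute)
      then have "1 / 2 * (1 - cmod w) \<le> 1 - cmod z" "1 - cmod z \<le> 2 * (1 - cmod w)"
        using zw by (auto simp: d_def)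
      then have o1: "omega \<alpha> z \<le> K * omega \<alpha> w"
        using omega_le_of_comparable[OF al z w, of "1 / 2" 2] by (simp add: K_def)
      have "(1 + cmod z) powr (- \<alpha>) \<le> 1 powr (- \<alpha>) + 2 powr (- \<alpha>)"
        using z by (intro powr_le_powr_add_powr) auto
      then have "(1 + cmod z) powr \<alpha> * (1 + cmod z) powr (- \<alpha>) \<le> (1 + cmod z) powr \<alpha> * L"
        by (intro mult_left_mono) (simp_all add: L_def)
      moreover have "(1 + cmod z) powr \<alpha> * (1 + cmod z) powr (- \<alpha>) = 1"
        using norm_ge_zero[of z] by (simp flip: powr_add) (use norm_ge_zero[of z] in linarith)
      ultimately have "1 / L \<le> (1 + cmod z) powr \<alpha>" using L by (simp add: field_simps)
      then have "(1 + \<alpha>) * d powr \<alpha> * (1 / L) \<le> (1 + \<alpha>) * d powr \<alpha> * (1 + cmod z) powr \<alpha>"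
        using al by (intro mult_left_mono) auto
      also have "\<dots> = omega \<alpha> z"
      proof -
        have "1 - (cmod z)\<^sup>2 = d * (1 + cmod z)" by (simp add: d_def power2_eq_square algebra_simps)
        then show ?thesis using d by (simp add: omega_def powr_mult mult.assoc)
      qed
      finally have "(1 + \<alpha>) * d powr \<alpha> * (1 / L) \<le> K * omega \<alpha> w" using o1 by simp
      then have o2: "c0 * d powr \<alpha> \<le> omega \<alpha> w" using K L by (simp add: c0_def field_simps)
      have "1 - cnj z * w = of_real (1 - (cmod z)\<^sup>2) + cnj z * (z - w)"
        by (simp add: algebra_simps complex_norm_square[of z, simplified] mult.commute)
      then have "cmod (1 - cnj z * w) \<le> \<bar>1 - (cmod z)\<^sup>2\<bar> + cmod z * cmod (z - w)"
        using norm_triangle_ineq[of "of_real (1 - (cmod z)\<^sup>2)" "cnj z * (z - w)"]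
        by (simp only: norm_of_real norm_mult complex_mod_cnj)
      also have "\<dots> \<le> 2 * d + d / 2"
      proof (rule add_mono)
        have "1 - (cmod z)\<^sup>2 = d * (1 + cmod z)" by (simp add: d_def power2_eq_square algebra_simps)
        also have "\<dots> \<le> d * 2" using d z by (intro mult_left_mono) auto
        finally show "\<bar>1 - (cmod z)\<^sup>2\<bar> \<le> 2 * d" using disk_square_less[of z] z by simp
        have "cmod z * cmod (z - w) \<le> 1 * cmod (z - w)" using z by (intro mult_right_mono) auto
        then show "cmod z * cmod (z - w) \<le> d / 2" using zw by simp
      qed
      also have "\<dots> \<le> 3 * d" using d by simp
      finally have "cmod (1 - cnj z * w) \<le> 3 * d" .
      moreover have "0 < cmod (1 - cnj z * w)"
        using d kernel_base_ge[OF z w] unfolding d_def by (rule less_le_trans)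
      ultimately have "(3 * d) powr (- (2 * (2 + \<alpha>))) \<le> kernel_sq \<alpha> z w"
        unfolding kernel_sq_def using al by (intro powr_mono2') auto
      then have "v \<le> omega \<alpha> w * kernel_sq \<alpha> z w"
        unfolding v_def using o2 omega_nonneg[OF al, of w] by (intro mult_mono) auto
      then show ?thesis
        using True omega_nonneg[OF al, of w] kernel_sq_nonneg by (simp add: ennreal_leI flip: ennreal_mult)
    qed simp
    have "c * (1 - cmod z) powr (- (2 + \<alpha>)) = v * (d / 2)\<^sup>2"
    proof -
      have "d powr \<alpha> * d powr (- (2 * (2 + \<alpha>))) * d\<^sup>2 = d powr (- (2 + \<alpha>))"
        using d by (simp add: powr_numeral[symmetric] powr_add[symmetric] del: powr_numeral)
      then show ?thesis using d by (simp add: v_def c_def powr_mult power_divide d_def[symmetric] mult_ac)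
    qed
    then have "ennreal (c * (1 - cmod z) powr (- (2 + \<alpha>))) = ennreal v * emeasure area B"
      using v d sub by (simp add: B_def emeasure_area_ball ennreal_mult)
    also have "\<dots> = (\<integral>\<^sup>+w. ennreal v * indicator B w \<partial>area)" using B by (simp add: nn_integral_cmult_indicator)
    also have "\<dots> \<le> (\<integral>\<^sup>+w. ennreal (omega \<alpha> w) * ennreal (kernel_sq \<alpha> z w) \<partial>area)"
      by (intro nn_integral_mono pt)
    also have "\<dots> = (\<integral>\<^sup>+w. ennreal (kernel_sq \<alpha> z w) \<partial>weighted_area \<alpha>)"
      by (rule nn_integral_weighted_area[symmetric]) measurable
    finally show "ennreal (c * (1 - cmod z) powr (- (2 + \<alpha>))) \<le> (\<integral>\<^sup>+w. ennreal (kernel_sq \<alpha> z w) \<partial>weighted_area \<alpha>)" .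
  qed
qed

text \<open>Dyadic shells about \<open>w\<close>. For |w| = 1 one has |1 - cnj w u| = |w - u|, and
  moving \<open>w\<close> to \<open>z\<close> changes the base by at most s/2; so on the shell of
  radius \<open>R j\<close> the base is at least \<open>R j / 2\<close>. The kernel is then of order
  \<open>R j powr (- (2 * \<beta>))\<close> on a set of mass of order
  \<open>R j powr \<beta>\<close>, and the sum is geometric.\<close>

lemma kernel_tail_le:
  assumes al: "\<alpha> > -1"
  obtains C :: real where "C > 0" "\<And>w s z. cmod w = 1 \<Longrightarrow> 0 < s \<Longrightarrow> z \<in> disk \<Longrightarrow> dist w z \<le> s / 2 \<Longrightarrow>
    (\<integral>\<^sup>+u. ennreal (kernel_sq \<alpha> z u) * indicator (- ball w s) u \<partial>weighted_area \<alpha>)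
      \<le> ennreal (C * s powr (- (2 + \<alpha>)))"
proof -
  define \<beta> where "\<beta> = 2 + \<alpha>"
  have b: "1 < \<beta>" using al by (simp add: \<beta>_def)
  obtain C where C: "C > 0" "\<And>w s. cmod w = 1 \<Longrightarrow> 0 < s \<Longrightarrow>
    emeasure (weighted_area \<alpha>) (disk \<inter> ball w s) \<le> ennreal (C * s powr (\<alpha> + 2))"
    by (rule weighted_ball_le[OF al]) blast
  \<comment> \<open>The ratio of the series: doubling the radius divides the kernel bound by
    \<open>2 powr (2 * \<beta>)\<close> and multiplies the mass bound by
    \<open>2 powr \<beta>\<close>. In \<open>D\<close>, the factor \<open>8 powr \<beta>\<close>
    collects the halved base and the outer radius \<open>R (Suc j)\<close>.\<close>
  define p where "p = (2::real) powr (- \<beta>)"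
  have p: "0 < p" "p < 1" unfolding p_def using b by (auto simp: powr_less_one)
  define D where "D = C * 8 powr \<beta>"
  have D: "0 < D" using C by (simp add: D_def)
  show thesis
  proof
    show "D / (1 - p) > 0" using D p by simp
    fix w z :: complex and s :: real
    assume w: "cmod w = 1" and s: "0 < s" and z: "z \<in> disk" and wz: "dist w z \<le> s / 2"
    define R where "R j = 2 ^ j * s" for j :: nat
    have R: "0 < R j" "s \<le> R j" for j
    proof -
      have "1 * s \<le> 2 ^ j * s" using s by (intro mult_right_mono) auto
      then show "0 < R j" "s \<le> R j" using s by (auto simp: R_def)
    qed
    define q where "q j = (R j / 2) powr (- (2 * \<beta>))" for j
    have pt: "ennreal (kernel_sq \<alpha> z u) * indicator (- ball w s) u
        \<le> (\<Sum>j. ennreal (q j) * indicator (disk \<inter> ball w (R (Suc j))) u)" if u: "u \<in> disk" for u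
    proof (cases "dist w u < s")
      case False
      have "\<exists>j. dist w u < R (Suc j)"
      proof -
        obtain j where "dist w u / s < 2 ^ j" using real_arch_pow[of 2 "dist w u / s"] by auto
        then have "dist w u < R j" using s by (simp add: R_def field_simps)
        also have "\<dots> \<le> R (Suc j)" using s by (simp add: R_def)
        finally show ?thesis by blast
      qed
      \<comment> \<open>Minimality gives \<open>R j \<le> dist w u\<close>; for \<open>j = 0\<close>
        this is the assumption that \<open>u\<close> lies outside \<open>ball w s\<close>.\<close>
      define j where "j = (LEAST j. dist w u < R (Suc j))"
      have j1: "dist w u < R (Suc j)" unfolding j_def by (rule LeastI_ex) fact
      have j2: "R j \<le> dist w u"
      proof (cases j)
        case 0
        then show ?thesis using False by (simp add: R_def)
      next
        case (Suc k)
        then have "\<not> dist w u < R (Suc k)" unfolding j_def by (intro not_less_Least) simp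
        then show ?thesis using Suc by simp
      qed
      have "R j / 2 \<le> cmod (1 - cnj z * u)"
      proof -
        have ww: "cnj w * w = 1" using complex_norm_square[of w] w by (simp add: mult.commute)
        have "1 - cnj w * u = cnj w * (w - u)" by (simp add: right_diff_distrib ww)
        then have "cmod (1 - cnj w * u) = dist w u" using w by (simp add: norm_mult dist_norm)
        moreover have "cmod ((cnj w - cnj z) * u) \<le> s / 2"
        proof -
          have "cmod (cnj w - cnj z) = dist w z" by (simp add: dist_norm flip: complex_cnj_diff)
          then have "cmod ((cnj w - cnj z) * u) \<le> dist w z" using u by (simp add: norm_mult mult_left_le)
          then show ?thesis using wz by simp
        qed
        moreover have "1 - cnj w * u = (1 - cnj z * u) - (cnj w - cnj z) * u" by (simp add: algebra_simps)
        then have "cmod (1 - cnj w * u) \<le> cmod (1 - cnj z * u) + cmod ((cnj w - cnj z) * u)"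
          by (metis norm_triangle_ineq4)
        ultimately show ?thesis using j2 R(2)[of j] by simp
      qed
      then have "kernel_sq \<alpha> z u \<le> q j"
        unfolding q_def \<beta>_def by (intro kernel_sq_le_of_base_ge al) (use R(1)[of j] in auto)
      then have "ennreal (kernel_sq \<alpha> z u) * indicator (- ball w s) u
          \<le> (\<Sum>i\<in>{j}. ennreal (q i) * indicator (disk \<inter> ball w (R (Suc i))) u)"
        using j1 u False by (simp add: ennreal_leI)
      also have "\<dots> \<le> (\<Sum>i. ennreal (q i) * indicator (disk \<inter> ball w (R (Suc i))) u)"
        by (rule sum_le_suminf) auto
      finally show ?thesis .
    qed simp
    have [measurable]: "disk \<inter> ball w r \<in> sets area" for r by (intro borel_sets_area) auto
    have "(\<integral>\<^sup>+u. ennreal (kernel_sq \<alpha> z u) * indicator (- ball w s) u \<partial>weighted_area \<alpha>)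
        \<le> (\<integral>\<^sup>+u. (\<Sum>j. ennreal (q j) * indicator (disk \<inter> ball w (R (Suc j))) u) \<partial>weighted_area \<alpha>)"
      using pt by (intro nn_integral_mono) simp
    also have "\<dots> = (\<Sum>j. \<integral>\<^sup>+u. ennreal (q j) * indicator (disk \<inter> ball w (R (Suc j))) u \<partial>weighted_area \<alpha>)"
      by (rule nn_integral_suminf) (unfold measurable_weighted_area, measurable)
    also have "\<dots> = (\<Sum>j. ennreal (q j) * emeasure (weighted_area \<alpha>) (disk \<inter> ball w (R (Suc j))))"
      by (intro suminf_cong nn_integral_cmult_indicator) (simp add: sets_weighted_area flip: sets_area)
    also have "\<dots> \<le> (\<Sum>j. ennreal (D * s powr (- \<beta>) * p ^ j))"
    proof (intro suminf_le allI)
      fix j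
      have "ennreal (q j) * emeasure (weighted_area \<alpha>) (disk \<inter> ball w (R (Suc j)))
          \<le> ennreal (q j) * ennreal (C * R (Suc j) powr (\<alpha> + 2))"
        by (intro mult_left_mono C(2) w R) simp
      also have "\<dots> = ennreal (q j * (C * R (Suc j) powr (\<alpha> + 2)))"
        using C(1) by (simp add: q_def flip: ennreal_mult)
      also have "q j * (C * R (Suc j) powr (\<alpha> + 2)) = D * s powr (- \<beta>) * p ^ j"
      proof -
        have r: "R j powr (- (2 * \<beta>)) * R j powr \<beta> = R j powr (- \<beta>)" by (simp flip: powr_add)
        have "(1 / 2) powr (- (2 * \<beta>)) * 2 powr \<beta> = (8::real) powr \<beta>"
        proof -
          have "(8::real) powr \<beta> = (2 powr 3) powr \<beta>" by simp
          also have "\<dots> = 2 powr (2 * \<beta>) * 2 powr \<beta>" by (simp only: powr_powr flip: powr_add) simp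
          also have "2 powr (2 * \<beta>) = (1 / 2 :: real) powr (- (2 * \<beta>))" by (simp add: powr_minus_divide powr_divide)
          finally show ?thesis by simp
        qed
        moreover have "q j = (1 / 2) powr (- (2 * \<beta>)) * R j powr (- (2 * \<beta>))"
          using R(1)[of j] powr_mult[of "1 / 2" "R j" "- (2 * \<beta>)"] by (simp add: q_def)
        moreover have "R (Suc j) powr (\<alpha> + 2) = 2 powr \<beta> * R j powr \<beta>"
          using R(1)[of j] powr_mult[of 2 "R j" \<beta>] by (simp add: R_def \<beta>_def add.commute mult.assoc)
        moreover have "R j powr (- \<beta>) = s powr (- \<beta>) * p ^ j"
          using s by (simp add: R_def powr_mult p_def powr_power powr_powr mult.commute flip: powr_realpow)
        ultimately show ?thesis using r by (simp add: D_def mult_ac)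
      qed
      finally show "ennreal (q j) * emeasure (weighted_area \<alpha>) (disk \<inter> ball w (R (Suc j)))
          \<le> ennreal (D * s powr (- \<beta>) * p ^ j)" .
    qed auto
    also have "\<dots> = ennreal (\<Sum>j. D * s powr (- \<beta>) * p ^ j)"
      using D p by (intro suminf_ennreal2 summable_mult summable_geometric) auto
    also have "(\<Sum>j. D * s powr (- \<beta>) * p ^ j) = D / (1 - p) * s powr (- (2 + \<alpha>))"
      using p by (subst suminf_mult) (auto simp: suminf_geometric \<beta>_def)
    finally show "(\<integral>\<^sup>+u. ennreal (kernel_sq \<alpha> z u) * indicator (- ball w s) u \<partial>weighted_area \<alpha>)
      \<le> ennreal (D / (1 - p) * s powr (- (2 + \<alpha>)))" .
  qed
qed

text \<open>Turns a bound that holds only almost everywhere into one at an actual point near a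
  prescribed place: a ball has positive area and is not contained in a null set.\<close>

lemma AE_area_imp_ex_in_ball:
  assumes ae: "AE z in area. P z" and r: "0 < r" and sub: "ball c r \<subseteq> disk"
  shows "\<exists>z\<in>ball c r. P z"
proof (rule ccontr)
  assume n: "\<not> (\<exists>z\<in>ball c r. P z)"
  obtain N where N: "{z \<in> space area. \<not> P z} \<subseteq> N" "emeasure area N = 0" "N \<in> sets area"
    using AE_E[OF ae] by blast
  have "ball c r \<subseteq> N" using n sub N(1) unfolding space_area by blast
  then have "emeasure area (ball c r) \<le> 0" using emeasure_mono[OF _ N(3)] N(2) by metis
  then show False using r emeasure_area_ball(2)[OF _ sub] by simp
qed

text \<open>With \<beta> = 2 + \<alpha>, the kernel mass at \<open>z\<close> is at least
  \<open>Q0 * s powr (- \<beta>)\<close>, and \<open>G\<close> carries the proportion \<kappa> of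
  it. The constants make the tail outside \<open>ball w s\<close> and the strip take at most a
  quarter of this share each. The remaining half sits where kernel and weight are bounded, so it is
  at most a constant times \<open>s powr (\<alpha> - 2 * \<beta>)\<close> times the area
  sought.\<close>

lemma boundary_ball_area_of_kernel:
  assumes al: "\<alpha> > -1" and G [measurable]: "G \<in> sets area" and k: "0 < \<kappa>"
    and ae: "AE z in area. ennreal \<kappa> * (\<integral>\<^sup>+u. ennreal (kernel_sq \<alpha> z u) \<partial>weighted_area \<alpha>)
      \<le> (\<integral>\<^sup>+u\<in>G. ennreal (kernel_sq \<alpha> z u) \<partial>weighted_area \<alpha>)"
  obtains \<delta> :: real where "\<delta> > 0" "\<And>w s. cmod w = 1 \<Longrightarrow> 0 < s \<Longrightarrow> s \<le> 2 \<Longrightarrow> \<delta> * s\<^sup>2 \<le> measure area (G \<inter> ball w s)"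
proof -
  define \<beta> where "\<beta> = 2 + \<alpha>"
  have b: "1 < \<beta>" using al by (simp add: \<beta>_def)
  obtain c where c: "c > 0" "\<And>z. z \<in> disk \<Longrightarrow>
    ennreal (c * (1 - cmod z) powr (- (2 + \<alpha>))) \<le> (\<integral>\<^sup>+w. ennreal (kernel_sq \<alpha> z w) \<partial>weighted_area \<alpha>)"
    by (rule kernel_sqnorm_ge[OF al]) blast
  obtain C3 where C3: "C3 > 0" "\<And>w s z. cmod w = 1 \<Longrightarrow> 0 < s \<Longrightarrow> z \<in> disk \<Longrightarrow> dist w z \<le> s / 2 \<Longrightarrow>
    (\<integral>\<^sup>+u. ennreal (kernel_sq \<alpha> z u) * indicator (- ball w s) u \<partial>weighted_area \<alpha>)
      \<le> ennreal (C3 * s powr (- (2 + \<alpha>)))"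
    by (rule kernel_tail_le[OF al]) blast
  obtain C where C: "C > 0" "\<And>w s t. 0 < t \<Longrightarrow> t \<le> s \<Longrightarrow>
    emeasure (weighted_area \<alpha>) {z \<in> disk \<inter> ball w s. 1 - cmod z < t} \<le> ennreal (C * (s * t powr (\<alpha> + 1)))"
    by (rule weighted_strip_le[OF al]) blast
  \<comment> \<open>The second entry of the maximum yields
    \<open>C3 \<le> \<kappa> / 4 * Q0\<close>, using \<beta> > 1. The bound \<open>3 \<le> N\<close>
    keeps \<open>z\<close> within \<open>s / 2\<close> of \<open>w\<close>, as the tail estimate
    requires, and the disk of test points inside the unit disk.\<close>
  define N where "N = max 3 (6 * C3 / (\<kappa> * c))"
  have N: "3 \<le> N" "6 * C3 / (\<kappa> * c) \<le> N" by (auto simp: N_def)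
  \<comment> \<open>\<open>Q0\<close> belongs to \<open>1 - cmod z < 3 * q / 2\<close> and gives the
    lower bound for the mass; \<open>E\<close> belongs to \<open>1 - cmod z > q / 2\<close> and
    gives the maximum of the kernel, where \<open>q = s / N\<close>.\<close>
  define Q0 where "Q0 = c * (2 * N / 3) powr \<beta>"
  define E where "E = (2 * N) powr (2 * \<beta>)"
  \<comment> \<open>The strip has width \<open>h * s\<close>. The second entry solves
    \<open>E * C * h powr (\<alpha> + 1) = \<kappa> / 4 * Q0\<close>, and the minimum with 1 keeps
    the width below \<open>s\<close>.\<close>
  define h where "h = min 1 ((\<kappa> * Q0 / (4 * C * E)) powr (1 / (\<alpha> + 1)))"
  \<comment> \<open>Off the strip but inside \<open>ball w s\<close>, the base of the weight lies
    between \<open>h * s\<close> and \<open>2 * s\<close>.\<close>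
  define W where "W = (1 + \<alpha>) * (h powr \<alpha> + 2 powr \<alpha>)"
  have Q0: "0 < Q0" using c N by (simp add: Q0_def)
  have E: "0 < E" using N by (simp add: E_def)
  have h: "0 < h" "h \<le> 1" using k Q0 C E by (auto simp: h_def)
  have W: "0 < W" unfolding W_def using al h by (intro mult_pos_pos) (auto intro: add_pos_pos)
  have tailc: "C3 \<le> \<kappa> / 4 * Q0"
  proof -
    have "2 * N / 3 \<le> (2 * N / 3) powr \<beta>"
      using powr_mono[of 1 \<beta> "2 * N / 3"] b N by simp
    then have "c * (2 * N / 3) \<le> Q0" unfolding Q0_def using c by (intro mult_left_mono) auto
    moreover have "C3 \<le> \<kappa> / 4 * (c * (2 * N / 3))"
      using N(2) k c by (simp add: field_simps)
    ultimately show ?thesis using k by (meson mult_left_mono less_imp_le order_trans divide_pos_pos zero_less_numeral)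
  qed
  have stripc: "E * C * h powr (\<alpha> + 1) \<le> \<kappa> / 4 * Q0"
  proof -
    have "h powr (\<alpha> + 1) \<le> ((\<kappa> * Q0 / (4 * C * E)) powr (1 / (\<alpha> + 1))) powr (\<alpha> + 1)"
      using h al by (intro powr_mono2) (auto simp: h_def)
    also have "\<dots> = \<kappa> * Q0 / (4 * C * E)" using al k Q0 C E by (simp add: powr_powr)
    finally have "E * C * h powr (\<alpha> + 1) \<le> E * C * (\<kappa> * Q0 / (4 * C * E))"
      using E C by (intro mult_left_mono) auto
    then show ?thesis using E C by simp
  qed
  define \<delta> where "\<delta> = \<kappa> * Q0 / (2 * E * W)"
  have d: "0 < \<delta>" using k Q0 E W by (simp add: \<delta>_def)
  show thesis
  proof (rule that[OF d])
    fix w :: complex and s :: real assume w: "cmod w = 1" and s: "0 < s" "s \<le> 2"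
    define q where "q = s / N"
    have q: "0 < q" "3 * q \<le> s" "q \<le> 2 / 3" using s N by (auto simp: q_def field_simps)
    define u0 where "u0 = w * of_real (1 - q)"
    have u0: "cmod u0 = 1 - q" "dist w u0 = q"
    proof -
      show "cmod u0 = 1 - q" using w q by (simp add: u0_def norm_mult del: of_real_diff)
      have "w - u0 = w * of_real q" by (simp add: u0_def algebra_simps)
      then show "dist w u0 = q" using w q by (simp add: dist_norm norm_mult)
    qed
    have near: "cmod z < 1 - q / 2" "1 - 3 * q / 2 < cmod z" "dist w z < 3 * q / 2" if "z \<in> ball u0 (q / 2)" for z
    proof -
      have z: "cmod (u0 - z) < q / 2" using that by (simp add: dist_norm)
      show "cmod z < 1 - q / 2" using z u0(1) norm_triangle_ineq2[of z u0] by (simp add: norm_minus_commute)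
      show "1 - 3 * q / 2 < cmod z" using z u0(1) norm_triangle_ineq2[of u0 z] by simp
      show "dist w z < 3 * q / 2" using dist_triangle[of w z u0] that u0(2) by simp
    qed
    have "ball u0 (q / 2) \<subseteq> disk" using near(1) q by force
    then obtain z where zb: "z \<in> ball u0 (q / 2)" and
      zk: "ennreal \<kappa> * (\<integral>\<^sup>+u. ennreal (kernel_sq \<alpha> z u) \<partial>weighted_area \<alpha>)
        \<le> (\<integral>\<^sup>+u\<in>G. ennreal (kernel_sq \<alpha> z u) \<partial>weighted_area \<alpha>)"
      using AE_area_imp_ex_in_ball[OF ae, of "q / 2" u0] q by auto
    note zn = near[OF zb]
    have z: "z \<in> disk" using zn(1) q by simp
    define kz where "kz u = ennreal (kernel_sq \<alpha> z u)" for u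
    have [measurable]: "kz \<in> borel_measurable area" unfolding kz_def by measurable
    define e where "e = E * s powr (- (2 * \<beta>))"
    have e: "0 < e" using E s by (simp add: e_def)
    have kmax: "kz u \<le> ennreal e" if u: "u \<in> disk" for u
    proof -
      have "q / 2 \<le> cmod (1 - cnj z * u)" using kernel_base_ge[OF z u] zn(1) by simp
      then have "kernel_sq \<alpha> z u \<le> (q / 2) powr (- (2 * (2 + \<alpha>)))"
        using q by (intro kernel_sq_le_of_base_ge al) auto
      also have "q / 2 = s / (2 * N)" by (simp add: q_def)
      also have "(s / (2 * N)) powr (- (2 * (2 + \<alpha>))) = e"
      proof -
        have "(s / (2 * N)) powr (- t) = (2 * N) powr t * s powr (- t)" for t
          using s N by (simp add: powr_divide powr_minus_divide)
        then show ?thesis by (simp only: e_def E_def \<beta>_def)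
      qed
      finally show ?thesis by (simp add: kz_def ennreal_leI)
    qed
    define A where "A = {u \<in> disk \<inter> ball w s. 1 - cmod u < h * s}"
    have A [measurable]: "A \<in> sets area" unfolding A_def by (rule strip_in_sets)
    have [measurable]: "disk \<inter> ball w s \<in> sets area" by (intro borel_sets_area) auto
    have "G \<inter> ball w s = G \<inter> (disk \<inter> ball w s)" using sets.sets_into_space[OF G] by auto
    then have GB [measurable]: "G \<inter> ball w s \<in> sets area" by simp
    define V where "V = e * (W * s powr \<alpha>)"
    have V: "0 < V" using e W s by (simp add: V_def)
    define \<mu> where "\<mu> = measure area (G \<inter> ball w s)"
    have om: "omega \<alpha> u \<le> W * s powr \<alpha>" if u: "u \<in> disk" "u \<in> ball w s" "u \<notin> A" for u
    proof -
      have lo: "h * s \<le> 1 - cmod u" using u by (auto simp: A_def)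
      have hi: "1 - cmod u \<le> s" using u(2) w norm_triangle_ineq2[of w u] by (simp add: dist_norm)
      have f: "1 - (cmod u)\<^sup>2 = (1 - cmod u) * (1 + cmod u)" by (simp add: power2_eq_square algebra_simps)
      have "(h * s) * 1 \<le> (1 - cmod u) * (1 + cmod u)" using lo u(1) h s by (intro mult_mono) auto
      moreover have "(1 - cmod u) * (1 + cmod u) \<le> s * 2" using hi u(1) s by (intro mult_mono) auto
      ultimately have "(1 - (cmod u)\<^sup>2) powr \<alpha> \<le> (h * s) powr \<alpha> + (2 * s) powr \<alpha>"
        unfolding f using h s by (intro powr_le_powr_add_powr) auto
      also have "\<dots> = (h powr \<alpha> + 2 powr \<alpha>) * s powr \<alpha>" using h s by (simp add: powr_mult algebra_simps)
      finally show ?thesis unfolding omega_def W_def mult.assoc using al by (intro mult_left_mono) auto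
    qed
    have pt: "kz u * indicator G u \<le> kz u * indicator (- ball w s) u + ennreal e * indicator A u
        + kz u * indicator (G \<inter> ball w s - A) u" for u
    proof (cases "u \<in> A")
      case True
      then have "u \<in> disk" by (auto simp: A_def)
      from kmax[OF this] True show ?thesis by (auto simp: indicator_def add_increasing add_increasing2)
    next
      case False
      then show ?thesis by (auto simp: indicator_def)
    qed
    have ball_meas [measurable]: "(\<lambda>u. indicator (- ball w s) u :: ennreal) \<in> borel_measurable area"
      by (intro borel_measurable_area borel_measurable_indicator) auto
    have rest: "(\<integral>\<^sup>+u. kz u * indicator (G \<inter> ball w s - A) u \<partial>weighted_area \<alpha>) \<le> ennreal (V * \<mu>)"
    proof -
      have "(\<integral>\<^sup>+u. kz u * indicator (G \<inter> ball w s - A) u \<partial>weighted_area \<alpha>)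
          = (\<integral>\<^sup>+u. ennreal (omega \<alpha> u) * (kz u * indicator (G \<inter> ball w s - A) u) \<partial>area)"
        by (rule nn_integral_weighted_area) measurable
      also have "\<dots> \<le> (\<integral>\<^sup>+u. ennreal V * indicator (G \<inter> ball w s) u \<partial>area)"
      proof (intro nn_integral_mono)
        fix u assume "u \<in> space area"
        then have u: "u \<in> disk" by simp
        show "ennreal (omega \<alpha> u) * (kz u * indicator (G \<inter> ball w s - A) u) \<le> ennreal V * indicator (G \<inter> ball w s) u"
        proof (cases "u \<in> G \<inter> ball w s - A")
          case True
          have "ennreal (omega \<alpha> u) * kz u \<le> ennreal (W * s powr \<alpha>) * ennreal e"
            using True om[OF u] kmax[OF u] by (intro mult_mono ennreal_leI) auto
          also have "\<dots> = ennreal V" using W e by (simp add: V_def mult.commute flip: ennreal_mult)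
          finally show ?thesis using True by simp
        qed (simp add: indicator_def)
      qed
      also have "\<dots> = ennreal V * emeasure area (G \<inter> ball w s)" by (rule nn_integral_cmult_indicator) measurable
      also have "\<dots> = ennreal (V * \<mu>)" using V by (simp add: area.emeasure_eq_measure \<mu>_def ennreal_mult)
      finally show ?thesis .
    qed
    have strip: "(\<integral>\<^sup>+u. ennreal e * indicator A u \<partial>weighted_area \<alpha>) \<le> ennreal (\<kappa> / 4 * Q0 * s powr (- \<beta>))"
    proof -
      have "(\<integral>\<^sup>+u. ennreal e * indicator A u \<partial>weighted_area \<alpha>) = ennreal e * emeasure (weighted_area \<alpha>) A"
        using A by (intro nn_integral_cmult_indicator) (simp add: sets_weighted_area sets_area)
      also have "\<dots> \<le> ennreal e * ennreal (C * (s * (h * s) powr (\<alpha> + 1)))"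
        unfolding A_def using h s by (intro mult_left_mono C(2)) auto
      also have "\<dots> = ennreal (e * (C * (s * (h * s) powr (\<alpha> + 1))))"
        using e C s by (simp flip: ennreal_mult)
      also have "e * (C * (s * (h * s) powr (\<alpha> + 1))) = (E * C * h powr (\<alpha> + 1)) * s powr (- \<beta>)"
      proof -
        have "s powr (- (2 * \<beta>)) * (s powr 1 * s powr (\<alpha> + 1)) = s powr (- \<beta>)"
          unfolding \<beta>_def powr_add[symmetric] by simp
        then have "s powr (- (2 * \<beta>)) * (s * s powr (\<alpha> + 1)) = s powr (- \<beta>)" using s by simp
        then show ?thesis using h s by (simp add: e_def powr_mult mult_ac)
      qed
      also have "\<dots> \<le> \<kappa> / 4 * Q0 * s powr (- \<beta>)" by (intro mult_right_mono stripc) simp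
      finally show ?thesis by (simp add: ennreal_leI)
    qed
    have tail: "(\<integral>\<^sup>+u. kz u * indicator (- ball w s) u \<partial>weighted_area \<alpha>) \<le> ennreal (\<kappa> / 4 * Q0 * s powr (- \<beta>))"
    proof -
      have "(\<integral>\<^sup>+u. kz u * indicator (- ball w s) u \<partial>weighted_area \<alpha>) \<le> ennreal (C3 * s powr (- \<beta>))"
        unfolding kz_def \<beta>_def using zn(3) q by (intro C3(2) w s z) auto
      also have "\<dots> \<le> ennreal (\<kappa> / 4 * Q0 * s powr (- \<beta>))"
        by (intro ennreal_leI mult_right_mono tailc) simp
      finally show ?thesis .
    qed
    have "Q0 * s powr (- \<beta>) \<le> c * (1 - cmod z) powr (- \<beta>)"
    proof -
      have "(3 * q / 2) powr (- \<beta>) \<le> (1 - cmod z) powr (- \<beta>)" using zn z b by (intro powr_mono2') auto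
      moreover have "(3 * q / 2) powr (- \<beta>) = (2 * N / 3) powr \<beta> * s powr (- \<beta>)"
      proof -
        have eq: "3 * q / 2 = s / (2 * N / 3)" using N by (simp add: q_def)
        have div: "(s / y) powr (- \<beta>) = y powr \<beta> * s powr (- \<beta>)" if "0 < y" for y
          using s that by (simp add: powr_divide powr_minus_divide)
        show ?thesis unfolding eq by (rule div) (use N in simp)
      qed
      ultimately show ?thesis using c by (simp add: Q0_def mult.assoc)
    qed
    then have "ennreal (\<kappa> * (Q0 * s powr (- \<beta>))) \<le> ennreal \<kappa> * ennreal (c * (1 - cmod z) powr (- \<beta>))"
      using k c by (simp add: ennreal_leI flip: ennreal_mult)
    also have "\<dots> \<le> ennreal \<kappa> * (\<integral>\<^sup>+u. kz u \<partial>weighted_area \<alpha>)"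
      unfolding kz_def \<beta>_def by (intro mult_left_mono c(2) z) simp
    also have "\<dots> \<le> (\<integral>\<^sup>+u. kz u * indicator G u \<partial>weighted_area \<alpha>)" using zk by (simp add: kz_def)
    also have "\<dots> \<le> (\<integral>\<^sup>+u. kz u * indicator (- ball w s) u + ennreal e * indicator A u
        + kz u * indicator (G \<inter> ball w s - A) u \<partial>weighted_area \<alpha>)"
      by (intro nn_integral_mono pt)
    also have "\<dots> = (\<integral>\<^sup>+u. kz u * indicator (- ball w s) u \<partial>weighted_area \<alpha>) + (\<integral>\<^sup>+u. ennreal e * indicator A u \<partial>weighted_area \<alpha>)
        + (\<integral>\<^sup>+u. kz u * indicator (G \<inter> ball w s - A) u \<partial>weighted_area \<alpha>)"
      by (subst nn_integral_add, (unfold measurable_weighted_area, measurable)[2],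
          subst nn_integral_add, (unfold measurable_weighted_area, measurable)[2], rule refl)
    also have "\<dots> \<le> ennreal (\<kappa> / 4 * Q0 * s powr (- \<beta>)) + ennreal (\<kappa> / 4 * Q0 * s powr (- \<beta>)) + ennreal (V * \<mu>)"
      by (intro add_mono tail strip rest)
    also have "\<dots> = ennreal (\<kappa> / 2 * (Q0 * s powr (- \<beta>)) + V * \<mu>)"
      using k Q0 V by (simp add: \<mu>_def field_simps flip: ennreal_plus)
    finally have "\<kappa> * (Q0 * s powr (- \<beta>)) \<le> \<kappa> / 2 * (Q0 * s powr (- \<beta>)) + V * \<mu>"
      by (subst (asm) ennreal_le_iff) (use k Q0 V in \<open>auto simp: \<mu>_def\<close>)
    then have "\<kappa> / 2 * (Q0 * s powr (- \<beta>)) \<le> V * \<mu>" by simp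
    \<comment> \<open>This factor cancels the power of \<open>s\<close> in \<open>V\<close> and
      leaves \<open>s powr (\<beta> - \<alpha>)\<close>, the square of \<open>s\<close>, on the
      left.\<close>
    then have "s powr (2 * \<beta> - \<alpha>) * (\<kappa> / 2 * (Q0 * s powr (- \<beta>))) \<le> s powr (2 * \<beta> - \<alpha>) * (V * \<mu>)"
      by (intro mult_left_mono) auto
    moreover have "s powr (2 * \<beta> - \<alpha>) * (\<kappa> / 2 * (Q0 * s powr (- \<beta>))) = \<kappa> / 2 * Q0 * s\<^sup>2"
    proof -
      have "s powr (2 * \<beta> - \<alpha>) * s powr (- \<beta>) = s powr 2" unfolding \<beta>_def powr_add[symmetric] by simp
      then show ?thesis using s by (simp add: mult_ac)
    qed
    moreover have "s powr (2 * \<beta> - \<alpha>) * (V * \<mu>) = E * W * \<mu>"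
    proof -
      have "s powr (2 * \<beta> - \<alpha>) * s powr (- (2 * \<beta>)) * s powr \<alpha> = 1" using s unfolding powr_add[symmetric] by simp
      then show ?thesis unfolding V_def e_def by (metis (no_types, lifting) mult.assoc mult.commute mult_1)
    qed
    ultimately have "\<kappa> / 2 * Q0 * s\<^sup>2 \<le> E * W * \<mu>" by (simp only:)
    then show "\<delta> * s\<^sup>2 \<le> measure area (G \<inter> ball w s)"
      using E W by (simp add: \<delta>_def \<mu>_def field_simps)
  qed
qed

section \<open>The Berezin transform of a bounded symbol\<close>

lemma kernel_sq_pair_measurable: "(\<lambda>p. kernel_sq \<alpha> (fst p) (snd p)) \<in> borel_measurable (area \<Otimes>\<^sub>M area)"
proof -
  have [measurable]: "cnj \<in> borel_measurable borel"
    by (intro borel_measurable_continuous_onI continuous_intros)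
  show ?thesis unfolding kernel_sq_def by measurable
qed

context bounded_symbol
begin

lemma phi_measurable [measurable]: "\<phi> \<in> borel_measurable area"
  using meas by (simp add: measurable_weighted_area)

lemma symbol_set_in_area: "{z \<in> disk. \<phi> z > r} \<in> sets area"
proof -
  have "{z \<in> space area. \<phi> z > r} \<in> sets area" by measurable
  then show ?thesis by simp
qed

abbreviation kernel_mass :: "complex \<Rightarrow> real" where
  "kernel_mass z \<equiv> (LINT w|weighted_area \<alpha>. kernel_sq \<alpha> z w)"

abbreviation kernel_energy :: "complex \<Rightarrow> real" where
  "kernel_energy z \<equiv> (LINT w|weighted_area \<alpha>. kernel_sq \<alpha> z w * \<phi> w)"

lemma berezin_eq: "berezin \<alpha> (\<lambda>z. complex_of_real (\<phi> z)) z = of_real (kernel_energy z / kernel_mass z)"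
proof -
  have "(L2_norm \<alpha> (bergman_kernel \<alpha> z))\<^sup>2 = kernel_mass z"
    unfolding L2_norm_def bergman_kernel_sq by (simp add: kernel_sq_nonneg)
  moreover have "(LINT w|weighted_area \<alpha>. complex_of_real (\<phi> w) * of_real ((cmod (bergman_kernel \<alpha> z w))\<^sup>2))
      = of_real (kernel_energy z)"
    unfolding bergman_kernel_sq of_real_mult[symmetric] integral_complex_of_real by (simp add: mult.commute)
  ultimately show ?thesis by (simp add: berezin_def)
qed

lemma berezin_measurable: "berezin \<alpha> (\<lambda>z. complex_of_real (\<phi> z)) \<in> borel_measurable (weighted_area \<alpha>)"
proof -
  interpret finite_measure "weighted_area \<alpha>" by (rule weighted_area_finite[OF alpha])
  have cong: "borel_measurable (weighted_area \<alpha> \<Otimes>\<^sub>M weighted_area \<alpha>) = borel_measurable (area \<Otimes>\<^sub>M area)"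
    by (intro measurable_cong_sets sets_pair_measure_cong) (simp_all add: sets_area sets_weighted_area)
  have k: "(\<lambda>p. kernel_sq \<alpha> (fst p) (snd p)) \<in> borel_measurable (weighted_area \<alpha> \<Otimes>\<^sub>M weighted_area \<alpha>)"
    unfolding cong by (rule kernel_sq_pair_measurable)
  have "(\<lambda>z. kernel_mass z) \<in> borel_measurable (weighted_area \<alpha>)"
    by (rule borel_measurable_lebesgue_integral) (use k in \<open>simp add: case_prod_unfold\<close>)
  moreover have "(\<lambda>z. kernel_energy z) \<in> borel_measurable (weighted_area \<alpha>)"
  proof (rule borel_measurable_lebesgue_integral)
    have "(\<lambda>p. \<phi> (snd p)) \<in> borel_measurable (weighted_area \<alpha> \<Otimes>\<^sub>M weighted_area \<alpha>)" by measurable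
    then show "(\<lambda>(z, w). kernel_sq \<alpha> z w * \<phi> w) \<in> borel_measurable (weighted_area \<alpha> \<Otimes>\<^sub>M weighted_area \<alpha>)"
      using borel_measurable_times[OF k] by (simp add: case_prod_unfold)
  qed
  ultimately have "(\<lambda>z. complex_of_real (kernel_energy z / kernel_mass z)) \<in> borel_measurable (weighted_area \<alpha>)"
    by measurable
  then show ?thesis by (simp add: berezin_eq[abs_def])
qed

lemma kernel_energy_integrable:
  assumes "z \<in> disk"
  shows "integrable (weighted_area \<alpha>) (\<lambda>w. kernel_sq \<alpha> z w * \<phi> w)"
proof -
  have le: "AE w in weighted_area \<alpha>. norm (kernel_sq \<alpha> z w * \<phi> w) \<le> norm (m * kernel_sq \<alpha> z w)"
    using nonneg bounded
  proof eventually_elim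
    case (elim w)
    then have "kernel_sq \<alpha> z w * \<phi> w \<le> kernel_sq \<alpha> z w * m"
      using kernel_sq_nonneg by (intro mult_left_mono) auto
    then show ?case using elim m_pos kernel_sq_nonneg[of \<alpha> z w] by (simp add: abs_mult mult.commute)
  qed
  have [measurable]: "kernel_sq \<alpha> z \<in> borel_measurable (weighted_area \<alpha>)"
    unfolding measurable_weighted_area by measurable
  show ?thesis
    by (rule Bochner_Integration.integrable_bound[OF _ _ le])
      (use kernel_sq_integrable[OF alpha assms] in \<open>simp_all, measurable\<close>)
qed

lemma kernel_energy_le:
  assumes z: "z \<in> disk"
  shows "kernel_energy z \<le> m * kernel_mass z" and "0 \<le> kernel_energy z"
proof -
  have "kernel_energy z \<le> (LINT w|weighted_area \<alpha>. m * kernel_sq \<alpha> z w)"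
  proof (rule integral_mono_AE)
    show "AE w in weighted_area \<alpha>. kernel_sq \<alpha> z w * \<phi> w \<le> m * kernel_sq \<alpha> z w"
      using bounded
      by eventually_elim (subst mult.commute, rule mult_right_mono, simp_all add: kernel_sq_nonneg)
  qed (use kernel_energy_integrable[OF z] kernel_sq_integrable[OF alpha z] in simp_all)
  then show "kernel_energy z \<le> m * kernel_mass z" by simp
  show "0 \<le> kernel_energy z"
    by (rule integral_nonneg_AE) (use nonneg in \<open>eventually_elim, simp add: kernel_sq_nonneg\<close>)
qed

lemma kernel_mass_pos:
  assumes z: "z \<in> disk"
  shows "0 < kernel_mass z" "(\<integral>\<^sup>+w. ennreal (kernel_sq \<alpha> z w) \<partial>weighted_area \<alpha>) = ennreal (kernel_mass z)"
proof -
  show eq: "(\<integral>\<^sup>+w. ennreal (kernel_sq \<alpha> z w) \<partial>weighted_area \<alpha>) = ennreal (kernel_mass z)"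
    by (rule nn_integral_eq_integral[OF kernel_sq_integrable[OF alpha z]]) (simp add: kernel_sq_nonneg)
  obtain c where c: "c > 0" "\<And>z. z \<in> disk \<Longrightarrow>
    ennreal (c * (1 - cmod z) powr (- (2 + \<alpha>))) \<le> (\<integral>\<^sup>+w. ennreal (kernel_sq \<alpha> z w) \<partial>weighted_area \<alpha>)"
    by (rule kernel_sqnorm_ge[OF alpha]) blast
  have p: "0 < c * (1 - cmod z) powr (- (2 + \<alpha>))" using c(1) z by (intro mult_pos_pos) auto
  have "ennreal (c * (1 - cmod z) powr (- (2 + \<alpha>))) \<le> ennreal (kernel_mass z)" using c(2)[OF z] by (simp only: eq)
  then have "c * (1 - cmod z) powr (- (2 + \<alpha>)) \<le> kernel_mass z"
    by (subst (asm) ennreal_le_iff) (auto intro!: Bochner_Integration.integral_nonneg kernel_sq_nonneg)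
  with p show "0 < kernel_mass z" by linarith
qed

lemma berezin_invertible_of_coercive:
  assumes C: "0 < C" and coercive: "\<And>f. f \<in> bergman \<alpha> \<Longrightarrow> C * sqnorm \<alpha> f \<le> energy f"
  shows "invertible_Linfty \<alpha> (berezin \<alpha> (\<lambda>z. complex_of_real (\<phi> z)))"
proof -
  let ?b = "berezin \<alpha> (\<lambda>z. complex_of_real (\<phi> z))"
  note [measurable] = berezin_measurable
  have lo: "C \<le> kernel_energy z / kernel_mass z" if z: "z \<in> disk" for z
  proof -
    let ?k = "\<lambda>w. if w \<in> disk then bergman_kernel \<alpha> z w else 0"
    have "sqnorm \<alpha> ?k = kernel_mass z" "energy ?k = kernel_energy z"
      unfolding energy_def by (intro Bochner_Integration.integral_cong; simp add: bergman_kernel_sq)+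
    then have "C * kernel_mass z \<le> kernel_energy z" using coercive[OF kernel_in_bergman[OF alpha z]] by simp
    then show ?thesis using kernel_mass_pos(1)[OF z] by (simp add: pos_le_divide_eq)
  qed
  have hi: "kernel_energy z / kernel_mass z \<le> m" if z: "z \<in> disk" for z
    using kernel_energy_le(1)[OF z] kernel_mass_pos(1)[OF z] by (simp add: pos_divide_le_eq)
  have "?b \<in> Linfty \<alpha>"
    unfolding Linfty_def
  proof (intro CollectI conjI exI)
    show "AE z in weighted_area \<alpha>. cmod (?b z) \<le> m"
      using lo hi C by (intro AE_I2) (fastforce simp: berezin_eq simp del: of_real_divide)
  qed (rule berezin_measurable)
  moreover have "(\<lambda>z. 1 / ?b z) \<in> Linfty \<alpha>"
    unfolding Linfty_def
  proof (intro CollectI conjI exI)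
    show "AE z in weighted_area \<alpha>. cmod (1 / ?b z) \<le> 1 / C"
    proof (rule AE_I2)
      fix z assume "z \<in> space (weighted_area \<alpha>)"
      then have "C \<le> kernel_energy z / kernel_mass z" using lo[of z] by simp
      also have "\<dots> \<le> \<bar>kernel_energy z / kernel_mass z\<bar>" by (rule abs_ge_self)
      finally have "C \<le> cmod (?b z)" by (simp only: berezin_eq norm_of_real)
      then show "cmod (1 / ?b z) \<le> 1 / C" using C by (simp add: norm_divide frac_le)
    qed
  qed measurable
  moreover have "AE z in weighted_area \<alpha>. ?b z * (1 / ?b z) = 1"
  proof (rule AE_I2)
    fix z assume "z \<in> space (weighted_area \<alpha>)"
    then have "?b z \<noteq> 0" using lo[of z] C unfolding berezin_eq of_real_eq_0_iff by auto
    then show "?b z * (1 / ?b z) = 1" by simp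
  qed
  ultimately show ?thesis
    unfolding invertible_Linfty_def by (intro conjI bexI[of _ "\<lambda>z. 1 / ?b z"])
qed

text \<open>If the Berezin transform is at least \<open>c\<close> at \<open>z\<close>, then \<phi>
  \<le> c/2 + m times the indicator of \<open>G\<close> shows that \<open>G\<close> carries at least
  the proportion \<open>c / (2 * m)\<close> of the kernel mass at \<open>z\<close>, the hypothesis
  of \<open>boundary_ball_area_of_kernel\<close>.\<close>

lemma boundary_balls_of_berezin:
  assumes inv: "invertible_Linfty \<alpha> (berezin \<alpha> (\<lambda>z. complex_of_real (\<phi> z)))"
  shows "\<exists>r>0. \<exists>\<delta>\<in>{0<..<1}. \<forall>w\<in>sphere 0 1. \<forall>\<rho>>0.
       measure area ({z \<in> disk. \<phi> z > r} \<inter> ball w \<rho>) \<ge> \<delta> * measure area (disk \<inter> ball w \<rho>)"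
proof -
  let ?b = "berezin \<alpha> (\<lambda>z. complex_of_real (\<phi> z))"
  obtain g K where g: "AE z in weighted_area \<alpha>. cmod (g z) \<le> K" "AE z in weighted_area \<alpha>. ?b z * g z = 1"
    using inv unfolding invertible_Linfty_def Linfty_def by blast
  define c where "c = 1 / max K 1"
  have c: "0 < c" by (simp add: c_def)
  define r where "r = c / 2"
  have r: "0 < r" using c by (simp add: r_def)
  define G where "G = {z \<in> disk. \<phi> z > r}"
  have G: "G \<in> sets area" unfolding G_def by (rule symbol_set_in_area)
  have Gw: "G \<in> sets (weighted_area \<alpha>)" using G by (simp add: sets_area sets_weighted_area)
  define \<kappa> where "\<kappa> = c / (2 * m)"
  have k: "0 < \<kappa>" using c m_pos by (simp add: \<kappa>_def)
  have key: "ennreal \<kappa> * (\<integral>\<^sup>+u. ennreal (kernel_sq \<alpha> z u) \<partial>weighted_area \<alpha>)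
      \<le> (\<integral>\<^sup>+u\<in>G. ennreal (kernel_sq \<alpha> z u) \<partial>weighted_area \<alpha>)"
    if z: "z \<in> disk" and lo: "c \<le> cmod (?b z)" for z
  proof -
    note kp = kernel_mass_pos[OF z]
    have "0 \<le> kernel_energy z / kernel_mass z" using kp kernel_energy_le(2)[OF z] by simp
    then have "c \<le> kernel_energy z / kernel_mass z" using lo unfolding berezin_eq norm_of_real by simp
    then have 1: "c * kernel_mass z \<le> kernel_energy z" using kp by (simp add: pos_le_divide_eq)
    have IG: "integrable (weighted_area \<alpha>) (\<lambda>w. indicator G w * kernel_sq \<alpha> z w)"
      using integrable_mult_indicator[OF Gw kernel_sq_integrable[OF alpha z]] by simp
    have "kernel_energy z \<le> (LINT w|weighted_area \<alpha>. r * kernel_sq \<alpha> z w + m * (indicator G w * kernel_sq \<alpha> z w))"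
    proof (rule integral_mono_AE)
      show "AE w in weighted_area \<alpha>. kernel_sq \<alpha> z w * \<phi> w \<le> r * kernel_sq \<alpha> z w + m * (indicator G w * kernel_sq \<alpha> z w)"
        using bounded AE_space
      proof eventually_elim
        case (elim w)
        show ?case
        proof (cases "w \<in> G")
          case True
          have "kernel_sq \<alpha> z w * \<phi> w \<le> kernel_sq \<alpha> z w * m"
            using elim by (intro mult_left_mono kernel_sq_nonneg) auto
          moreover have "0 \<le> r * kernel_sq \<alpha> z w" using r by (simp add: kernel_sq_nonneg)
          ultimately show ?thesis using True by (simp add: mult.commute)
        next
          case False
          then have "\<phi> w \<le> r" using elim by (simp add: G_def)
          then have "kernel_sq \<alpha> z w * \<phi> w \<le> kernel_sq \<alpha> z w * r"
            by (intro mult_left_mono kernel_sq_nonneg) auto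
          then show ?thesis using False by (simp add: mult.commute)
        qed
      qed
    qed (use kernel_energy_integrable[OF z] kernel_sq_integrable[OF alpha z] IG in simp_all)
    also have "\<dots> = r * kernel_mass z + m * (LINT w|weighted_area \<alpha>. indicator G w * kernel_sq \<alpha> z w)"
      using kernel_sq_integrable[OF alpha z] IG by simp
    finally have "c * kernel_mass z \<le> r * kernel_mass z + m * (LINT w|weighted_area \<alpha>. indicator G w * kernel_sq \<alpha> z w)"
      using 1 by linarith
    then have "c / 2 * kernel_mass z \<le> m * (LINT w|weighted_area \<alpha>. indicator G w * kernel_sq \<alpha> z w)"
      by (simp add: r_def)
    then have le: "\<kappa> * kernel_mass z \<le> (LINT w|weighted_area \<alpha>. indicator G w * kernel_sq \<alpha> z w)"
      using m_pos by (simp add: \<kappa>_def field_simps)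
    have "(\<integral>\<^sup>+u. ennreal (indicator G u * kernel_sq \<alpha> z u) \<partial>weighted_area \<alpha>)
        = ennreal (LINT w|weighted_area \<alpha>. indicator G w * kernel_sq \<alpha> z w)"
      by (rule nn_integral_eq_integral[OF IG]) (simp add: kernel_sq_nonneg)
    moreover have "ennreal (indicator G u * kernel_sq \<alpha> z u) = ennreal (kernel_sq \<alpha> z u) * indicator G u" for u
      by (simp add: indicator_def)
    ultimately show ?thesis using le k by (simp add: kp(2) ennreal_leI flip: ennreal_mult')
  qed
  have "AE z in weighted_area \<alpha>. ennreal \<kappa> * (\<integral>\<^sup>+u. ennreal (kernel_sq \<alpha> z u) \<partial>weighted_area \<alpha>)
      \<le> (\<integral>\<^sup>+u\<in>G. ennreal (kernel_sq \<alpha> z u) \<partial>weighted_area \<alpha>)"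
    using g(1) g(2) AE_space
  proof eventually_elim
    case (elim z)
    have "1 = cmod (?b z) * cmod (g z)" using elim(2) by (metis norm_mult norm_one)
    also have "\<dots> \<le> cmod (?b z) * max K 1" using elim(1) by (intro mult_left_mono) auto
    finally have "c \<le> cmod (?b z)" by (simp add: c_def divide_le_eq)
    then show ?case using elim(3) by (intro key) auto
  qed
  then have "AE z in area. ennreal \<kappa> * (\<integral>\<^sup>+u. ennreal (kernel_sq \<alpha> z u) \<partial>weighted_area \<alpha>)
      \<le> (\<integral>\<^sup>+u\<in>G. ennreal (kernel_sq \<alpha> z u) \<partial>weighted_area \<alpha>)"
    unfolding AE_weighted_area[OF alpha] .
  then obtain d where d: "d > 0" "\<And>w s. cmod w = 1 \<Longrightarrow> 0 < s \<Longrightarrow> s \<le> 2 \<Longrightarrow> d * s\<^sup>2 \<le> measure area (G \<inter> ball w s)"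
    by (rule boundary_ball_area_of_kernel[OF alpha G k]) blast
  \<comment> \<open>The minimum only ensures that the proportion is below 1.\<close>
  define \<delta> where "\<delta> = min d (1 / 2)"
  have "\<delta> * measure area (disk \<inter> ball w \<rho>) \<le> measure area (G \<inter> ball w \<rho>)"
    if w: "cmod w = 1" and rho: "0 < \<rho>" for w \<rho>
  proof -
    \<comment> \<open>A ball of radius 2 about a point of the circle already contains the disk, so
      larger radii reduce to this one.\<close>
    define s where "s = min \<rho> 2"
    have s: "0 < s" "s \<le> 2" "s \<le> \<rho>" using rho by (auto simp: s_def)
    have GB: "G \<inter> ball w \<rho> \<in> sets area"
    proof -
      have "G \<inter> ball w \<rho> = G \<inter> (disk \<inter> ball w \<rho>)" by (auto simp: G_def)
      moreover have "disk \<inter> ball w \<rho> \<in> sets area" by (intro borel_sets_area) auto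
      ultimately show ?thesis using G by auto
    qed
    have "disk \<inter> ball w \<rho> \<subseteq> disk \<inter> ball w s"
    proof
      fix z assume z: "z \<in> disk \<inter> ball w \<rho>"
      then have "dist w z < 2" using w norm_triangle_ineq4[of w z] by (simp add: dist_norm)
      then show "z \<in> disk \<inter> ball w s" using z by (simp add: s_def)
    qed
    moreover have "disk \<inter> ball w s \<in> sets area" by (intro borel_sets_area) auto
    ultimately have "measure area (disk \<inter> ball w \<rho>) \<le> measure area (disk \<inter> ball w s)"
      by (rule area.finite_measure_mono)
    also have "\<dots> \<le> s\<^sup>2" using emeasure_area_ball(1)[of s w] s by (simp add: area.emeasure_eq_measure)
    finally have "\<delta> * measure area (disk \<inter> ball w \<rho>) \<le> d * s\<^sup>2" using d(1) by (intro mult_mono) (auto simp: \<delta>_def)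
    also have "\<dots> \<le> measure area (G \<inter> ball w s)" by (rule d(2)[OF w s(1,2)])
    also have "\<dots> \<le> measure area (G \<inter> ball w \<rho>)" using s GB by (intro area.finite_measure_mono) auto
    finally show ?thesis .
  qed
  moreover have "\<delta> \<in> {0<..<1}" using d(1) by (auto simp: \<delta>_def)
  ultimately show ?thesis
    using r unfolding G_def by (intro exI[of _ r] conjI bexI[of _ \<delta>]) auto
qed

end

section \<open>Closing the cycle of conditions\<close>

lemma reverse_carleson_of_boundary_balls:
  assumes al: "\<alpha> > -1" and G: "G \<in> sets area" and d: "0 < \<delta>" "\<delta> < 1"
    and bd: "\<forall>w\<in>sphere 0 1. \<forall>\<rho>>0. measure area (G \<inter> ball w \<rho>) \<ge> \<delta> * measure area (disk \<inter> ball w \<rho>)"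
  shows "reverse_carleson \<alpha> G"
proof -
  obtain \<eta> \<delta>' where eta: "0 < \<eta>" "\<eta> < 1" "0 < \<delta>'"
    and inner: "\<And>b. b \<in> disk \<Longrightarrow> ennreal (\<delta>' * (1 - cmod b)\<^sup>2) \<le> emeasure area (G \<inter> ball b (\<eta> * (1 - cmod b)))"
    by (rule inner_balls_of_boundary_balls[OF G d bd]) blast
  obtain C where C: "C > 0" "\<And>f. f holomorphic_on disk \<Longrightarrow>
    sq_integral (weighted_area \<alpha>) f < \<infinity> \<Longrightarrow>
    sq_integral (weighted_area \<alpha>) f
      \<le> ennreal C * sq_integral_on (weighted_area \<alpha>) G f"
    by (rule reverse_carleson_of_inner_balls[OF al G eta inner]) (blast, rule that)
  have Gw: "G \<in> sets (weighted_area \<alpha>)" using G by (simp add: sets_area sets_weighted_area)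
  have "sqnorm \<alpha> f \<le> C * (LINT z:G|weighted_area \<alpha>. (cmod (f z))\<^sup>2)" if f: "f \<in> bergman \<alpha>" for f
  proof -
    note nn = nn_integral_sqnorm[OF bergman_L2[OF f]]
    have IG: "integrable (weighted_area \<alpha>) (\<lambda>z. indicator G z *\<^sub>R (cmod (f z))\<^sup>2)"
      by (rule integrable_mult_indicator[OF Gw L2_integrable[OF bergman_L2[OF f]]])
    have "(\<integral>\<^sup>+z. ennreal (indicator G z *\<^sub>R (cmod (f z))\<^sup>2) \<partial>weighted_area \<alpha>)
        = ennreal (LINT z:G|weighted_area \<alpha>. (cmod (f z))\<^sup>2)"
      unfolding set_lebesgue_integral_def by (rule nn_integral_eq_integral[OF IG]) simp
    moreover have "ennreal (indicator G z *\<^sub>R (cmod (f z))\<^sup>2) = ennreal ((cmod (f z))\<^sup>2) * indicator G z" for z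
      by (simp add: indicator_def)
    ultimately have "ennreal (sqnorm \<alpha> f) \<le> ennreal C * ennreal (LINT z:G|weighted_area \<alpha>. (cmod (f z))\<^sup>2)"
      using C(2)[OF bergman_holomorphic[OF f]] by (simp add: nn)
    moreover have "0 \<le> (LINT z:G|weighted_area \<alpha>. (cmod (f z))\<^sup>2)"
      unfolding set_lebesgue_integral_def by simp
    ultimately show ?thesis using C(1) by (simp add: ennreal_le_iff flip: ennreal_mult)
  qed
  then show ?thesis unfolding reverse_carleson_def using C(1) G by blast
qed

text \<open>The symbol exceeds \<open>r\<close> on the set and is nonnegative almost everywhere off
  it, so the energy is at least \<open>r\<close> times the mass on the set.\<close>

lemma (in bounded_symbol) coercive_of_reverse_carleson:
  assumes r: "0 < r" and rc: "reverse_carleson \<alpha> {z \<in> disk. \<phi> z > r}"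
  shows "\<exists>C>0. \<forall>f\<in>bergman \<alpha>. energy f \<ge> C * sqnorm \<alpha> f"
proof -
  define G where "G = {z \<in> disk. \<phi> z > r}"
  obtain C where C: "0 < C" "\<And>f. f \<in> bergman \<alpha> \<Longrightarrow> sqnorm \<alpha> f \<le> C * (LINT z:G|weighted_area \<alpha>. (cmod (f z))\<^sup>2)"
    using rc unfolding reverse_carleson_def G_def by blast
  have Gw: "G \<in> sets (weighted_area \<alpha>)"
    using symbol_set_in_area by (simp add: G_def sets_area sets_weighted_area)
  have "r / C * sqnorm \<alpha> f \<le> energy f" if f: "f \<in> bergman \<alpha>" for f
  proof -
    have "sqnorm \<alpha> f \<le> C * (LINT z:G|weighted_area \<alpha>. (cmod (f z))\<^sup>2)" by (rule C(2)[OF f])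
    then have "r / C * sqnorm \<alpha> f \<le> r / C * (C * (LINT z:G|weighted_area \<alpha>. (cmod (f z))\<^sup>2))"
      using r C(1) by (intro mult_left_mono) auto
    also have "\<dots> = (LINT z|weighted_area \<alpha>. r * (indicator G z *\<^sub>R (cmod (f z))\<^sup>2))"
      using C(1) by (simp add: set_lebesgue_integral_def)
    also have "\<dots> \<le> energy f"
      unfolding energy_def
    proof (rule integral_mono_AE)
      show "integrable (weighted_area \<alpha>) (\<lambda>z. r * (indicator G z *\<^sub>R (cmod (f z))\<^sup>2))"
        by (intro Bochner_Integration.integrable_mult_right integrable_mult_indicator[OF Gw] L2_integrable[OF bergman_L2[OF f]])
      show "integrable (weighted_area \<alpha>) (\<lambda>z. (cmod (f z))\<^sup>2 * \<phi> z)"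
        by (rule energy_integrable[OF bergman_L2[OF f]])
      show "AE z in weighted_area \<alpha>. r * (indicator G z *\<^sub>R (cmod (f z))\<^sup>2) \<le> (cmod (f z))\<^sup>2 * \<phi> z"
        using nonneg by eventually_elim
          (auto simp: indicator_def G_def mult.commute[of r] intro!: mult_left_mono)
    qed
    finally show ?thesis .
  qed
  then show ?thesis using r C(1) by (intro exI[of _ "r / C"]) auto
qed

lemma all_equivalentI5:
  assumes "P1 \<Longrightarrow> P5" "P5 \<Longrightarrow> P1" "P5 \<Longrightarrow> P2" "P2 \<Longrightarrow> P4" "P4 \<Longrightarrow> P3" "P3 \<Longrightarrow> P5"
  shows "all_equivalent [P1, P2, P3, P4, P5]"
proof -
  have "P1 \<longleftrightarrow> P5" using assms(1,2) by (rule iffI)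
  moreover have "P4 \<longleftrightarrow> P5" using assms(3-6) by iprover
  moreover have "P3 \<longleftrightarrow> P5" using assms(3-6) by iprover
  moreover have "P2 \<longleftrightarrow> P5" using assms(3-6) by iprover
  ultimately show ?thesis by (simp add: all_equivalent_def)
qed

theorem theorem4p4:
  fixes \<alpha> :: real and \<phi> :: "complex \<Rightarrow> real"
  assumes "\<alpha> > -1"
    and "(\<lambda>z. complex_of_real (\<phi> z)) \<in> Linfty \<alpha>"
    and "AE z in weighted_area \<alpha>. \<phi> z \<ge> 0"
  shows "all_equivalent
    [invertible_operator \<alpha> (toeplitz \<alpha> (\<lambda>z. complex_of_real (\<phi> z))),
     invertible_Linfty \<alpha> (berezin \<alpha> (\<lambda>z. complex_of_real (\<phi> z))),
     \<exists>r>0. reverse_carleson \<alpha> {z \<in> disk. \<phi> z > r},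
     \<exists>r>0. \<exists>\<delta>\<in>{0<..<1}. \<forall>w\<in>sphere 0 1. \<forall>\<rho>>0.
       measure area ({z \<in> disk. \<phi> z > r} \<inter> ball w \<rho>) \<ge> \<delta> * measure area (disk \<inter> ball w \<rho>),
     \<exists>C>0. \<forall>f\<in>bergman \<alpha>.
       (LINT z|weighted_area \<alpha>. (cmod (f z))\<^sup>2 * \<phi> z)
         \<ge> C * (LINT z|weighted_area \<alpha>. (cmod (f z))\<^sup>2)]"
    (is "all_equivalent [?P1, ?P2, ?P3, ?P4, ?P5]")
proof -
  obtain K where K: "(\<lambda>z. complex_of_real (\<phi> z)) \<in> borel_measurable (weighted_area \<alpha>)"
    "AE z in weighted_area \<alpha>. cmod (complex_of_real (\<phi> z)) \<le> K"
    using assms(2) unfolding Linfty_def by blast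
  \<comment> \<open>The symbol may vanish almost everywhere, so \<open>K\<close> may be 0, whereas
    the locale asks for a positive bound.\<close>
  interpret bounded_symbol \<alpha> \<phi> "max K 1"
  proof
    show "\<phi> \<in> borel_measurable (weighted_area \<alpha>)"
      using measurable_compose[OF K(1) borel_measurable_Re] by simp
    show "AE z in weighted_area \<alpha>. \<phi> z \<le> max K 1"
      using K(2) by eventually_elim simp
  qed (use assms in auto)
  show ?thesis
  proof (rule all_equivalentI5)
    show "?P1 \<Longrightarrow> ?P5"
      using coercive_of_invertible unfolding energy_def .
    show ?P1 if P5: "?P5"
    proof -
      obtain C where "C > 0" "\<And>f. f \<in> bergman \<alpha> \<Longrightarrow> C * sqnorm \<alpha> f \<le> energy f"
        using P5 unfolding energy_def by blast
      then show ?P1 by (rule invertible_of_coercive)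
    qed
    show ?P2 if P5: "?P5"
    proof -
      obtain C where "C > 0" "\<And>f. f \<in> bergman \<alpha> \<Longrightarrow> C * sqnorm \<alpha> f \<le> energy f"
        using P5 unfolding energy_def by blast
      then show ?P2 by (rule berezin_invertible_of_coercive)
    qed
    show "?P2 \<Longrightarrow> ?P4" by (rule boundary_balls_of_berezin)
    show ?P3 if P4: "?P4"
    proof -
      obtain r \<delta> where r: "r > 0" and d: "\<delta> \<in> {0<..<1}" and
        bd: "\<forall>w\<in>sphere 0 1. \<forall>\<rho>>0.
          measure area ({z \<in> disk. \<phi> z > r} \<inter> ball w \<rho>) \<ge> \<delta> * measure area (disk \<inter> ball w \<rho>)"
        using P4 by blast
      have "reverse_carleson \<alpha> {z \<in> disk. \<phi> z > r}"
        using d by (intro reverse_carleson_of_boundary_balls[OF assms(1) symbol_set_in_area _ _ bd]) simp_all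
      then show ?P3 using r by blast
    qed
    show ?P5 if P3: "?P3"
      using P3 coercive_of_reverse_carleson unfolding energy_def by blast
  qed
qed

end
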